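(* Let $0\to C\xrightarrow{\mathfrak e}\Omega\xrightarrow{\mathfrak p}A\otimes B\to 0$ be a DVB sequence over $M$, i.e. a short exact sequence of vector bundles over $M$ (over the identity of $M$), where $A,B,C,\Omega$ are vector bundles over $M$. Put $$\mathfrak D(\Omega)=\{(\omega,a,b)\in\Omega\times_M A\times_M B \;:\; \mathfrak p(\omega)=a\otimes b\},$$ with the projections $q^D_A:\mathfrak D(\Omega)\to A$, $(\omega,a,b)\mapsto a$, and $q^D_B:\mathfrak D(\Omega)\to B$, $(\omega,a,b)\mapsto b$. Then, with the natural fibrewise linear structures given in the context, $(\mathfrak D(\Omega);A,B;M)$ is a double vector bundle with vertical bundle projection $q^D_A$ and horizontal bundle projection $q^D_B$.
   Context: All manifolds and vector bundles are smooth, real, of finite dimension/rank. Double vector bundle: a double vector bundle $(D;A,B;M)$ consists of vector bundles $q_A:A\to M$, $q_B:B\to M$ and a manifold $D$ with two vector bundle structures $q^D_A:D\to A$ and $q^D_B:D\to B$, with $q_A\circ q^D_A=q_B\circ q^D_B$, such that each of the structure maps (bundle projection, zero section, addition, scalar multiplication) of each vector bundle structure on $D$ is a morphism of vector bundles with respect to the other structures. Linear structures on $\mathfrak D(\Omega)$: over a fixed $a\in A$, $$r\cdot_A(\omega_1,a,b_1)+_A(\omega_2,a,b_2)=(r\omega_1+\omega_2,\,a,\,rb_1+b_2),$$ and over a fixed $b\in B$, $$r\cdot_B(\omega_1,a_1,b)+_B(\omega_2,a_2,b)=(r\omega_1+\omega_2,\,ra_1+a_2,\,b).$$ *)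

theory Defs
  imports "HOL-Analysis.Analysis"
begin

section \<open>Model spaces\<close>

text \<open>
  The class \<open>euclidean_space\<close> without its axiom \<open>Basis \<noteq> {}\<close>, so that manifolds of dimension 0
  and vector bundles of rank 0 are covered as well.
\<close>

class euclidean_model = real_inner +
  assumes ex_orthonormal_basis:
    "\<exists>B. finite B \<and> (\<forall>u\<in>B. \<forall>v\<in>B. inner u v = (if u = v then 1 else 0)) \<and>
         (\<forall>x. (\<forall>u\<in>B. inner x u = 0) \<longrightarrow> x = 0)"

subclass (in euclidean_space) euclidean_model
proof
  show "\<exists>B. finite B \<and> (\<forall>u\<in>B. \<forall>v\<in>B. inner u v = (if u = v then 1 else 0)) \<and>
         (\<forall>x. (\<forall>u\<in>B. inner x u = 0) \<longrightarrow> x = 0)"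
    by (rule exI[of _ Basis]) (simp add: inner_Basis euclidean_all_zero_iff)
qed

instance prod :: (euclidean_model, euclidean_model) euclidean_model
proof
  obtain B :: "'a set" where B: "finite B"
      "\<And>u v. u \<in> B \<Longrightarrow> v \<in> B \<Longrightarrow> inner u v = (if u = v then 1 else 0)"
      "\<And>x. (\<forall>u\<in>B. inner x u = 0) \<Longrightarrow> x = 0"
    using ex_orthonormal_basis by metis
  obtain C :: "'b set" where C: "finite C"
      "\<And>u v. u \<in> C \<Longrightarrow> v \<in> C \<Longrightarrow> inner u v = (if u = v then 1 else 0)"
      "\<And>x. (\<forall>u\<in>C. inner x u = 0) \<Longrightarrow> x = 0"
    using ex_orthonormal_basis by metis
  have "0 \<notin> B" "0 \<notin> C"
    using B(2)[of 0 0] C(2)[of 0 0] by auto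
  let ?D = "(\<lambda>u. (u, 0)) ` B \<union> (\<lambda>v. (0, v)) ` C"
  have "finite ?D"
    using B(1) C(1) by simp
  moreover have "\<forall>u\<in>?D. \<forall>v\<in>?D. inner u v = (if u = v then 1 else 0)"
    using B(2) C(2) \<open>0 \<notin> B\<close> \<open>0 \<notin> C\<close> by (auto split: if_splits)
  moreover have "\<forall>x. (\<forall>u\<in>?D. inner x u = 0) \<longrightarrow> x = 0"
    using B(3) C(3) by (auto simp: inner_prod_def ball_Un zero_prod_def)
  ultimately show "\<exists>D::('a \<times> 'b) set. finite D \<and>
      (\<forall>u\<in>D. \<forall>v\<in>D. inner u v = (if u = v then 1 else 0)) \<and>
      (\<forall>x. (\<forall>u\<in>D. inner x u = 0) \<longrightarrow> x = 0)"
    by blast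
qed

text \<open>A zero-dimensional model space.\<close>

datatype origin = Origin

instantiation origin :: euclidean_model
begin

definition zero_origin :: origin where "zero_origin = Origin"
definition plus_origin :: "origin \<Rightarrow> origin \<Rightarrow> origin" where "plus_origin x y = Origin"
definition minus_origin :: "origin \<Rightarrow> origin \<Rightarrow> origin" where "minus_origin x y = Origin"
definition uminus_origin :: "origin \<Rightarrow> origin" where "uminus_origin x = Origin"
definition scaleR_origin :: "real \<Rightarrow> origin \<Rightarrow> origin" where "scaleR_origin r x = Origin"
definition inner_origin :: "origin \<Rightarrow> origin \<Rightarrow> real" where "inner_origin x y = 0"
definition norm_origin :: "origin \<Rightarrow> real" where "norm_origin x = 0"
definition dist_origin :: "origin \<Rightarrow> origin \<Rightarrow> real" where "dist_origin x y = 0"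
definition sgn_origin :: "origin \<Rightarrow> origin" where "sgn_origin x = Origin"
definition uniformity_origin :: "(origin \<times> origin) filter" where
  "uniformity_origin = (INF e\<in>{0 <..}. principal {(x, y). dist x y < e})"
definition open_origin :: "origin set \<Rightarrow> bool" where
  "open_origin U \<longleftrightarrow> (\<forall>x\<in>U. eventually (\<lambda>(x', y). x' = x \<longrightarrow> y \<in> U) uniformity)"

instance
proof
  have eq: "x = y" for x y :: origin
    by (cases x; cases y) simp
  fix x y z :: origin and a b :: real and U :: "origin set"
  show "dist x y = norm (x - y)" "inner x y = inner y x"
    "inner (x + y) z = inner x z + inner y z" "inner (scaleR a x) y = a * inner x y"
    "0 \<le> inner x x" "norm x = sqrt (inner x x)"
    by (simp_all add: dist_origin_def norm_origin_def inner_origin_def)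
  show "inner x x = 0 \<longleftrightarrow> x = 0"
    by (simp add: inner_origin_def eq[of x 0])
  show "(uniformity :: (origin \<times> origin) filter)
      = (INF e\<in>{0 <..}. principal {(x, y). dist x y < e})"
    by (rule uniformity_origin_def)
  show "open U \<longleftrightarrow> (\<forall>x\<in>U. eventually (\<lambda>(x', y). x' = x \<longrightarrow> y \<in> U) uniformity)"
    by (rule open_origin_def)
  show "\<exists>B::origin set. finite B \<and> (\<forall>u\<in>B. \<forall>v\<in>B. inner u v = (if u = v then 1 else 0)) \<and>
      (\<forall>x. (\<forall>u\<in>B. inner x u = 0) \<longrightarrow> x = 0)"
    by (rule exI[of _ "{}"]) (simp add: eq[of _ 0])
qed (metis (full_types) origin.exhaust)+

end


section \<open>Smooth maps between model spaces\<close>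

text \<open>
  For open \<open>S\<close> this is \<open>C\<^sup>k\<close>: since the model spaces are finite-dimensional, \<open>f\<close> is of class
  \<open>C\<^sup>k\<^sup>+\<^sup>1\<close> iff it is differentiable and all its directional derivatives are of class \<open>C\<^sup>k\<close>.
\<close>

primrec Ck_on ::
  "nat \<Rightarrow> 'a::real_normed_vector set \<Rightarrow> ('a \<Rightarrow> 'b::real_normed_vector) \<Rightarrow> bool" where
  "Ck_on 0 S f \<longleftrightarrow> continuous_on S f"
| "Ck_on (Suc k) S f \<longleftrightarrow> (\<forall>x\<in>S. f differentiable (at x)) \<and>
     (\<forall>v. Ck_on k S (\<lambda>x. frechet_derivative f (at x) v))"

definition smooth_on ::
  "'a::real_normed_vector set \<Rightarrow> ('a \<Rightarrow> 'b::real_normed_vector) \<Rightarrow> bool" where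
  "smooth_on S f \<longleftrightarrow> (\<forall>k. Ck_on k S f)"


section \<open>Smooth manifolds\<close>

text \<open>
  A manifold is a topology together with a smooth atlas, which need not be maximal.  A chart is a
  pair \<open>(U, \<phi>)\<close>; the values of \<open>\<phi>\<close> outside \<open>U\<close> are irrelevant.
\<close>

record ('x, 'e) manifold =
  mtop :: "'x topology"
  atlas :: "('x set \<times> ('x \<Rightarrow> 'e)) set"

abbreviation carrier :: "('x, 'e) manifold \<Rightarrow> 'x set" where
  "carrier N \<equiv> topspace (mtop N)"

definition smooth_manifold :: "('x, 'e::euclidean_model) manifold \<Rightarrow> bool" where
  "smooth_manifold N \<longleftrightarrow>
     Hausdorff_space (mtop N) \<and> second_countable (mtop N) \<and>
     carrier N = (\<Union>(U, \<phi>)\<in>atlas N. U) \<and>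
     (\<forall>(U, \<phi>)\<in>atlas N. openin (mtop N) U \<and> open (\<phi> ` U) \<and>
        homeomorphic_map (subtopology (mtop N) U) (top_of_set (\<phi> ` U)) \<phi>) \<and>
     (\<forall>(U, \<phi>)\<in>atlas N. \<forall>(V, \<psi>)\<in>atlas N.
        smooth_on (\<phi> ` (U \<inter> V)) (\<psi> \<circ> inv_into U \<phi>))"

definition smooth_map ::
  "('x, 'e::euclidean_model) manifold \<Rightarrow> ('y, 'f::euclidean_model) manifold \<Rightarrow> ('x \<Rightarrow> 'y) \<Rightarrow> bool"
where
  "smooth_map N N' f \<longleftrightarrow>
     continuous_map (mtop N) (mtop N') f \<and>
     (\<forall>(U, \<phi>)\<in>atlas N. \<forall>(V, \<psi>)\<in>atlas N'.
        smooth_on (\<phi> ` {x \<in> U. f x \<in> V}) (\<psi> \<circ> f \<circ> inv_into U \<phi>))"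

definition diffeomorphism ::
  "('x, 'e::euclidean_model) manifold \<Rightarrow> ('y, 'f::euclidean_model) manifold \<Rightarrow> ('x \<Rightarrow> 'y) \<Rightarrow> bool"
where
  "diffeomorphism N N' f \<longleftrightarrow>
     smooth_map N N' f \<and> bij_betw f (carrier N) (carrier N') \<and>
     smooth_map N' N (inv_into (carrier N) f)"

definition open_submanifold :: "('x, 'e) manifold \<Rightarrow> 'x set \<Rightarrow> ('x, 'e) manifold" where
  "open_submanifold N W =
     \<lparr>mtop = subtopology (mtop N) W, atlas = (\<lambda>(U, \<phi>). (U \<inter> W, \<phi>)) ` atlas N\<rparr>"

definition model_manifold :: "('e::euclidean_model, 'e) manifold" where
  "model_manifold = \<lparr>mtop = euclidean, atlas = {(UNIV, id)}\<rparr>"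

definition prod_manifold ::
  "('x, 'e) manifold \<Rightarrow> ('y, 'f) manifold \<Rightarrow> ('x \<times> 'y, 'e \<times> 'f) manifold" where
  "prod_manifold N N' =
     \<lparr>mtop = prod_topology (mtop N) (mtop N'),
      atlas = {(U \<times> V, map_prod \<phi> \<psi>) | U \<phi> V \<psi>. (U, \<phi>) \<in> atlas N \<and> (V, \<psi>) \<in> atlas N'}\<rparr>"

text \<open>Smoothness of a map defined on an arbitrary subset: local existence of smooth extensions.\<close>

definition smooth_map_on ::
  "('x, 'e::euclidean_model) manifold \<Rightarrow> 'x set \<Rightarrow> ('y, 'f::euclidean_model) manifold
     \<Rightarrow> ('x \<Rightarrow> 'y) \<Rightarrow> bool" where
  "smooth_map_on N S N' f \<longleftrightarrow> S \<subseteq> carrier N \<and>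
     (\<forall>p\<in>S. \<exists>W g. openin (mtop N) W \<and> p \<in> W \<and>
        smooth_map (open_submanifold N W) N' g \<and> (\<forall>x\<in>W \<inter> S. g x = f x))"

text \<open>
  \<open>D\<close>, with its own smooth structure, is an embedded submanifold of \<open>N\<close>: it carries the subspace
  topology and the inclusion is an immersion.  This determines the smooth structure of \<open>D\<close>.
\<close>

definition embedded_submanifold ::
  "('x, 'd::euclidean_model) manifold \<Rightarrow> ('x, 'e::euclidean_model) manifold \<Rightarrow> bool" where
  "embedded_submanifold D N \<longleftrightarrow>
     smooth_manifold D \<and> carrier D \<subseteq> carrier N \<and>
     mtop D = subtopology (mtop N) (carrier D) \<and>
     smooth_map D N (\<lambda>x. x) \<and>
     (\<forall>(U, \<phi>)\<in>atlas D. \<forall>(V, \<psi>)\<in>atlas N. \<forall>p\<in>U \<inter> V.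
        inj (frechet_derivative (\<psi> \<circ> inv_into U \<phi>) (at (\<phi> p))))"

text \<open>The same property of a mere subset, expressed by slice charts.\<close>

definition embedded_subset :: "('x, 'e::euclidean_model) manifold \<Rightarrow> 'x set \<Rightarrow> bool" where
  "embedded_subset N S \<longleftrightarrow> S \<subseteq> carrier N \<and>
     (\<exists>L :: 'e set. subspace L \<and>
       (\<forall>p\<in>S. \<exists>U (\<phi> :: 'x \<Rightarrow> 'e). p \<in> U \<and> openin (mtop N) U \<and> open (\<phi> ` U) \<and>
          diffeomorphism (open_submanifold N U) (open_submanifold model_manifold (\<phi> ` U)) \<phi> \<and>
          \<phi> ` (U \<inter> S) = \<phi> ` U \<inter> L))"


section \<open>Real vector spaces and tensor products with explicit carriers\<close>

definition real_vector_space_on ::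
  "'v set \<Rightarrow> ('v \<Rightarrow> 'v \<Rightarrow> 'v) \<Rightarrow> 'v \<Rightarrow> (real \<Rightarrow> 'v \<Rightarrow> 'v) \<Rightarrow> bool" where
  "real_vector_space_on S add z smul \<longleftrightarrow>
     z \<in> S \<and> (\<forall>x\<in>S. \<forall>y\<in>S. add x y \<in> S) \<and> (\<forall>r. \<forall>x\<in>S. smul r x \<in> S) \<and>
     (\<forall>x\<in>S. \<forall>y\<in>S. \<forall>w\<in>S. add (add x y) w = add x (add y w)) \<and>
     (\<forall>x\<in>S. \<forall>y\<in>S. add x y = add y x) \<and>
     (\<forall>x\<in>S. add z x = x) \<and> (\<forall>x\<in>S. \<exists>y\<in>S. add x y = z) \<and>
     (\<forall>r. \<forall>x\<in>S. \<forall>y\<in>S. smul r (add x y) = add (smul r x) (smul r y)) \<and>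
     (\<forall>r s. \<forall>x\<in>S. smul (r + s) x = add (smul r x) (smul s x)) \<and>
     (\<forall>r s. \<forall>x\<in>S. smul (r * s) x = smul r (smul s x)) \<and>
     (\<forall>x\<in>S. smul 1 x = x)"

definition linear_map_on ::
  "'v set \<Rightarrow> ('v \<Rightarrow> 'v \<Rightarrow> 'v) \<Rightarrow> (real \<Rightarrow> 'v \<Rightarrow> 'v) \<Rightarrow>
   'w set \<Rightarrow> ('w \<Rightarrow> 'w \<Rightarrow> 'w) \<Rightarrow> (real \<Rightarrow> 'w \<Rightarrow> 'w) \<Rightarrow> ('v \<Rightarrow> 'w) \<Rightarrow> bool" where
  "linear_map_on S add smul S' add' smul' f \<longleftrightarrow>
     (\<forall>x\<in>S. f x \<in> S') \<and> (\<forall>x\<in>S. \<forall>y\<in>S. f (add x y) = add' (f x) (f y)) \<and>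
     (\<forall>r. \<forall>x\<in>S. f (smul r x) = smul' r (f x))"


section \<open>Vector bundles\<close>

record ('x, 'e, 'y, 'm) vbundle =
  vtotal :: "('x, 'e) manifold"
  vbase :: "('y, 'm) manifold"
  vproj :: "'x \<Rightarrow> 'y"
  vzero :: "'y \<Rightarrow> 'x"
  vadd :: "'x \<Rightarrow> 'x \<Rightarrow> 'x"
  vscale :: "real \<Rightarrow> 'x \<Rightarrow> 'x"

definition fibre :: "('x, 'e, 'y, 'm) vbundle \<Rightarrow> 'y \<Rightarrow> 'x set" where
  "fibre E p = {e \<in> carrier (vtotal E). vproj E e = p}"

text \<open>
  Over the open set \<open>U\<close>, the map \<open>e \<mapsto> (vproj E e, \<phi> e)\<close> is a trivialisation with typical fibre
  the model space \<open>'f\<close>.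
\<close>

definition local_trivialization ::
  "('x, 'e::euclidean_model, 'y, 'm::euclidean_model) vbundle \<Rightarrow> 'y set
     \<Rightarrow> ('x \<Rightarrow> 'f::euclidean_model) \<Rightarrow> bool" where
  "local_trivialization E U \<phi> \<longleftrightarrow>
     openin (mtop (vbase E)) U \<and>
     diffeomorphism
       (open_submanifold (vtotal E) {e \<in> carrier (vtotal E). vproj E e \<in> U})
       (prod_manifold (open_submanifold (vbase E) U) model_manifold)
       (\<lambda>e. (vproj E e, \<phi> e)) \<and>
     (\<forall>p\<in>U. linear_map_on (fibre E p) (vadd E) (vscale E) UNIV (+) (*\<^sub>R) \<phi>)"

definition vector_bundle ::
  "'f::euclidean_model itself
     \<Rightarrow> ('x, 'e::euclidean_model, 'y, 'm::euclidean_model) vbundle \<Rightarrow> bool" where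
  "vector_bundle F E \<longleftrightarrow>
     smooth_manifold (vtotal E) \<and> smooth_manifold (vbase E) \<and>
     smooth_map (vtotal E) (vbase E) (vproj E) \<and>
     (\<forall>p\<in>carrier (vbase E).
        real_vector_space_on (fibre E p) (vadd E) (vzero E p) (vscale E)) \<and>
     (\<forall>p\<in>carrier (vbase E). \<exists>U (\<phi> :: 'x \<Rightarrow> 'f). p \<in> U \<and> local_trivialization E U \<phi>)"

definition prod_vbundle ::
  "('x, 'e, 'y, 'm) vbundle \<Rightarrow> ('x', 'e', 'y', 'm') vbundle
     \<Rightarrow> ('x \<times> 'x', 'e \<times> 'e', 'y \<times> 'y', 'm \<times> 'm') vbundle" where
  "prod_vbundle E E' =
     \<lparr>vtotal = prod_manifold (vtotal E) (vtotal E'),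
      vbase = prod_manifold (vbase E) (vbase E'),
      vproj = map_prod (vproj E) (vproj E'),
      vzero = map_prod (vzero E) (vzero E'),
      vadd = (\<lambda>(x, x') (y, y'). (vadd E x y, vadd E' x' y')),
      vscale = (\<lambda>r. map_prod (vscale E r) (vscale E' r))\<rparr>"

text \<open>
  \<open>X\<close> is (the total space of) a vector subbundle of \<open>E\<close> over the embedded submanifold \<open>S\<close> of the
  base: locally there are trivialisations of \<open>E\<close> which map the fibres of \<open>X\<close> over \<open>S\<close> to a fixed
  linear subspace of the typical fibre.
\<close>

definition vector_subbundle ::
  "'f::euclidean_model itself \<Rightarrow> ('x, 'e::euclidean_model, 'y, 'm::euclidean_model) vbundle
     \<Rightarrow> 'x set \<Rightarrow> 'y set \<Rightarrow> bool" where
  "vector_subbundle F E X S \<longleftrightarrow>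
     embedded_subset (vbase E) S \<and> X \<subseteq> carrier (vtotal E) \<and> vproj E ` X \<subseteq> S \<and>
     (\<exists>L. subspace L \<and>
       (\<forall>p\<in>S. \<exists>U (\<phi> :: 'x \<Rightarrow> 'f). p \<in> U \<and> local_trivialization E U \<phi> \<and>
          {e \<in> X. vproj E e \<in> U}
            = {e \<in> carrier (vtotal E). vproj E e \<in> S \<inter> U \<and> \<phi> e \<in> L}))"

text \<open>
  Morphisms \<open>\<Phi>\<close> over \<open>\<phi>\<close> whose domain is the restriction of the bundle structure of \<open>E\<close> to a
  vector subbundle \<open>X\<close> over \<open>S\<close>.
\<close>

definition vb_morphism_on ::
  "('x, 'e::euclidean_model, 'y, 'm::euclidean_model) vbundle \<Rightarrow> 'x set \<Rightarrow> 'y set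
     \<Rightarrow> ('x', 'e'::euclidean_model, 'y', 'm'::euclidean_model) vbundle
     \<Rightarrow> ('x \<Rightarrow> 'x') \<Rightarrow> ('y \<Rightarrow> 'y') \<Rightarrow> bool" where
  "vb_morphism_on E X S E' \<Phi> \<phi> \<longleftrightarrow>
     smooth_map_on (vtotal E) X (vtotal E') \<Phi> \<and>
     smooth_map_on (vbase E) S (vbase E') \<phi> \<and>
     (\<forall>e\<in>X. vproj E' (\<Phi> e) = \<phi> (vproj E e)) \<and>
     (\<forall>p\<in>S. linear_map_on (fibre E p \<inter> X) (vadd E) (vscale E)
        (fibre E' (\<phi> p)) (vadd E') (vscale E') \<Phi>)"

definition vb_morphism ::
  "('x, 'e::euclidean_model, 'y, 'm::euclidean_model) vbundle
     \<Rightarrow> ('x', 'e'::euclidean_model, 'y', 'm'::euclidean_model) vbundle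
     \<Rightarrow> ('x \<Rightarrow> 'x') \<Rightarrow> ('y \<Rightarrow> 'y') \<Rightarrow> bool" where
  "vb_morphism E E' \<Phi> \<phi> \<longleftrightarrow>
     smooth_map (vtotal E) (vtotal E') \<Phi> \<and> smooth_map (vbase E) (vbase E') \<phi> \<and>
     (\<forall>e\<in>carrier (vtotal E). vproj E' (\<Phi> e) = \<phi> (vproj E e)) \<and>
     (\<forall>p\<in>carrier (vbase E). linear_map_on (fibre E p) (vadd E) (vscale E)
        (fibre E' (\<phi> p)) (vadd E') (vscale E') \<Phi>)"

definition fibre_product ::
  "('x, 'e, 'y, 'm) vbundle \<Rightarrow> ('x', 'e', 'y, 'm) vbundle \<Rightarrow> ('x \<times> 'x') set" where
  "fibre_product E E' =
     {(e, e'). e \<in> carrier (vtotal E) \<and> e' \<in> carrier (vtotal E') \<and> vproj E e = vproj E' e'}"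


section \<open>Tensor products of vector bundles\<close>

definition bilinear_on_fibres ::
  "('x, 'e, 'y, 'm) vbundle \<Rightarrow> ('x', 'e', 'y, 'm) vbundle \<Rightarrow> 'y \<Rightarrow>
   'v set \<Rightarrow> ('v \<Rightarrow> 'v \<Rightarrow> 'v) \<Rightarrow> (real \<Rightarrow> 'v \<Rightarrow> 'v) \<Rightarrow> ('x \<Rightarrow> 'x' \<Rightarrow> 'v) \<Rightarrow> bool" where
  "bilinear_on_fibres A B p V add smul \<beta> \<longleftrightarrow>
     (\<forall>a\<in>fibre A p. linear_map_on (fibre B p) (vadd B) (vscale B) V add smul (\<beta> a)) \<and>
     (\<forall>b\<in>fibre B p. linear_map_on (fibre A p) (vadd A) (vscale A) V add smul (\<lambda>a. \<beta> a b))"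

text \<open>
  \<open>T\<close>, together with \<open>\<tau> a b = a \<otimes> b\<close>, is a tensor product of \<open>A\<close> and \<open>B\<close>: \<open>\<tau>\<close> is smooth and
  \<open>T\<^sub>p\<close> is the tensor product of \<open>A\<^sub>p\<close> and \<open>B\<^sub>p\<close> for each \<open>p\<close>.  The universal property is imposed
  for all vector spaces \<open>V\<close>, with arbitrary operations, whose elements are real sequences; up to
  isomorphism these include all finite-dimensional ones.
\<close>

definition tensor_product_bundle ::
  "('x, 'e::euclidean_model, 'y, 'm::euclidean_model) vbundle
     \<Rightarrow> ('x', 'e'::euclidean_model, 'y, 'm) vbundle
     \<Rightarrow> ('t, 'e''::euclidean_model, 'y, 'm) vbundle \<Rightarrow> ('x \<Rightarrow> 'x' \<Rightarrow> 't) \<Rightarrow> bool" where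
  "tensor_product_bundle A B T \<tau> \<longleftrightarrow>
     vbase A = vbase T \<and> vbase B = vbase T \<and>
     smooth_map_on (prod_manifold (vtotal A) (vtotal B)) (fibre_product A B) (vtotal T)
       (\<lambda>(a, b). \<tau> a b) \<and>
     (\<forall>p\<in>carrier (vbase T).
        bilinear_on_fibres A B p (fibre T p) (vadd T) (vscale T) \<tau> \<and>
        (\<forall>(V :: (nat \<Rightarrow> real) set) add z smul \<beta>.
           real_vector_space_on V add z smul \<and> bilinear_on_fibres A B p V add smul \<beta> \<longrightarrow>
           (\<exists>f. linear_map_on (fibre T p) (vadd T) (vscale T) V add smul f \<and>
                (\<forall>a\<in>fibre A p. \<forall>b\<in>fibre B p. f (\<tau> a b) = \<beta> a b) \<and>
                (\<forall>g. linear_map_on (fibre T p) (vadd T) (vscale T) V add smul g \<and>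
                     (\<forall>a\<in>fibre A p. \<forall>b\<in>fibre B p. g (\<tau> a b) = \<beta> a b) \<longrightarrow>
                     (\<forall>t\<in>fibre T p. g t = f t)))))"


section \<open>Short exact sequences of vector bundles over a common base\<close>

definition short_exact_sequence ::
  "('c, 'e1::euclidean_model, 'y, 'm::euclidean_model) vbundle \<Rightarrow> ('c \<Rightarrow> 'w)
     \<Rightarrow> ('w, 'e2::euclidean_model, 'y, 'm) vbundle \<Rightarrow> ('w \<Rightarrow> 't)
     \<Rightarrow> ('t, 'e3::euclidean_model, 'y, 'm) vbundle \<Rightarrow> bool" where
  "short_exact_sequence C \<e> W \<p> T \<longleftrightarrow>
     vbase C = vbase W \<and> vbase T = vbase W \<and>
     vb_morphism C W \<e> (\<lambda>x. x) \<and> vb_morphism W T \<p> (\<lambda>x. x) \<and>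
     (\<forall>x\<in>carrier (vbase W).
        inj_on \<e> (fibre C x) \<and>
        \<e> ` fibre C x = {w \<in> fibre W x. \<p> w = vzero T x} \<and>
        \<p> ` fibre W x = fibre T x)"


section \<open>Double vector bundles\<close>

text \<open>
  The structure maps of \<open>V: D \<rightarrow> A\<close> are morphisms with respect to the structures \<open>H: D \<rightarrow> B\<close>,
  \<open>A \<rightarrow> M\<close> and \<open>B \<rightarrow> M\<close>.  The addition of \<open>V\<close> is a map \<open>D \<times>\<^sub>A D \<rightarrow> D\<close> over \<open>B \<times>\<^sub>M B \<rightarrow> B\<close>, where
  \<open>D \<times>\<^sub>A D \<rightarrow> B \<times>\<^sub>M B\<close> is a vector subbundle of \<open>H \<times> H: D \<times> D \<rightarrow> B \<times> B\<close>.  The type argument is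
  the typical fibre of \<open>H\<close>.
\<close>

definition structure_maps_morphisms ::
  "'h::euclidean_model itself
     \<Rightarrow> ('d, 'ed::euclidean_model, 'a, 'ea::euclidean_model) vbundle
     \<Rightarrow> ('d, 'ed, 'b, 'eb::euclidean_model) vbundle
     \<Rightarrow> ('a, 'ea, 'm, 'em::euclidean_model) vbundle
     \<Rightarrow> ('b, 'eb, 'm, 'em) vbundle \<Rightarrow> bool" where
  "structure_maps_morphisms F V H A B \<longleftrightarrow>
     vb_morphism H A (vproj V) (vproj B) \<and>
     vb_morphism A H (vzero V) (vzero B) \<and>
     vector_subbundle TYPE('h \<times> 'h) (prod_vbundle H H) (fibre_product V V) (fibre_product B B) \<and>
     vb_morphism_on (prod_vbundle H H) (fibre_product V V) (fibre_product B B) H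
       (\<lambda>(d, d'). vadd V d d') (\<lambda>(b, b'). vadd B b b') \<and>
     (\<forall>r. vb_morphism H H (vscale V r) (vscale B r))"

definition double_vector_bundle ::
  "'v::euclidean_model itself \<Rightarrow> 'h::euclidean_model itself
     \<Rightarrow> 'fa::euclidean_model itself \<Rightarrow> 'fb::euclidean_model itself
     \<Rightarrow> ('d, 'ed::euclidean_model, 'a, 'ea::euclidean_model) vbundle
     \<Rightarrow> ('d, 'ed, 'b, 'eb::euclidean_model) vbundle
     \<Rightarrow> ('a, 'ea, 'm, 'em::euclidean_model) vbundle
     \<Rightarrow> ('b, 'eb, 'm, 'em) vbundle \<Rightarrow> bool" where
  "double_vector_bundle F\<^sub>V F\<^sub>H F\<^sub>A F\<^sub>B V H A B \<longleftrightarrow>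
     vector_bundle F\<^sub>V V \<and> vector_bundle F\<^sub>H H \<and> vector_bundle F\<^sub>A A \<and> vector_bundle F\<^sub>B B \<and>
     vtotal V = vtotal H \<and> vbase V = vtotal A \<and> vbase H = vtotal B \<and> vbase A = vbase B \<and>
     (\<forall>d\<in>carrier (vtotal V). vproj A (vproj V d) = vproj B (vproj H d)) \<and>
     structure_maps_morphisms F\<^sub>H V H A B \<and> structure_maps_morphisms F\<^sub>V H V B A"


section \<open>The double vector bundle of a DVB sequence\<close>

definition dvb_set ::
  "('w, 'ew, 'm, 'em) vbundle \<Rightarrow> ('a, 'ea, 'm, 'em) vbundle \<Rightarrow> ('b, 'eb, 'm, 'em) vbundle
     \<Rightarrow> ('a \<Rightarrow> 'b \<Rightarrow> 't) \<Rightarrow> ('w \<Rightarrow> 't) \<Rightarrow> ('w \<times> 'a \<times> 'b) set" where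
  "dvb_set W A B \<tau> \<p> =
     {(w, a, b). w \<in> carrier (vtotal W) \<and> a \<in> carrier (vtotal A) \<and> b \<in> carrier (vtotal B) \<and>
        vproj W w = vproj A a \<and> vproj W w = vproj B b \<and> \<p> w = \<tau> a b}"

text \<open>In both structures the addition is only meaningful on \<open>D \<times>\<^sub>A D\<close>, respectively \<open>D \<times>\<^sub>B D\<close>.\<close>

definition dvb_vertical ::
  "('w \<times> 'a \<times> 'b, 'ed) manifold \<Rightarrow> ('w, 'ew, 'm, 'em) vbundle
     \<Rightarrow> ('a, 'ea, 'm, 'em) vbundle \<Rightarrow> ('b, 'eb, 'm, 'em) vbundle
     \<Rightarrow> ('w \<times> 'a \<times> 'b, 'ed, 'a, 'ea) vbundle" where
  "dvb_vertical D W A B =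
     \<lparr>vtotal = D, vbase = vtotal A, vproj = (\<lambda>(w, a, b). a),
      vzero = (\<lambda>a. (vzero W (vproj A a), a, vzero B (vproj A a))),
      vadd = (\<lambda>(w1, a, b1) (w2, _, b2). (vadd W w1 w2, a, vadd B b1 b2)),
      vscale = (\<lambda>r (w, a, b). (vscale W r w, a, vscale B r b))\<rparr>"

definition dvb_horizontal ::
  "('w \<times> 'a \<times> 'b, 'ed) manifold \<Rightarrow> ('w, 'ew, 'm, 'em) vbundle
     \<Rightarrow> ('a, 'ea, 'm, 'em) vbundle \<Rightarrow> ('b, 'eb, 'm, 'em) vbundle
     \<Rightarrow> ('w \<times> 'a \<times> 'b, 'ed, 'b, 'eb) vbundle" where
  "dvb_horizontal D W A B =
     \<lparr>vtotal = D, vbase = vtotal B, vproj = (\<lambda>(w, a, b). b),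
      vzero = (\<lambda>b. (vzero W (vproj B b), vzero A (vproj B b), b)),
      vadd = (\<lambda>(w1, a1, b) (w2, a2, _). (vadd W w1 w2, vadd A a1 a2, b)),
      vscale = (\<lambda>r (w, a, b). (vscale W r w, vscale A r a, b))\<rparr>"

end

theory Submission
  imports Defs
begin

text \<open>
  Locally over \<open>M\<close>, pick trivialisations \<open>\<alpha>\<close>, \<open>\<beta>\<close>, \<open>\<omega>\<close> of \<open>A\<close>, \<open>B\<close>, \<open>\<Omega>\<close> and a left inverse of \<open>C \<rightarrow> \<Omega>\<close> at
  one point, extended to a fibrewise linear map \<open>\<gamma>\<close> on \<open>\<Omega>\<close> that is constant in the trivialisation.
  Near that point \<open>(\<gamma>, \<p>)\<close> is an isomorphism onto \<open>C \<oplus> A \<otimes> B\<close>, and since the second component of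
  \<open>(\<omega>, a, b) \<in> D\<close> is prescribed as \<open>a \<otimes> b\<close>, the coordinates \<open>(x, \<alpha> a, \<beta> b, \<gamma> \<omega>)\<close> identify \<open>D\<close> with an open
  set times the product of the three typical fibres. These charts are restrictions of smooth maps and have
  smooth inverses, so \<open>D\<close> is an embedded submanifold. As \<open>\<gamma>\<close> is linear for both structures of \<open>D\<close>, the
  same coordinates trivialise \<open>D \<rightarrow> A\<close> and \<open>D \<rightarrow> B\<close>, and all structure maps become the evident ones of a
  decomposed double vector bundle.
\<close>

subsection \<open>Calculus on model spaces\<close>

text \<open>The equation \<open>\<p> w = \<tau> a b\<close> is solved explicitly rather than by a
  regular value argument: over \<open>x\<close> its solutions form the graph w = G x (c, a \<otimes>
  b), with a, b and the core coordinate c free. The analytic obstacle is smoothness of G. Inverses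
  of a smooth family of linear isomorphisms vary smoothly because H x - H y = - H x (G x - G y) H y,
  and invertibility at one point persists nearby by a norm estimate. Model spaces may have dimension
  0, so all coordinates are taken along a chosen orthonormal basis. An element of D is determined by
  its two projections and \<gamma>, and \<gamma> is additive for both additions. Hence the
  interchange law and its relatives are equalities of three coordinates. The assumptions on the two
  structures are symmetric, so only D \<rightarrow> B is treated and D \<rightarrow> A follows by
  exchange. The additions live on fibre products, which need not be open; they are extended to
  nearby pairs by adding fibre coordinates over the base point of the first entry.\<close>

definition onb :: "'a::euclidean_model set" where
  "onb = (SOME B. finite B \<and> (\<forall>u\<in>B. \<forall>v\<in>B. inner u v = (if u = v then 1 else 0)) \<and>
         (\<forall>x. (\<forall>u\<in>B. inner x u = 0) \<longrightarrow> x = 0))"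

lemma onb:
  "finite (onb :: 'a::euclidean_model set)"
  "u \<in> onb \<Longrightarrow> v \<in> onb \<Longrightarrow> inner u (v::'a) = (if u = v then 1 else 0)"
  "(\<And>u. u \<in> onb \<Longrightarrow> inner (x::'a) u = 0) \<Longrightarrow> x = 0"
  using someI_ex[OF ex_orthonormal_basis[where 'a='a], folded onb_def] by blast+

text \<open>The difference of the two sides is orthogonal to every element of \<open>onb\<close>,
  and only 0 is.\<close>

lemma onb_expansion: "(\<Sum>b\<in>onb. inner x b *\<^sub>R b) = (x::'a::euclidean_model)"
proof -
  have "x - (\<Sum>b\<in>onb. inner x b *\<^sub>R b) = 0"
  proof (rule onb(3))
    fix u :: 'a assume u: "u \<in> onb"
    have "inner (\<Sum>b\<in>onb. inner x b *\<^sub>R b) u = (\<Sum>b\<in>onb. inner x b * (if b = u then 1 else 0))"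
      by (simp add: inner_sum_left onb(2) u)
    also have "\<dots> = inner x u"
      using u by (simp add: onb(1) if_distrib cong: if_cong)
    finally show "inner (x - (\<Sum>b\<in>onb. inner x b *\<^sub>R b)) u = 0"
      by (simp add: inner_diff_left)
  qed
  then show ?thesis by simp
qed

text \<open>Reduces statements about a linear map that varies with a parameter to its values at
  finitely many fixed vectors; every argument about families of linear maps below uses this.\<close>

lemma linear_onb:
  fixes f :: "'a::euclidean_model \<Rightarrow> 'b::real_vector"
  assumes "linear f"
  shows "f x = (\<Sum>b\<in>onb. inner x b *\<^sub>R f b)"
proof -
  have "f x = f (\<Sum>b\<in>onb. inner x b *\<^sub>R b)" by (simp only: onb_expansion)
  also have "\<dots> = (\<Sum>b\<in>onb. inner x b *\<^sub>R f b)"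
    using assms by (simp add: linear_sum linear_scale)
  finally show ?thesis .
qed

lemma linear_imp_bounded_linear:
  fixes f :: "'a::euclidean_model \<Rightarrow> 'b::real_normed_vector"
  assumes "linear f"
  shows "bounded_linear f"
proof -
  have "f = (\<lambda>x. \<Sum>b\<in>onb. inner x b *\<^sub>R f b)"
    using linear_onb[OF assms] by blast
  moreover have "bounded_linear (\<lambda>x. \<Sum>b\<in>onb. inner x b *\<^sub>R f b)"
    by (intro bounded_linear_sum bounded_linear_scaleR_const bounded_linear_inner_left)
  ultimately show ?thesis by simp
qed

text \<open>Dimension counting: orthonormality makes \<open>onb\<close> independent and the
  expansion makes it spanning, so the space is finite-dimensional in the sense of the linear algebra
  locales.\<close>

lemma linear_inj_imp_surj_model:
  fixes f :: "'a::euclidean_model \<Rightarrow> 'a"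
  assumes "linear f" "inj f"
  shows "surj f"
proof -
  have ind: "independent (onb :: 'a set)"
  proof (rule independent_if_scalars_zero)
    show "finite (onb :: 'a set)" by (rule onb(1))
    fix g and x :: 'a assume s: "(\<Sum>x\<in>onb. g x *\<^sub>R x) = (0::'a)" and x: "x \<in> onb"
    have "inner (\<Sum>b\<in>onb. g b *\<^sub>R b) x = (\<Sum>b\<in>onb. g b * (if b = x then 1 else 0))"
      by (simp add: inner_sum_left onb(2) x)
    also have "\<dots> = g x" using x by (simp add: onb(1) if_distrib cong: if_cong)
    finally show "g x = 0" using s by simp
  qed
  have sp: "span (onb :: 'a set) = UNIV"
  proof (rule set_eqI, simp)
    fix x :: 'a
    have "(\<Sum>b\<in>onb. inner x b *\<^sub>R b) \<in> span onb"
      by (intro span_sum span_scale span_base)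
    then show "x \<in> span onb" by (simp only: onb_expansion)
  qed
  interpret fd: finite_dimensional_vector_space "(*\<^sub>R)" "onb :: 'a set"
    using onb(1) ind sp
    by unfold_locales (auto simp: dependent_raw_def span_raw_def)
  show ?thesis
    using fd.linear_inj_imp_surj assms unfolding linear_def by blast
qed

section \<open>Maps of class C^k: restriction, sums, products and composition\<close>

lemma Ck_on_subset: "Ck_on k S f \<Longrightarrow> T \<subseteq> S \<Longrightarrow> Ck_on k T f"
  by (induction k arbitrary: f) (auto intro: continuous_on_subset)

lemma Ck_on_cong:
  assumes "open S" "\<And>x. x \<in> S \<Longrightarrow> f x = g x" "Ck_on k S f"
  shows "Ck_on k S g"
  using assms(2,3)
proof (induction k arbitrary: f g)
  case 0 then show ?case using continuous_on_cong[of S S f g] by auto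
next
  case (Suc k)
  have hd: "(g has_derivative frechet_derivative f (at x)) (at x)" if "x \<in> S" for x
    using Suc.prems that assms(1)
    by (meson Ck_on.simps(2) frechet_derivative_works has_derivative_transform_within_open)
  then have "frechet_derivative f (at x) = frechet_derivative g (at x)" if "x \<in> S" for x
    using frechet_derivative_at that by blast
  then have "Ck_on k S (\<lambda>x. frechet_derivative g (at x) v)" for v
    using Suc.IH[of "\<lambda>x. frechet_derivative f (at x) v" "\<lambda>x. frechet_derivative g (at x) v"] Suc.prems(2)
    by auto
  then show ?case using hd by (auto simp: differentiable_def)
qed

text \<open>Derivatives in \<open>Ck_on\<close> are taken at full neighbourhoods, not within
  \<open>S\<close>, so all clauses can be checked near each point.\<close>

lemma Ck_on_local:
  assumes "\<And>x. x \<in> S \<Longrightarrow> \<exists>T. open T \<and> x \<in> T \<and> Ck_on k T f"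
  shows "Ck_on k S f"
  using assms
proof (induction k arbitrary: f)
  case 0
  then have "continuous (at x) f" if "x \<in> S" for x
    using that continuous_on_eq_continuous_at by (metis Ck_on.simps(1))
  then show ?case by (simp add: continuous_at_imp_continuous_on)
next
  case (Suc k)
  then show ?case by (simp, meson)
qed

lemma Ck_on_SucD: "Ck_on (Suc k) S f \<Longrightarrow> Ck_on k S f"
proof (induction k arbitrary: f)
  case 0
  then show ?case
    by (auto intro!: continuous_at_imp_continuous_on differentiable_imp_continuous_within)
next
  case (Suc k)
  then show ?case by (simp only: Ck_on.simps) blast
qed

lemma Ck_on_continuous: "Ck_on k S f \<Longrightarrow> continuous_on S f"
  by (induction k) (auto dest: Ck_on_SucD simp del: Ck_on.simps(2))

text \<open>Uniqueness of the derivative lets any explicit formula \<open>f'\<close> replace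
  \<open>frechet_derivative\<close>; the inductions below then work with the product and chain rules
  directly.\<close>

lemma Ck_on_SucI:
  assumes "open S" "\<And>x. x \<in> S \<Longrightarrow> (f has_derivative f' x) (at x)"
    "\<And>v. Ck_on k S (\<lambda>x. f' x v)"
  shows "Ck_on (Suc k) S f"
proof -
  have "frechet_derivative f (at x) = f' x" if "x \<in> S" for x
    using assms(2) that frechet_derivative_at by metis
  then have "Ck_on k S (\<lambda>x. frechet_derivative f (at x) v)" for v
    using Ck_on_cong[OF assms(1) _ assms(3)[of v], of "\<lambda>x. frechet_derivative f (at x) v"] by simp
  then show ?thesis using assms(2) by (auto simp: differentiable_def)
qed

lemma Ck_on_has_derivative:
  "Ck_on (Suc k) S f \<Longrightarrow> x \<in> S \<Longrightarrow> (f has_derivative frechet_derivative f (at x)) (at x)"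
  using frechet_derivative_works by auto

lemma Ck_on_const: "Ck_on k S (\<lambda>x. c)"
  by (induction k arbitrary: c) (auto simp: frechet_derivative_const)

lemma Ck_on_bounded_linear: "bounded_linear f \<Longrightarrow> Ck_on k S f"
proof (induction k)
  case 0 then show ?case by (simp add: linear_continuous_on)
next
  case (Suc k)
  have "frechet_derivative f (at x) = f" for x
    using frechet_derivative_at[OF bounded_linear.has_derivative[OF Suc.prems has_derivative_ident]] by simp
  then show ?case
    using Suc.prems bounded_linear_imp_differentiable by (auto simp: Ck_on_const)
qed

lemma Ck_on_linear_comp:
  assumes "open S" "bounded_linear h" "Ck_on k S f"
  shows "Ck_on k S (\<lambda>x. h (f x))"
  using assms(3)
proof (induction k arbitrary: f)
  case 0 then show ?case
    using bounded_linear.continuous_on[OF assms(2)] by auto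
next
  case (Suc k)
  show ?case
  proof (rule Ck_on_SucI[OF assms(1)])
    fix x assume "x \<in> S"
    then show "((\<lambda>x. h (f x)) has_derivative (\<lambda>v. h (frechet_derivative f (at x) v))) (at x)"
      by (intro bounded_linear.has_derivative[OF assms(2)] Ck_on_has_derivative[OF Suc.prems])
  qed (use Suc in auto)
qed

lemma Ck_on_add:
  assumes "open S" "Ck_on k S f" "Ck_on k S g"
  shows "Ck_on k S (\<lambda>x. f x + g x)"
  using assms(2,3)
proof (induction k arbitrary: f g)
  case 0 then show ?case by (auto intro: continuous_on_add)
next
  case (Suc k)
  show ?case
  proof (rule Ck_on_SucI[OF assms(1)])
    fix x assume "x \<in> S"
    then show "((\<lambda>x. f x + g x) has_derivative
        (\<lambda>v. frechet_derivative f (at x) v + frechet_derivative g (at x) v)) (at x)"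
      by (intro has_derivative_add Ck_on_has_derivative[OF Suc.prems(1)] Ck_on_has_derivative[OF Suc.prems(2)])
  qed (use Suc in auto)
qed

lemma Ck_on_sum:
  assumes "open S" "\<And>i. i \<in> I \<Longrightarrow> Ck_on k S (f i)"
  shows "Ck_on k S (\<lambda>x. \<Sum>i\<in>I. f i x)"
  using assms(2)
  by (induction I rule: infinite_finite_induct) (auto intro: Ck_on_const Ck_on_add[OF assms(1)])

text \<open>The product rule yields two terms of the same shape. In each, one factor is a derivative
  and so of class C^k, the other is of class C^(k+1) and so of class C^k; this is why the induction
  generalises over \<open>f\<close> and \<open>g\<close>.\<close>

lemma Ck_on_bilinear:
  assumes "open S" "bounded_bilinear h" "Ck_on k S f" "Ck_on k S g"
  shows "Ck_on k S (\<lambda>x. h (f x) (g x))"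
  using assms(3,4)
proof (induction k arbitrary: f g)
  case 0 then show ?case
    using bounded_bilinear.continuous_on[OF assms(2)] by auto
next
  case (Suc k)
  show ?case
  proof (rule Ck_on_SucI[OF assms(1)])
    fix x assume "x \<in> S"
    then show "((\<lambda>x. h (f x) (g x)) has_derivative
        (\<lambda>v. h (f x) (frechet_derivative g (at x) v) + h (frechet_derivative f (at x) v) (g x))) (at x)"
      by (intro bounded_bilinear.FDERIV[OF assms(2)] Ck_on_has_derivative[OF Suc.prems(1)]
          Ck_on_has_derivative[OF Suc.prems(2)])
  next
    fix v
    show "Ck_on k S (\<lambda>x. h (f x) (frechet_derivative g (at x) v) + h (frechet_derivative f (at x) v) (g x))"
      using Suc.prems by (intro Ck_on_add[OF assms(1)] Suc.IH) (auto dest: Ck_on_SucD simp del: Ck_on.simps, auto)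
  qed
qed

lemmas Ck_on_scaleR = Ck_on_bilinear[OF _ bounded_bilinear_scaleR]

lemma Ck_on_inner_const: "open S \<Longrightarrow> Ck_on k S f \<Longrightarrow> Ck_on k S (\<lambda>x. inner (f x) b)"
  by (rule Ck_on_linear_comp[OF _ bounded_linear_inner_left])

lemma Ck_on_compose:
  fixes f :: "'a::real_normed_vector \<Rightarrow> 'b::euclidean_model"
  assumes "open S" "open T" "f ` S \<subseteq> T" "Ck_on k S f" "Ck_on k T g"
  shows "Ck_on k S (\<lambda>x. g (f x))"
  using assms(4,5)
proof (induction k arbitrary: g)
  case 0 then show ?case
    using continuous_on_compose2[OF _ _ assms(3)] by auto
next
  case (Suc k)
  have cf: "Ck_on k S f" using Suc.prems(1) by (rule Ck_on_SucD)
  show ?case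
  proof (rule Ck_on_SucI[OF assms(1)])
    fix x assume x: "x \<in> S"
    then have gx: "(g has_derivative frechet_derivative g (at (f x))) (at (f x))"
      using assms(3) by (intro Ck_on_has_derivative[OF Suc.prems(2)]) auto
    have fx: "(f has_derivative frechet_derivative f (at x)) (at x)"
      by (intro Ck_on_has_derivative[OF Suc.prems(1)] x)
    have "((\<lambda>x. g (f x)) has_derivative (\<lambda>v. frechet_derivative g (at (f x)) (frechet_derivative f (at x) v))) (at x)"
      using has_derivative_compose[OF fx gx] .
    \<comment> \<open>\<open>Ck_on\<close> speaks about derivatives in fixed directions only, while
      the direction in which \<open>g\<close> is differentiated here moves with \<open>x\<close>.
      Expanding it along \<open>onb\<close> leaves the fixed directions \<open>b\<close>, to which
      the induction hypothesis applies.\<close>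
    moreover have "(\<lambda>v. frechet_derivative g (at (f x)) (frechet_derivative f (at x) v)) =
       (\<lambda>v. \<Sum>b\<in>onb. inner (frechet_derivative f (at x) v) b *\<^sub>R frechet_derivative g (at (f x)) b)"
      using linear_onb[OF has_derivative_linear[OF gx]] by blast
    ultimately show "((\<lambda>x. g (f x)) has_derivative
      (\<lambda>v. \<Sum>b\<in>onb. inner (frechet_derivative f (at x) v) b *\<^sub>R frechet_derivative g (at (f x)) b)) (at x)"
      by simp
  next
    fix v
    have "Ck_on k S (\<lambda>x. frechet_derivative g (at (f x)) b)" for b
      using Suc.IH[OF cf, of "\<lambda>y. frechet_derivative g (at y) b"] Suc.prems(2) by auto
    moreover have "Ck_on k S (\<lambda>x. frechet_derivative f (at x) v)"
      using Suc.prems(1) by auto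
    ultimately show "Ck_on k S (\<lambda>x. \<Sum>b\<in>onb. inner (frechet_derivative f (at x) v) b *\<^sub>R frechet_derivative g (at (f x)) b)"
      by (intro Ck_on_sum Ck_on_scaleR Ck_on_inner_const assms(1))
  qed
qed

section \<open>The same rules for smooth maps\<close>

lemma smooth_on_subset: "smooth_on S f \<Longrightarrow> T \<subseteq> S \<Longrightarrow> smooth_on T f"
  using Ck_on_subset unfolding smooth_on_def by blast

lemma smooth_on_cong:
  "smooth_on S f \<Longrightarrow> open S \<Longrightarrow> (\<And>x. x \<in> S \<Longrightarrow> f x = g x) \<Longrightarrow> smooth_on S g"
  using Ck_on_cong unfolding smooth_on_def by blast

lemma smooth_on_local:
  assumes "\<And>x. x \<in> S \<Longrightarrow> \<exists>T. open T \<and> x \<in> T \<and> smooth_on T f"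
  shows "smooth_on S f"
  unfolding smooth_on_def using assms Ck_on_local unfolding smooth_on_def by meson

lemma smooth_on_continuous: "smooth_on S f \<Longrightarrow> continuous_on S f"
  using Ck_on_continuous unfolding smooth_on_def by blast

lemma smooth_on_has_derivative:
  "smooth_on S f \<Longrightarrow> x \<in> S \<Longrightarrow> (f has_derivative frechet_derivative f (at x)) (at x)"
  using Ck_on_has_derivative[of 0] unfolding smooth_on_def by blast

lemma smooth_on_compose:
  fixes f :: "'a::real_normed_vector \<Rightarrow> 'b::euclidean_model"
  assumes "smooth_on S f" "smooth_on T g" "open S" "open T" "f ` S \<subseteq> T"
  shows "smooth_on S (\<lambda>x. g (f x))"
  using assms Ck_on_compose unfolding smooth_on_def by blast

lemma smooth_on_linear_comp:
  assumes "smooth_on S f" "open S" "bounded_linear h"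
  shows "smooth_on S (\<lambda>x. h (f x))"
  using assms Ck_on_linear_comp unfolding smooth_on_def by blast

lemma smooth_on_bounded_linear: "bounded_linear f \<Longrightarrow> smooth_on S f"
  using Ck_on_bounded_linear unfolding smooth_on_def by blast

lemma smooth_on_linear: "linear f \<Longrightarrow> smooth_on S (f :: 'a::euclidean_model \<Rightarrow> 'b::real_normed_vector)"
  using smooth_on_bounded_linear linear_imp_bounded_linear by blast

lemma smooth_on_id: "smooth_on S (\<lambda>x. x)"
  by (rule smooth_on_bounded_linear[OF bounded_linear_ident])

lemma smooth_on_const: "smooth_on S (\<lambda>x. c)"
  using Ck_on_const unfolding smooth_on_def by blast

lemma smooth_on_add: "smooth_on S f \<Longrightarrow> smooth_on S g \<Longrightarrow> open S \<Longrightarrow> smooth_on S (\<lambda>x. f x + g x)"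
  using Ck_on_add unfolding smooth_on_def by blast

lemma smooth_on_scaleR:
  "smooth_on S f \<Longrightarrow> smooth_on S g \<Longrightarrow> open S \<Longrightarrow> smooth_on S (\<lambda>x. f x *\<^sub>R g x)"
  using Ck_on_scaleR unfolding smooth_on_def by blast

lemma bounded_linear_Pair_0: "bounded_linear (\<lambda>x. (x, 0))" "bounded_linear (\<lambda>x. (0, x))"
  by (auto intro: bounded_linear_Pair bounded_linear_ident bounded_linear_zero)

lemma smooth_on_Pair:
  assumes "smooth_on S f" "smooth_on S g" "open S"
  shows "smooth_on S (\<lambda>x. (f x, g x))"
proof -
  have "smooth_on S (\<lambda>x. (f x, 0) + (0, g x))"
    by (intro smooth_on_add smooth_on_linear_comp[OF _ _ bounded_linear_Pair_0(1)]
        smooth_on_linear_comp[OF _ _ bounded_linear_Pair_0(2)] assms)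
  then show ?thesis by simp
qed

subsection \<open>Smooth families of invertible linear maps\<close>

text \<open>The product rule at a zero of the scalar factor requires mere continuity of the other
  factor: \<open>f y\<close> is of order \<open>norm (y - x)\<close> and \<open>g y - g x\<close>
  tends to 0, so the error \<open>f y *\<^sub>R (g y - g x)\<close> is of lower order. It serves to
  differentiate a family of inverses that is so far known only to be continuous.\<close>

lemma has_derivative_scaleR_vanishing:
  fixes f :: "'a::real_normed_vector \<Rightarrow> real"
  assumes f: "(f has_derivative f') (at x)" and "f x = 0" and g: "continuous (at x) g"
  shows "((\<lambda>y. f y *\<^sub>R g y) has_derivative (\<lambda>v. f' v *\<^sub>R g x)) (at x)"
proof -
  have 1: "((\<lambda>y. f y *\<^sub>R g x) has_derivative (\<lambda>v. f' v *\<^sub>R g x)) (at x)"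
    by (rule has_derivative_scaleR_left[OF f])
  obtain K where K: "\<And>v. norm (f' v) \<le> norm v * K" "K > 0"
    using bounded_linear.pos_bounded[OF has_derivative_bounded_linear[OF f]] by blast
  have lim: "((\<lambda>y. norm (f y) / norm (y - x) * norm (g y - g x)) \<longlongrightarrow> 0) (at x)"
  proof -
    have q: "((\<lambda>y. (f y - f x - f' (y - x)) /\<^sub>R norm (y - x)) \<longlongrightarrow> 0) (at x)"
      using f by (simp add: has_derivative_at_within)
    then have "eventually (\<lambda>y. norm ((f y - f x - f' (y - x)) /\<^sub>R norm (y - x)) < 1) (at x)"
      using order_tendstoD(2)[OF tendsto_norm_zero[OF q], of 1] by simp
    \<comment> \<open>The bound is \<open>K\<close> for the linear part plus 1 for the remainder,
      which is eventually smaller than \<open>norm (y - x)\<close>.\<close>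
    then have ev: "eventually (\<lambda>y. norm (norm (f y) / norm (y - x)) \<le> K + 1) (at x)"
      unfolding eventually_at_filter
    proof (eventually_elim, intro impI)
      case (elim y)
      assume y: "y \<noteq> x" "y \<in> UNIV"
      then have pos: "norm (y - x) > 0" by simp
      have "norm (f y - f' (y - x)) < norm (y - x)"
        using elim y \<open>f x = 0\<close> pos by (simp add: field_simps)
      then have "norm (f y) \<le> norm (y - x) + norm (y - x) * K"
        using K(1)[of "y - x"] norm_triangle_ineq2[of "f y" "f' (y - x)"] by linarith
      then show "norm (norm (f y) / norm (y - x)) \<le> K + 1"
        using pos by (simp add: field_simps)
    qed
    have "((\<lambda>y. norm (g y - g x)) \<longlongrightarrow> 0) (at x)"
      using g by (simp add: continuous_at LIM_zero tendsto_norm_zero)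
    then show ?thesis
      by (rule lim_null_mult_left_bounded[OF ev])
  qed
  have 2: "((\<lambda>y. f y *\<^sub>R (g y - g x)) has_derivative (\<lambda>v. 0)) (at x)"
    unfolding has_derivative_at_within
  proof (intro conjI bounded_linear_zero)
    show "((\<lambda>y. (f y *\<^sub>R (g y - g x) - f x *\<^sub>R (g x - g x) - 0) /\<^sub>R norm (y - x)) \<longlongrightarrow> 0) (at x)"
      apply (rule tendsto_norm_zero_cancel)
      using lim by (simp add: divide_inverse ac_simps abs_mult)
  qed
  show ?thesis
    using has_derivative_add[OF 1 2] by (simp add: algebra_simps)
qed


lemma smooth_inverse_family:
  fixes G :: "'x::euclidean_model \<Rightarrow> 'f::euclidean_model \<Rightarrow> 'g::euclidean_model"
    and H :: "'x \<Rightarrow> 'g \<Rightarrow> 'f"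
  assumes S: "open S" and lin: "\<And>x. x \<in> S \<Longrightarrow> linear (G x)"
    and sm: "\<And>w. smooth_on S (\<lambda>x. G x w)"
    and linH: "\<And>x. x \<in> S \<Longrightarrow> linear (H x)"
    and HG: "\<And>x w. x \<in> S \<Longrightarrow> H x (G x w) = w" and GH: "\<And>x z. x \<in> S \<Longrightarrow> G x (H x z) = z"
    and bnd: "\<And>x z. x \<in> S \<Longrightarrow> norm (H x z) \<le> K * norm z"
  shows "smooth_on S (\<lambda>x. H x z)"
proof -
  define dG where "dG b x = frechet_derivative (\<lambda>x. G x b) (at x)" for b x
  have dG: "((\<lambda>x. G x b) has_derivative dG b x) (at x)" if "x \<in> S" for b x
    unfolding dG_def by (rule smooth_on_has_derivative[OF sm that])
  \<comment> \<open>This identity yields continuity of \<open>H\<close>, then its derivative \<open>- H \<circ> dG \<circ> H\<close>, hence by induction all higher ones.\<close>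
  have diff: "H x z - H x1 z = - H x (G x (H x1 z) - G x1 (H x1 z))" if "x \<in> S" "x1 \<in> S" for x x1 z
    using that by (simp add: linear_diff[OF linH] HG GH)
  have cont: "continuous (at x1) (\<lambda>x. H x z)" if x1: "x1 \<in> S" for x1 z
  proof -
    let ?y = "H x1 z"
    have "continuous (at x1) (\<lambda>x. G x ?y)"
      using smooth_on_continuous[OF sm] S x1 continuous_on_eq_continuous_at by blast
    then have "((\<lambda>x. K * norm (G x ?y - G x1 ?y)) \<longlongrightarrow> 0) (at x1)"
      by (auto intro!: tendsto_mult_right_zero tendsto_norm_zero simp: continuous_at LIM_zero)
    \<comment> \<open>The uniform bound \<open>K\<close> on \<open>H x\<close> turns the identity
      into an estimate by the difference of \<open>G x\<close> and \<open>G x1\<close> at the fixed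
      vector \<open>?y\<close>.\<close>
    then have "((\<lambda>x. H x z - H x1 z) \<longlongrightarrow> 0) (at x1)"
    proof (rule Lim_null_comparison[rotated])
      show "\<forall>\<^sub>F x in at x1. norm (H x z - H x1 z) \<le> K * norm (G x ?y - G x1 ?y)"
        using eventually_at_in_open'[OF S x1]
        by eventually_elim (simp add: diff x1 bnd)
    qed
    then show ?thesis by (simp add: continuous_at LIM_zero_iff)
  qed
  have der: "((\<lambda>x. H x z) has_derivative
      (\<lambda>v. - (\<Sum>c\<in>onb. (\<Sum>b\<in>onb. inner (H x1 z) b * inner (dG b x1 v) c) *\<^sub>R H x1 c))) (at x1)"
    if x1: "x1 \<in> S" for x1 z
  proof -
    \<comment> \<open>With the vector frozen at \<open>x1\<close>, the coefficients
      \<open>inner (G x ?y - G x1 ?y) c\<close> are scalars that vanish at \<open>x1\<close>, so the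
      moving factor \<open>H x c\<close> need only be continuous. The resulting formula contains
      \<open>H\<close> only at fixed vectors, which is what the induction on \<open>k\<close> can
      use.\<close>
    let ?y = "H x1 z"
    have "((\<lambda>x. \<Sum>b\<in>onb. inner ?y b *\<^sub>R G x b) has_derivative (\<lambda>v. \<Sum>b\<in>onb. inner ?y b *\<^sub>R dG b x1 v)) (at x1)"
      by (intro has_derivative_sum has_derivative_scaleR_right dG x1)
    then have G: "((\<lambda>x. G x ?y) has_derivative (\<lambda>v. \<Sum>b\<in>onb. inner ?y b *\<^sub>R dG b x1 v)) (at x1)"
      by (rule has_derivative_transform_within_open[OF _ S x1]) (simp flip: linear_onb[OF lin])
    have i: "((\<lambda>x. inner (G x ?y - G x1 ?y) c) has_derivative
        (\<lambda>v. (\<Sum>b\<in>onb. inner ?y b * inner (dG b x1 v) c))) (at x1)" for c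
      using has_derivative_inner_left[OF has_derivative_diff[OF G has_derivative_const[of "G x1 ?y"]], of c]
      by (simp add: inner_sum_left)
    have "((\<lambda>x. inner (G x ?y - G x1 ?y) c *\<^sub>R H x c) has_derivative
        (\<lambda>v. (\<Sum>b\<in>onb. inner ?y b * inner (dG b x1 v) c) *\<^sub>R H x1 c)) (at x1)" for c
      by (rule has_derivative_scaleR_vanishing[OF i _ cont[OF x1]]) simp
    then have "((\<lambda>x. - (\<Sum>c\<in>onb. inner (G x ?y - G x1 ?y) c *\<^sub>R H x c) + H x1 z) has_derivative
      (\<lambda>v. - (\<Sum>c\<in>onb. (\<Sum>b\<in>onb. inner (H x1 z) b * inner (dG b x1 v) c) *\<^sub>R H x1 c))) (at x1)"
      by (intro has_derivative_add[OF _ has_derivative_const, simplified] has_derivative_minus has_derivative_sum)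
    then show ?thesis
    proof (rule has_derivative_transform_within_open[OF _ S x1])
      fix x assume x: "x \<in> S"
      have "(\<Sum>c\<in>onb. inner (G x ?y - G x1 ?y) c *\<^sub>R H x c) = H x (G x ?y - G x1 ?y)"
        by (rule linear_onb[OF linH[OF x], symmetric])
      then show "- (\<Sum>c\<in>onb. inner (G x ?y - G x1 ?y) c *\<^sub>R H x c) + H x1 z = H x z"
        using diff[OF x x1, of z] by (simp add: algebra_simps)
    qed
  qed
  have "Ck_on k S (\<lambda>x. H x z)" for k z
  proof (induction k arbitrary: z)
    case 0 then show ?case by (simp add: continuous_at_imp_continuous_on cont)
  next
    case (Suc k)
    show ?case
    proof (rule Ck_on_SucI[OF S der])
      fix v
      have "Ck_on k S (\<lambda>x. dG b x v)" for b
        unfolding dG_def using sm[of b] Ck_on.simps(2) unfolding smooth_on_def by blast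
      then show "Ck_on k S (\<lambda>x. - (\<Sum>c\<in>onb. (\<Sum>b\<in>onb. inner (H x z) b * inner (dG b x v) c) *\<^sub>R H x c))"
        by (intro Ck_on_linear_comp[OF S bounded_linear_minus[OF bounded_linear_ident]] Ck_on_sum Ck_on_scaleR
            Ck_on_bilinear[OF S bounded_bilinear_mult] Ck_on_inner_const S Suc.IH)
    qed
  qed
  then show ?thesis unfolding smooth_on_def by blast
qed

text \<open>Near \<open>x0\<close> the operator norm of \<open>G x - G x0\<close> is small against
  the bound \<open>K\<close> of the inverse at \<open>x0\<close>, so \<open>G x\<close> stays
  bounded below. That gives injectivity, then bijectivity by dimension, and also the uniform bound
  on the inverses from which smoothness follows.\<close>

lemma exists_smooth_inverse_family:
  fixes G :: "'x::euclidean_model \<Rightarrow> 'f::euclidean_model \<Rightarrow> 'g::euclidean_model"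
  assumes S: "open S" and lin: "\<And>x. x \<in> S \<Longrightarrow> linear (G x)"
    and sm: "\<And>w. smooth_on S (\<lambda>x. G x w)"
    and x0: "x0 \<in> S" and bij: "bij (G x0)"
  obtains S' H where "open S'" "x0 \<in> S'" "S' \<subseteq> S" "\<And>x. x \<in> S' \<Longrightarrow> linear (H x)"
    "\<And>x w. x \<in> S' \<Longrightarrow> H x (G x w) = w" "\<And>x z. x \<in> S' \<Longrightarrow> G x (H x z) = z"
    "\<And>z. smooth_on S' (\<lambda>x. H x z)"
proof -
  define H0 where "H0 = inv (G x0)"
  have linH0: "linear H0"
  proof (rule linearI)
    note l = lin[OF x0] and i = bij_is_inj[OF bij] and s = surj_f_inv_f[OF bij_is_surj[OF bij]]
    show "H0 (u + v) = H0 u + H0 v" for u v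
      using i by (rule injD) (simp add: linear_add[OF l] s H0_def)
    show "H0 (r *\<^sub>R u) = r *\<^sub>R H0 u" for r u
      using i by (rule injD) (simp add: linear_scale[OF l] s H0_def)
  qed
  have H0: "H0 (G x0 w) = w" "G x0 (H0 z) = z" for w z
    unfolding H0_def using bij by (auto simp: bij_is_inj bij_is_surj surj_f_inv_f)
  obtain K where K: "K > 0" "\<And>z. norm (H0 z) \<le> norm z * K"
    using bounded_linear.pos_bounded[OF linear_imp_bounded_linear[OF linH0]] by blast
  \<comment> \<open>A bound for the operator norm of \<open>G x - G x0\<close> that is visibly
    continuous in \<open>x\<close>, being a finite sum, and vanishes at \<open>x0\<close>.\<close>
  define e where "e x = (\<Sum>b\<in>onb. norm (G x b - G x0 b))" for x
  have conte: "continuous_on S e"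
    unfolding e_def by (intro continuous_intros smooth_on_continuous sm)
  \<comment> \<open>The threshold \<open>1 / (2 * K)\<close> lets the term
    \<open>K * (e x * norm w)\<close> be absorbed as half of \<open>norm w\<close>.\<close>
  define S' where "S' = S \<inter> e -` {..<1 / (2 * K)}"
  have "open S'"
    unfolding S'_def using conte S by (simp add: continuous_on_open_vimage Int_commute)
  have "x0 \<in> S'" using x0 K by (simp add: S'_def e_def)
  have sub: "S' \<subseteq> S" by (auto simp: S'_def)
  have le: "norm (G x w - G x0 w) \<le> e x * norm w" if "x \<in> S" for x w
  proof -
    have "G x w - G x0 w = (\<Sum>b\<in>onb. inner w b *\<^sub>R (G x b - G x0 b))"
      using linear_onb[OF lin[OF that], of w] linear_onb[OF lin[OF x0], of w]
      by (simp add: scaleR_diff_right sum_subtractf)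
    also have "norm \<dots> \<le> (\<Sum>b\<in>onb. norm w * norm (G x b - G x0 b))"
    proof (rule sum_norm_le)
      fix b :: 'f assume "b \<in> onb"
      then have "norm b = 1" by (simp add: norm_eq_sqrt_inner onb(2))
      then have "\<bar>inner w b\<bar> \<le> norm w" using Cauchy_Schwarz_ineq2[of w b] by simp
      then show "norm (inner w b *\<^sub>R (G x b - G x0 b)) \<le> norm w * norm (G x b - G x0 b)"
        by (simp add: mult_right_mono)
    qed
    finally show ?thesis by (simp add: e_def sum_distrib_left mult.commute)
  qed
  have est: "norm w \<le> 2 * K * norm (G x w)" if x: "x \<in> S'" for x w
  proof -
    have "norm w \<le> K * norm (G x0 w)" using K(2)[of "G x0 w"] by (simp add: H0 mult.commute)
    also have "\<dots> \<le> K * (norm (G x w) + norm (G x w - G x0 w))"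
      using K(1) norm_triangle_sub[of "G x0 w" "G x w"] by (simp add: norm_minus_commute)
    also have "\<dots> \<le> K * (norm (G x w) + e x * norm w)"
      using K(1) le[of x w] x sub by auto
    also have "\<dots> \<le> K * (norm (G x w) + 1 / (2 * K) * norm w)"
      using K(1) x by (intro mult_left_mono add_left_mono mult_right_mono) (auto simp: S'_def)
    also have "\<dots> = K * norm (G x w) + norm w / 2" using K(1) by (simp add: field_simps)
    finally show ?thesis by simp
  qed
  have inj: "inj (G x)" if "x \<in> S'" for x
  proof -
    have "linear (G x)" using lin that sub by blast
    then show ?thesis
      using est[OF that] by (simp add: linear_injective_0) (metis mult_zero_right norm_le_zero_iff norm_zero)
  qed
  have surj: "surj (G x)" if x: "x \<in> S'" for x
  proof -
    have "inj H0" by (metis H0(2) injI)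
    have "linear (G x)" using lin x sub by blast
    \<comment> \<open>\<open>G x\<close> runs between two different spaces; composing with
      \<open>H0\<close> gives an injective endomorphism, to which dimension counting
      applies.\<close>
    with \<open>inj H0\<close> have "surj (G x \<circ> H0)"
      by (intro linear_inj_imp_surj_model linear_compose[OF linH0] inj_compose[OF inj[OF x]])
    then show ?thesis by (auto simp: surj_def)
  qed
  define H where "H x = inv (G x)" for x
  have HG: "H x (G x w) = w" if "x \<in> S'" for x w using inj[OF that] by (simp add: H_def)
  have GH: "G x (H x z) = z" if "x \<in> S'" for x z using surj[OF that] by (simp add: H_def surj_f_inv_f)
  have linH: "linear (H x)" if x: "x \<in> S'" for x
  proof (rule linearI)
    have l: "linear (G x)" using lin x sub by blast
    show "H x (u + v) = H x u + H x v" for u v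
      using inj[OF x] by (rule injD) (simp add: linear_add[OF l] GH x)
    show "H x (r *\<^sub>R u) = r *\<^sub>R H x u" for r u
      using inj[OF x] by (rule injD) (simp add: linear_scale[OF l] GH x)
  qed
  have smH: "smooth_on S' (\<lambda>x. H x z)" for z
  proof (rule smooth_inverse_family[OF \<open>open S'\<close>, of G H "2 * K"])
    show "smooth_on S' (\<lambda>x. G x w)" for w using sm sub by (rule smooth_on_subset)
    show "norm (H x z) \<le> 2 * K * norm z" if "x \<in> S'" for x z
      using est[OF that, of "H x z"] by (simp add: GH that)
  qed (use lin sub linH HG GH in auto)
  show ?thesis
    by (rule that[of S' H]) (fact \<open>open S'\<close> \<open>x0 \<in> S'\<close> sub linH HG GH smH)+
qed

subsection \<open>Smoothness at a point\<close>

text \<open>The clauses of \<open>smooth_manifold\<close> that concern charts. The calculus of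
  smooth maps rests on these, so it can be applied to a space before its global topology has been
  examined.\<close>

definition smooth_atlas :: "('x, 'e::euclidean_model) manifold \<Rightarrow> bool" where
  "smooth_atlas N \<longleftrightarrow>
     carrier N = (\<Union>(U, \<phi>)\<in>atlas N. U) \<and>
     (\<forall>(U, \<phi>)\<in>atlas N. openin (mtop N) U \<and> open (\<phi> ` U) \<and>
        homeomorphic_map (subtopology (mtop N) U) (top_of_set (\<phi> ` U)) \<phi>) \<and>
     (\<forall>(U, \<phi>)\<in>atlas N. \<forall>(V, \<psi>)\<in>atlas N.
        smooth_on (\<phi> ` (U \<inter> V)) (\<psi> \<circ> inv_into U \<phi>))"

lemma smooth_manifold_iff:
  "smooth_manifold N \<longleftrightarrow> Hausdorff_space (mtop N) \<and> second_countable (mtop N) \<and> smooth_atlas N"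
  by (auto simp: smooth_manifold_def smooth_atlas_def)

lemma smooth_manifold_atlas: "smooth_manifold N \<Longrightarrow> smooth_atlas N"
  by (simp add: smooth_manifold_iff)

text \<open>One pair of charts and one neighbourhood suffice to establish smoothness, and the notion
  depends only on the germ of \<open>f\<close>. There is no continuity clause: since
  \<open>f\<close> maps \<open>O'\<close> into a single chart domain, continuity near
  \<open>p\<close> follows from that of the coordinate expression. The converse passage to arbitrary
  charts is \<open>smooth_at_any_charts\<close>.\<close>

definition smooth_at ::
  "('x, 'e::euclidean_model) manifold \<Rightarrow> ('y, 'f::euclidean_model) manifold \<Rightarrow> ('x \<Rightarrow> 'y) \<Rightarrow> 'x \<Rightarrow> bool"
where
  "smooth_at N N' f p \<longleftrightarrow> (\<exists>O' U \<phi> V \<psi>. (U, \<phi>) \<in> atlas N \<and> (V, \<psi>) \<in> atlas N' \<and>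
     openin (mtop N) O' \<and> p \<in> O' \<and> O' \<subseteq> U \<and> f ` O' \<subseteq> V \<and>
     smooth_on (\<phi> ` O') (\<lambda>y. \<psi> (f (inv_into U \<phi> y))))"

context
  fixes N :: "('x, 'e::euclidean_model) manifold" and U and \<phi>
  assumes N: "smooth_atlas N" and c: "(U, \<phi>) \<in> atlas N"
begin

lemma chart_openin: "openin (mtop N) U" and chart_open_range: "open (\<phi> ` U)"
  and chart_homeo: "homeomorphic_map (subtopology (mtop N) U) (top_of_set (\<phi> ` U)) \<phi>"
  using N c unfolding smooth_atlas_def by blast+

lemma chart_subset: "U \<subseteq> carrier N"
  using chart_openin openin_subset by blast

lemma chart_inj: "inj_on \<phi> U"
  using chart_homeo chart_subset by (simp add: homeomorphic_map_def Int_absorb1)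

lemma chart_open_image:
  assumes "openin (mtop N) O'" "O' \<subseteq> U"
  shows "open (\<phi> ` O')"
proof -
  have "openin (subtopology (mtop N) U) O'"
    using assms openin_open_subtopology[OF chart_openin] by simp
  then have "openin (top_of_set (\<phi> ` U)) (\<phi> ` O')"
    using chart_homeo homeomorphic_imp_open_map open_map_def by blast
  then show ?thesis using chart_open_range openin_open_eq by blast
qed

lemma chart_open_preimage:
  assumes "open E"
  shows "openin (mtop N) {x \<in> U. \<phi> x \<in> E}"
proof -
  have "openin (subtopology (mtop N) U) {x \<in> topspace (subtopology (mtop N) U). \<phi> x \<in> \<phi> ` U \<inter> E}"
    using chart_homeo assms
    by (intro openin_continuous_map_preimage[OF homeomorphic_imp_continuous_map]) (auto intro: openin_open_Int)
  moreover have "{x \<in> topspace (subtopology (mtop N) U). \<phi> x \<in> \<phi> ` U \<inter> E} = {x \<in> U. \<phi> x \<in> E}"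
    using chart_subset by auto
  ultimately show ?thesis
    using openin_open_subtopology[OF chart_openin] by simp
qed

lemma chart_inv: "x \<in> U \<Longrightarrow> inv_into U \<phi> (\<phi> x) = x"
  using chart_inj by simp

lemma chart_transition: "(V, \<psi>) \<in> atlas N \<Longrightarrow> smooth_on (\<phi> ` (U \<inter> V)) (\<lambda>y. \<psi> (inv_into U \<phi> y))"
  using N c unfolding smooth_atlas_def comp_def by blast

end

lemma chart_exists: "smooth_atlas N \<Longrightarrow> p \<in> carrier N \<Longrightarrow> \<exists>U \<phi>. (U, \<phi>) \<in> atlas N \<and> p \<in> U"
  unfolding smooth_atlas_def by auto

text \<open>The open set is moved to the model space by \<psi>, pulled back along the continuous
  coordinate expression, and returned by \<phi>.\<close>

lemma smooth_at_preimages: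
  fixes f :: "'x \<Rightarrow> 'y"
  assumes N: "smooth_atlas N" "smooth_atlas N'"
    and c: "(U, \<phi>) \<in> atlas N" "(V, \<psi>) \<in> atlas N'"
    and O: "openin (mtop N) O'" "O' \<subseteq> U" "f ` O' \<subseteq> V"
    and s: "smooth_on (\<phi> ` O') (\<lambda>y. \<psi> (f (inv_into U \<phi> y)))"
    and Q: "openin (mtop N') Q"
  shows "openin (mtop N) {x \<in> O'. f x \<in> Q}"
proof -
  let ?r = "\<lambda>y. \<psi> (f (inv_into U \<phi> y))"
  let ?E = "\<phi> ` O' \<inter> ?r -` (\<psi> ` (Q \<inter> V))"
  have "open (\<psi> ` (Q \<inter> V))"
    using Q chart_openin[OF N(2) c(2)] by (intro chart_open_image[OF N(2) c(2)]) auto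
  moreover have "open (\<phi> ` O')" by (rule chart_open_image[OF N(1) c(1) O(1,2)])
  ultimately have "open ?E"
    using smooth_on_continuous[OF s] continuous_on_open_vimage by (metis Int_commute)
  then have "openin (mtop N) {x \<in> U. \<phi> x \<in> ?E}"
    by (rule chart_open_preimage[OF N(1) c(1)])
  moreover have "{x \<in> U. \<phi> x \<in> ?E} = {x \<in> O'. f x \<in> Q}"
  proof (intro set_eqI iffI)
    fix x assume "x \<in> {x \<in> U. \<phi> x \<in> ?E}"
    then have x: "x \<in> U" "\<phi> x \<in> \<phi> ` O'" "?r (\<phi> x) \<in> \<psi> ` (Q \<inter> V)" by auto
    then have xO: "x \<in> O'" using chart_inj[OF N(1) c(1)] O(2) by (meson inj_on_image_mem_iff)
    have "\<psi> (f x) \<in> \<psi> ` (Q \<inter> V)" using x chart_inv[OF N(1) c(1)] by simp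
    moreover have "f x \<in> V" using xO O(3) by auto
    ultimately have "f x \<in> Q \<inter> V"
      using chart_inj[OF N(2) c(2)] by (meson inf_le2 inj_on_image_mem_iff)
    then show "x \<in> {x \<in> O'. f x \<in> Q}" using xO by simp
  next
    fix x assume "x \<in> {x \<in> O'. f x \<in> Q}"
    then show "x \<in> {x \<in> U. \<phi> x \<in> ?E}"
      using O chart_inv[OF N(1) c(1)] by (auto simp: subset_iff image_subset_iff)
  qed
  ultimately show ?thesis by simp
qed

lemma smooth_at_preimage:
  assumes "smooth_atlas N" "smooth_atlas N'" "smooth_at N N' f p"
  obtains O' where "openin (mtop N) O'" "p \<in> O'"
    "\<And>Q. openin (mtop N') Q \<Longrightarrow> openin (mtop N) {x \<in> O'. f x \<in> Q}"
proof -
  obtain O1 U \<phi> V \<psi> where c: "(U, \<phi>) \<in> atlas N" "(V, \<psi>) \<in> atlas N'"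
    and O: "openin (mtop N) O1" "p \<in> O1" "O1 \<subseteq> U" "f ` O1 \<subseteq> V"
    and s: "smooth_on (\<phi> ` O1) (\<lambda>y. \<psi> (f (inv_into U \<phi> y)))"
    using assms(3) unfolding smooth_at_def by blast
  show ?thesis
    by (rule that[OF O(1,2)]) (rule smooth_at_preimages[OF assms(1,2) c O(1,3,4) s])
qed

lemma smooth_at_in_carrier:
  assumes "smooth_atlas N" "smooth_atlas N'" "smooth_at N N' f p"
  shows "p \<in> carrier N" "f p \<in> carrier N'"
proof -
  obtain O1 U \<phi> V \<psi> where c: "(U, \<phi>) \<in> atlas N" "(V, \<psi>) \<in> atlas N'"
    and O: "p \<in> O1" "O1 \<subseteq> U" "f ` O1 \<subseteq> V"
    using assms(3) unfolding smooth_at_def by blast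
  then have "p \<in> U" "f p \<in> V" by auto
  then show "p \<in> carrier N" "f p \<in> carrier N'"
    using chart_subset[OF assms(1) c(1)] chart_subset[OF assms(2) c(2)] by auto
qed

lemma smooth_at_nbhd:
  assumes "smooth_atlas N" "smooth_atlas N'" "smooth_at N N' f p" "openin (mtop N') Q" "f p \<in> Q"
  obtains O' where "openin (mtop N) O'" "p \<in> O'" "\<And>x. x \<in> O' \<Longrightarrow> f x \<in> Q"
proof (rule smooth_at_preimage[OF assms(1-3)])
  fix O1 assume O1: "openin (mtop N) O1" "p \<in> O1"
    and pre: "\<And>Q. openin (mtop N') Q \<Longrightarrow> openin (mtop N) {x \<in> O1. f x \<in> Q}"
  have "p \<in> {x \<in> O1. f x \<in> Q}" using O1(2) assms(5) by simp
  with pre[OF assms(4)] show ?thesis by (rule that) simp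
qed

text \<open>Two coordinate expressions of \<open>f\<close> differ by transition maps on either side,
  once the neighbourhood is shrunk into all the chart domains involved.\<close>

lemma smooth_at_any_charts:
  assumes N: "smooth_atlas N" "smooth_atlas N'" and f: "smooth_at N N' f p"
    and c': "(U', \<phi>') \<in> atlas N" "p \<in> U'" "(V', \<psi>') \<in> atlas N'" "f p \<in> V'"
  obtains O' where "openin (mtop N) O'" "p \<in> O'" "O' \<subseteq> U'" "f ` O' \<subseteq> V'"
    "smooth_on (\<phi>' ` O') (\<lambda>y. \<psi>' (f (inv_into U' \<phi>' y)))"
proof -
  obtain O1 U \<phi> V \<psi> where c: "(U, \<phi>) \<in> atlas N" "(V, \<psi>) \<in> atlas N'"
    and O: "openin (mtop N) O1" "p \<in> O1" "O1 \<subseteq> U" "f ` O1 \<subseteq> V"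
    and s: "smooth_on (\<phi> ` O1) (\<lambda>y. \<psi> (f (inv_into U \<phi> y)))"
    using f unfolding smooth_at_def by blast
  define O' where "O' = {x \<in> O1. f x \<in> V'} \<inter> U'"
  have oO: "openin (mtop N) O'" unfolding O'_def
    by (intro openin_Int smooth_at_preimages[OF N c O(1,3,4) s] chart_openin[OF N(2) c'(3)] chart_openin[OF N(1) c'(1)])
  have sub: "O' \<subseteq> O1" "O' \<subseteq> U" "O' \<subseteq> U'" "f ` O' \<subseteq> V'" "f ` O' \<subseteq> V" using O by (auto simp: O'_def)
  note i = chart_inv[OF N(1) c(1)] and i' = chart_inv[OF N(1) c'(1)] and j = chart_inv[OF N(2) c(2)]
  have iO: "x \<in> O' \<Longrightarrow> inv_into U \<phi> (\<phi> x) = x" "x \<in> O' \<Longrightarrow> inv_into U' \<phi>' (\<phi>' x) = x"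
    "x \<in> O' \<Longrightarrow> f x \<in> V" "x \<in> O' \<Longrightarrow> f x \<in> V'" for x
    using i i' sub by blast+
  have open': "open (\<phi>' ` O')" by (rule chart_open_image[OF N(1) c'(1) oO sub(3)])
  have open1: "open (\<phi> ` O')" by (rule chart_open_image[OF N(1) c(1) oO sub(2)])
  have open2: "open (\<psi> ` (V \<inter> V'))"
    using chart_openin[OF N(2)] c c' by (intro chart_open_image[OF N(2) c(2)]) auto
  have 1: "smooth_on (\<phi>' ` O') (\<lambda>y. \<phi> (inv_into U' \<phi>' y))"
    by (rule smooth_on_subset[OF chart_transition[OF N(1) c'(1) c(1)]]) (use sub in auto)
  have 2: "smooth_on (\<phi> ` O') (\<lambda>y. \<psi> (f (inv_into U \<phi> y)))"
    by (rule smooth_on_subset[OF s]) (use sub in auto)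
  have 12: "smooth_on (\<phi>' ` O') (\<lambda>y. \<psi> (f (inv_into U \<phi> (\<phi> (inv_into U' \<phi>' y)))))"
    by (rule smooth_on_compose[OF 1 2 open' open1]) (auto simp: iO)
  have 123: "smooth_on (\<phi>' ` O') (\<lambda>y. \<psi>' (inv_into V \<psi> (\<psi> (f (inv_into U \<phi> (\<phi> (inv_into U' \<phi>' y)))))))"
    by (rule smooth_on_compose[OF 12 chart_transition[OF N(2) c(2) c'(3)] open' open2]) (auto simp: iO)
  have "smooth_on (\<phi>' ` O') (\<lambda>y. \<psi>' (f (inv_into U' \<phi>' y)))"
  proof (rule smooth_on_cong[OF 123 open'])
    fix y assume "y \<in> \<phi>' ` O'"
    then obtain x where x: "x \<in> O'" "y = \<phi>' x" by blast
    then have "x \<in> U" "x \<in> U'" "f x \<in> V" using sub by auto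
    then show "\<psi>' (inv_into V \<psi> (\<psi> (f (inv_into U \<phi> (\<phi> (inv_into U' \<phi>' y)))))) = \<psi>' (f (inv_into U' \<phi>' y))"
      using x by (simp add: i i' j)
  qed
  moreover have "p \<in> O'" using O c' by (simp add: O'_def)
  ultimately show ?thesis using that oO sub by blast
qed

lemma smooth_at_compose:
  assumes N: "smooth_atlas N" "smooth_atlas N'" "smooth_atlas N''"
    and f: "smooth_at N N' f p" and g: "smooth_at N' N'' g (f p)"
  shows "smooth_at N N'' (\<lambda>x. g (f x)) p"
proof -
  obtain O2 V \<psi> W \<kappa> where c: "(V, \<psi>) \<in> atlas N'" "(W, \<kappa>) \<in> atlas N''"
    and O: "openin (mtop N') O2" "f p \<in> O2" "O2 \<subseteq> V" "g ` O2 \<subseteq> W"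
    and s: "smooth_on (\<psi> ` O2) (\<lambda>y. \<kappa> (g (inv_into V \<psi> y)))"
    using g unfolding smooth_at_def by blast
  have p: "p \<in> carrier N" by (rule smooth_at_in_carrier(1)[OF N(1,2) f])
  have fpV: "f p \<in> V" using O by blast
  obtain U \<phi> where c1: "(U, \<phi>) \<in> atlas N" "p \<in> U" using chart_exists[OF N(1) p] by blast
  \<comment> \<open>The chart of the middle manifold is dictated by \<open>g\<close>; changing
    charts for \<open>f\<close> makes the two coordinate expressions composable.\<close>
  obtain O1 where O1: "openin (mtop N) O1" "p \<in> O1" "O1 \<subseteq> U" "f ` O1 \<subseteq> V"
    and s1: "smooth_on (\<phi> ` O1) (\<lambda>y. \<psi> (f (inv_into U \<phi> y)))"
    by (rule smooth_at_any_charts[OF N(1,2) f c1 c(1) fpV])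
  let ?O = "{x \<in> O1. f x \<in> O2}"
  have oO: "openin (mtop N) ?O"
    by (rule smooth_at_preimages[OF N(1,2) c1(1) c(1) O1(1,3,4) s1 O(1)])
  have op: "open (\<phi> ` ?O)" by (rule chart_open_image[OF N(1) c1(1) oO]) (use O1 in auto)
  note i = chart_inv[OF N(1) c1(1)] and j = chart_inv[OF N(2) c(1)]
  have 1: "smooth_on (\<phi> ` ?O) (\<lambda>y. \<kappa> (g (inv_into V \<psi> (\<psi> (f (inv_into U \<phi> y))))))"
  proof (rule smooth_on_compose[OF _ s op])
    show "smooth_on (\<phi> ` ?O) (\<lambda>y. \<psi> (f (inv_into U \<phi> y)))"
      by (rule smooth_on_subset[OF s1]) auto
    show "open (\<psi> ` O2)" by (rule chart_open_image[OF N(2) c(1) O(1,3)])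
    show "(\<lambda>y. \<psi> (f (inv_into U \<phi> y))) ` \<phi> ` ?O \<subseteq> \<psi> ` O2" using O1 by (auto simp: i subset_iff)
  qed
  have "smooth_on (\<phi> ` ?O) (\<lambda>y. \<kappa> (g (f (inv_into U \<phi> y))))"
    by (rule smooth_on_cong[OF 1 op]) (use O O1 in \<open>auto simp: i j subset_iff\<close>)
  moreover have "(\<lambda>x. g (f x)) ` ?O \<subseteq> W" using O by auto
  ultimately show ?thesis
    using c1 c O O1 oO unfolding smooth_at_def by (intro exI[of _ ?O] exI[of _ U] exI[of _ \<phi>] exI[of _ W] exI[of _ \<kappa>]) auto
qed

lemma smooth_at_cong:
  assumes N: "smooth_atlas N" and f: "smooth_at N N' f p"
    and Q: "openin (mtop N) Q" "p \<in> Q" "\<And>x. x \<in> Q \<Longrightarrow> f x = g x"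
  shows "smooth_at N N' g p"
proof -
  obtain O1 U \<phi> V \<psi> where c: "(U, \<phi>) \<in> atlas N" "(V, \<psi>) \<in> atlas N'"
    and O: "openin (mtop N) O1" "p \<in> O1" "O1 \<subseteq> U" "f ` O1 \<subseteq> V"
    and s: "smooth_on (\<phi> ` O1) (\<lambda>y. \<psi> (f (inv_into U \<phi> y)))"
    using f unfolding smooth_at_def by blast
  have oO: "openin (mtop N) (O1 \<inter> Q)" using O Q by blast
  have op: "open (\<phi> ` (O1 \<inter> Q))" by (rule chart_open_image[OF N c(1) oO]) (use O in auto)
  have s': "smooth_on (\<phi> ` (O1 \<inter> Q)) (\<lambda>y. \<psi> (f (inv_into U \<phi> y)))"
    by (rule smooth_on_subset[OF s]) auto
  have i: "x \<in> O1 \<Longrightarrow> inv_into U \<phi> (\<phi> x) = x" for x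
    using chart_inv[OF N c(1)] O by blast
  have "smooth_on (\<phi> ` (O1 \<inter> Q)) (\<lambda>y. \<psi> (g (inv_into U \<phi> y)))"
    by (rule smooth_on_cong[OF s' op]) (use Q i in auto)
  moreover have "g ` (O1 \<inter> Q) \<subseteq> V" using O Q(3) by fastforce
  ultimately show ?thesis using c O Q(2) oO unfolding smooth_at_def
    by (intro exI[of _ "O1 \<inter> Q"] exI[of _ U] exI[of _ \<phi>] exI[of _ V] exI[of _ \<psi>]) auto
qed

text \<open>From here on, global smoothness is always proved and used pointwise. Continuity and the
  condition on every pair of charts are both local, so they can be recovered from
  neighbourhoods.\<close>

lemma smooth_map_iff:
  assumes N: "smooth_atlas N" "smooth_atlas N'"
  shows "smooth_map N N' f \<longleftrightarrow> (\<forall>p\<in>carrier N. smooth_at N N' f p)"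
proof
  assume f: "smooth_map N N' f"
  show "\<forall>p\<in>carrier N. smooth_at N N' f p"
  proof
    fix p assume p: "p \<in> carrier N"
    have cf: "continuous_map (mtop N) (mtop N') f" using f by (simp add: smooth_map_def)
    then have "f p \<in> carrier N'" using p continuous_map_image_subset_topspace by blast
    then obtain V \<psi> where V: "(V, \<psi>) \<in> atlas N'" "f p \<in> V" using chart_exists[OF N(2)] by blast
    obtain U \<phi> where U: "(U, \<phi>) \<in> atlas N" "p \<in> U" using chart_exists[OF N(1) p] by blast
    have "openin (mtop N) ({x \<in> carrier N. f x \<in> V} \<inter> U)"
      by (intro openin_Int openin_continuous_map_preimage[OF cf] chart_openin[OF N(1) U(1)] chart_openin[OF N(2) V(1)])
    moreover have "{x \<in> carrier N. f x \<in> V} \<inter> U = {x \<in> U. f x \<in> V}"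
      using chart_subset[OF N(1) U(1)] by auto
    moreover have "smooth_on (\<phi> ` {x \<in> U. f x \<in> V}) (\<lambda>y. \<psi> (f (inv_into U \<phi> y)))"
      using f U V unfolding smooth_map_def comp_def by blast
    ultimately show "smooth_at N N' f p"
      unfolding smooth_at_def using U V
      by (intro exI[of _ "{x \<in> U. f x \<in> V}"] exI[of _ U] exI[of _ \<phi>] exI[of _ V] exI[of _ \<psi>]) auto
  qed
next
  assume f: "\<forall>p\<in>carrier N. smooth_at N N' f p"
  have "continuous_map (mtop N) (mtop N') f"
    unfolding continuous_map_def
  proof (intro conjI allI impI)
    show "f \<in> carrier N \<rightarrow> carrier N'" using f smooth_at_in_carrier(2)[OF N] by blast
    fix Q assume Q: "openin (mtop N') Q"
    show "openin (mtop N) {x \<in> carrier N. f x \<in> Q}"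
    proof (subst openin_subopen, intro ballI)
      fix p assume p: "p \<in> {x \<in> carrier N. f x \<in> Q}"
      then have "smooth_at N N' f p" using f by simp
      then obtain O' where "openin (mtop N) O'" "p \<in> O'" "\<And>x. x \<in> O' \<Longrightarrow> f x \<in> Q"
        by (rule smooth_at_nbhd[OF N _ Q]) (use p in auto)
      then show "\<exists>T. openin (mtop N) T \<and> p \<in> T \<and> T \<subseteq> {x \<in> carrier N. f x \<in> Q}"
        using openin_subset by (intro exI[of _ O']) blast
    qed
  qed
  moreover have "smooth_on (\<phi> ` {x \<in> U. f x \<in> V}) (\<psi> \<circ> f \<circ> inv_into U \<phi>)"
    if ab: "(U, \<phi>) \<in> atlas N" "(V, \<psi>) \<in> atlas N'" for U \<phi> V \<psi>
  proof (rule smooth_on_local)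
    fix y assume "y \<in> \<phi> ` {x \<in> U. f x \<in> V}"
    then obtain x where x: "x \<in> U" "f x \<in> V" "y = \<phi> x" by blast
    have fx: "smooth_at N N' f x" using f x chart_subset[OF N(1) ab(1)] by auto
    obtain O' where "openin (mtop N) O'" "x \<in> O'" "O' \<subseteq> U"
      "smooth_on (\<phi> ` O') (\<lambda>y. \<psi> (f (inv_into U \<phi> y)))"
      by (rule smooth_at_any_charts[OF N fx ab(1) x(1) ab(2) x(2)])
    then show "\<exists>T. open T \<and> y \<in> T \<and> smooth_on T (\<psi> \<circ> f \<circ> inv_into U \<phi>)"
      using chart_open_image[OF N(1), of U \<phi>] ab x by (intro exI[of _ "\<phi> ` O'"]) (auto simp: comp_def)
  qed
  ultimately show "smooth_map N N' f" unfolding smooth_map_def by blast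
qed

lemma smooth_map_smooth_at:
  "smooth_atlas N \<Longrightarrow> smooth_atlas N' \<Longrightarrow> smooth_map N N' f \<Longrightarrow> p \<in> carrier N \<Longrightarrow> smooth_at N N' f p"
  by (simp add: smooth_map_iff)

text \<open>The inverse may be given by any formula \<open>g\<close>: it agrees with
  \<open>inv_into\<close> on the carrier, which is a neighbourhood of each of its points.\<close>

lemma diffeomorphismI:
  assumes N: "smooth_atlas N" "smooth_atlas N'"
    and f: "\<And>p. p \<in> carrier N \<Longrightarrow> smooth_at N N' f p" and g: "\<And>q. q \<in> carrier N' \<Longrightarrow> smooth_at N' N g q"
    and gf: "\<And>p. p \<in> carrier N \<Longrightarrow> g (f p) = p" and fg: "\<And>q. q \<in> carrier N' \<Longrightarrow> f (g q) = q"
  shows "diffeomorphism N N' f"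
proof -
  have bij: "bij_betw f (carrier N) (carrier N')"
    by (rule bij_betw_byWitness[of _ g])
      (use gf fg smooth_at_in_carrier(2)[OF N f] smooth_at_in_carrier(2)[OF N(2,1) g] in auto)
  have "inv_into (carrier N) f q = g q" if "q \<in> carrier N'" for q
    using that bij fg smooth_at_in_carrier(2)[OF N(2,1) g[OF that]] by (metis bij_betw_def inv_into_f_f)
  then have "smooth_at N' N (inv_into (carrier N) f) q" if "q \<in> carrier N'" for q
    by (intro smooth_at_cong[OF N(2) g[OF that] openin_topspace]) (use that in auto)
  then show ?thesis using bij f N by (simp add: diffeomorphism_def smooth_map_iff)
qed

lemma diffeomorphismD:
  assumes N: "smooth_atlas N" "smooth_atlas N'" and f: "diffeomorphism N N' f"
  obtains g where "\<And>p. p \<in> carrier N \<Longrightarrow> smooth_at N N' f p" "\<And>q. q \<in> carrier N' \<Longrightarrow> smooth_at N' N g q"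
    "\<And>p. p \<in> carrier N \<Longrightarrow> g (f p) = p" "\<And>q. q \<in> carrier N' \<Longrightarrow> f (g q) = q"
proof (rule that[of "inv_into (carrier N) f"])
  have bij: "bij_betw f (carrier N) (carrier N')" using f by (simp add: diffeomorphism_def)
  show "inv_into (carrier N) f (f p) = p" if "p \<in> carrier N" for p
    using that bij by (simp add: bij_betw_def)
  show "f (inv_into (carrier N) f q) = q" if "q \<in> carrier N'" for q
    using that bij by (simp add: bij_betw_def f_inv_into_f)
  show "smooth_at N N' f p" if "p \<in> carrier N" for p
    using smooth_map_smooth_at[OF N _ that] f by (simp add: diffeomorphism_def)
  show "smooth_at N' N (inv_into (carrier N) f) q" if "q \<in> carrier N'" for q
    using smooth_map_smooth_at[OF N(2,1) _ that] f by (simp add: diffeomorphism_def)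
qed

subsection \<open>Open submanifolds, model spaces and products\<close>

lemma carrier_open_submanifold [simp]: "carrier (open_submanifold N W) = carrier N \<inter> W"
  by (simp add: open_submanifold_def)

lemma carrier_model [simp]: "carrier model_manifold = UNIV"
  by (simp add: model_manifold_def)

lemma carrier_prod [simp]: "carrier (prod_manifold N N') = carrier N \<times> carrier N'"
  by (simp add: prod_manifold_def)

lemma openin_model: "openin (mtop model_manifold) O' \<longleftrightarrow> open O'"
  by (simp add: model_manifold_def flip: open_openin)

lemma openin_Times_prod:
  "openin (mtop N) O1 \<Longrightarrow> openin (mtop N') O2 \<Longrightarrow> openin (mtop (prod_manifold N N')) (O1 \<times> O2)"
  by (simp add: prod_manifold_def openin_prod_Times_iff)

lemma smooth_atlas_open_submanifold [intro, simp]: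
  assumes N: "smooth_atlas N" and W: "openin (mtop N) W"
  shows "smooth_atlas (open_submanifold N W)"
  unfolding smooth_atlas_def
proof (intro conjI)
  \<comment> \<open>Restriction keeps the chart map and shrinks its domain, so the inverse charts
    are formally different functions and must be compared on the smaller image.\<close>
  have inv_W: "inv_into (U \<inter> W) \<phi> y = inv_into U \<phi> y" if "(U, \<phi>) \<in> atlas N" "y \<in> \<phi> ` (U \<inter> W)" for U \<phi> y
    using that chart_inj[OF N that(1)]
    by (metis (no_types, lifting) IntD1 f_inv_into_f inf_le1 inj_on_subset inv_into_f_f inv_into_into)
  show "carrier (open_submanifold N W) = (\<Union>(U, \<phi>)\<in>atlas (open_submanifold N W). U)"
    using N by (auto simp: open_submanifold_def smooth_atlas_def)
  show "\<forall>(U, \<phi>)\<in>atlas (open_submanifold N W). openin (mtop (open_submanifold N W)) U \<and> open (\<phi> ` U) \<and>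
      homeomorphic_map (subtopology (mtop (open_submanifold N W)) U) (top_of_set (\<phi> ` U)) \<phi>"
  proof (clarify)
    fix U' \<phi> assume "(U', \<phi>) \<in> atlas (open_submanifold N W)"
    then obtain U where U: "(U, \<phi>) \<in> atlas N" "U' = U \<inter> W" by (auto simp: open_submanifold_def)
    have o: "openin (mtop N) U'" using U W chart_openin[OF N U(1)] by blast
    have s: "homeomorphic_map (subtopology (subtopology (mtop N) U) U') (subtopology (top_of_set (\<phi> ` U)) (\<phi> ` U')) \<phi>"
      using chart_subset[OF N U(1)] U(2)
      by (intro homeomorphic_map_subtopologies[OF chart_homeo[OF N U(1)]]) auto
    have "U \<inter> U' = W \<inter> U'" "\<phi> ` U \<inter> \<phi> ` U' = \<phi> ` U'" using U by auto
    with s have s': "homeomorphic_map (subtopology (subtopology (mtop N) W) U') (top_of_set (\<phi> ` U')) \<phi>"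
      by (simp add: subtopology_subtopology)
    show "openin (mtop (open_submanifold N W)) U' \<and> open (\<phi> ` U') \<and>
      homeomorphic_map (subtopology (mtop (open_submanifold N W)) U') (top_of_set (\<phi> ` U')) \<phi>"
      using o s' U chart_open_image[OF N U(1) o] openin_open_subtopology[OF W]
      by (simp add: open_submanifold_def)
  qed
  show "\<forall>(U, \<phi>)\<in>atlas (open_submanifold N W). \<forall>(V, \<psi>)\<in>atlas (open_submanifold N W).
       smooth_on (\<phi> ` (U \<inter> V)) (\<psi> \<circ> inv_into U \<phi>)"
  proof (clarify)
    fix U' \<phi> V' \<psi> assume "(U', \<phi>) \<in> atlas (open_submanifold N W)" "(V', \<psi>) \<in> atlas (open_submanifold N W)"
    then obtain U V where U: "(U, \<phi>) \<in> atlas N" "U' = U \<inter> W" and V: "(V, \<psi>) \<in> atlas N" "V' = V \<inter> W"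
      by (auto simp: open_submanifold_def)
    have "openin (mtop N) (U' \<inter> V')" using U V W chart_openin[OF N U(1)] chart_openin[OF N V(1)] by blast
    then have op: "open (\<phi> ` (U' \<inter> V'))" using U by (intro chart_open_image[OF N U(1)]) auto
    have s: "smooth_on (\<phi> ` (U' \<inter> V')) (\<lambda>y. \<psi> (inv_into U \<phi> y))"
      by (rule smooth_on_subset[OF chart_transition[OF N U(1) V(1)]]) (use U V in auto)
    show "smooth_on (\<phi> ` (U' \<inter> V')) (\<psi> \<circ> inv_into U' \<phi>)"
    proof (rule smooth_on_cong[OF s op])
      fix y assume "y \<in> \<phi> ` (U' \<inter> V')"
      then have "y \<in> \<phi> ` (U \<inter> W)" using U by blast
      then show "\<psi> (inv_into U \<phi> y) = (\<psi> \<circ> inv_into U' \<phi>) y" using inv_W[OF U(1)] U(2) by simp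
    qed
  qed
qed

text \<open>In a chart both maps are the identity. Having both directions turns every change between
  a manifold and an open part of it, in domain or codomain, into a composition.\<close>

lemma smooth_at_inclusion:
  assumes N: "smooth_atlas N" and W: "openin (mtop N) W" and p: "p \<in> W"
  shows "smooth_at (open_submanifold N W) N (\<lambda>x. x) p" "smooth_at N (open_submanifold N W) (\<lambda>x. x) p"
proof -
  have "p \<in> carrier N" using W p openin_subset by blast
  then obtain U \<phi> where U: "(U, \<phi>) \<in> atlas N" "p \<in> U" using chart_exists[OF N] by blast
  have U': "(U \<inter> W, \<phi>) \<in> atlas (open_submanifold N W)" using U by (force simp: open_submanifold_def)
  have o: "openin (mtop N) (U \<inter> W)" using W chart_openin[OF N U(1)] by blast
  have o': "openin (mtop (open_submanifold N W)) (U \<inter> W)"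
    using o openin_open_subtopology[OF W] by (simp add: open_submanifold_def)
  have op: "open (\<phi> ` (U \<inter> W))" using chart_open_image[OF N U(1) o] by simp
  have "smooth_on (\<phi> ` (U \<inter> W)) (\<lambda>y. \<phi> (inv_into U' \<phi> y))" if "U \<inter> W \<subseteq> U'" for U'
    by (rule smooth_on_cong[OF smooth_on_id op]) (use that in \<open>auto simp: f_inv_into_f image_mono[THEN subsetD]\<close>)
  then have s: "smooth_on (\<phi> ` (U \<inter> W)) (\<lambda>y. \<phi> (inv_into (U \<inter> W) \<phi> y))"
    "smooth_on (\<phi> ` (U \<inter> W)) (\<lambda>y. \<phi> (inv_into U \<phi> y))" by simp_all
  show "smooth_at (open_submanifold N W) N (\<lambda>x. x) p"
    unfolding smooth_at_def using U U' o' p s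
    by (intro exI[of _ "U \<inter> W"] exI[of _ \<phi>] exI[of _ U]) auto
  show "smooth_at N (open_submanifold N W) (\<lambda>x. x) p"
    unfolding smooth_at_def using U U' o p s
    by (intro exI[of _ "U \<inter> W"] exI[of _ U] exI[of _ \<phi>]) auto
qed

lemma smooth_at_open_submanifold_dom:
  assumes "smooth_atlas N" "smooth_atlas N'" "openin (mtop N) W"
  shows "smooth_at (open_submanifold N W) N' f p \<longleftrightarrow> p \<in> W \<and> smooth_at N N' f p"
proof (intro iffI conjI)
  assume f: "smooth_at (open_submanifold N W) N' f p"
  show p: "p \<in> W"
    using smooth_at_in_carrier(1)[OF _ _ f] assms by auto
  show "smooth_at N N' f p"
    by (rule smooth_at_compose[OF _ _ _ smooth_at_inclusion(2)[OF assms(1,3) p] f]) (use assms in auto)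
next
  assume f: "p \<in> W \<and> smooth_at N N' f p"
  show "smooth_at (open_submanifold N W) N' f p"
    by (rule smooth_at_compose[OF _ _ _ smooth_at_inclusion(1)]) (use assms f in auto)
qed

lemma smooth_at_open_submanifold_cod:
  assumes "smooth_atlas N" "smooth_atlas N'" "openin (mtop N') W"
  shows "smooth_at N (open_submanifold N' W) f p \<longleftrightarrow> f p \<in> W \<and> smooth_at N N' f p"
proof (intro iffI conjI)
  assume f: "smooth_at N (open_submanifold N' W) f p"
  show p: "f p \<in> W"
    using smooth_at_in_carrier(2)[OF _ _ f] assms by auto
  show "smooth_at N N' f p"
    by (rule smooth_at_compose[OF _ _ _ f smooth_at_inclusion(1)[OF assms(2,3) p]]) (use assms in auto)
next
  assume f: "f p \<in> W \<and> smooth_at N N' f p"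
  show "smooth_at N (open_submanifold N' W) f p"
    by (rule smooth_at_compose[of _ N', OF _ _ _ _ smooth_at_inclusion(2)]) (use assms f in auto)
qed

lemma smooth_at_id:
  assumes "smooth_atlas N" "p \<in> carrier N"
  shows "smooth_at N N (\<lambda>x. x) p"
  using smooth_at_inclusion(1)[OF assms(1) openin_topspace assms(2)] assms
  by (simp add: smooth_at_open_submanifold_dom)

section \<open>Model spaces as manifolds and maps into them\<close>

lemma smooth_atlas_model [intro, simp]: "smooth_atlas model_manifold"
  unfolding smooth_atlas_def model_manifold_def
  by (simp add: smooth_on_id[folded id_def])

lemma smooth_at_model_iff:
  "smooth_at model_manifold model_manifold f x \<longleftrightarrow> (\<exists>T. open T \<and> x \<in> T \<and> smooth_on T f)"
  unfolding smooth_at_def openin_model by (simp add: model_manifold_def)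

lemma smooth_at_imp_smooth_on:
  assumes "\<And>x. x \<in> S \<Longrightarrow> smooth_at model_manifold model_manifold f x"
  shows "smooth_on S f"
  using assms unfolding smooth_at_model_iff by (intro smooth_on_local)

lemma smooth_at_chart:
  assumes N: "smooth_atlas N" and c: "(U, \<phi>) \<in> atlas N" and p: "p \<in> U"
  shows "smooth_at N model_manifold \<phi> p"
proof -
  have "smooth_on (\<phi> ` U) (\<lambda>y. id (\<phi> (inv_into U \<phi> y)))"
    by (rule smooth_on_cong[OF smooth_on_id chart_open_range[OF N c]]) (simp add: f_inv_into_f)
  then show ?thesis unfolding smooth_at_def using c p chart_openin[OF N c]
    by (intro exI[of _ U] exI[of _ \<phi>] exI[of _ UNIV] exI[of _ id]) (auto simp: model_manifold_def)
qed

lemma smooth_at_chart_inv: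
  assumes N: "smooth_atlas N" and c: "(U, \<phi>) \<in> atlas N" and y: "y \<in> \<phi> ` U"
  shows "smooth_at model_manifold N (inv_into U \<phi>) y"
proof -
  have "smooth_on (\<phi> ` U) (\<lambda>y. \<phi> (inv_into U \<phi> (inv_into UNIV id y)))"
    by (rule smooth_on_cong[OF smooth_on_id chart_open_range[OF N c]]) (simp add: f_inv_into_f)
  then show ?thesis unfolding smooth_at_def openin_model using c y chart_open_range[OF N c]
    by (intro exI[of _ "\<phi> ` U"] exI[of _ UNIV] exI[of _ id] exI[of _ U] exI[of _ \<phi>])
      (auto simp: model_manifold_def inv_into_into)
qed

lemma smooth_at_const:
  assumes N: "smooth_atlas N" "smooth_atlas N'" and "p \<in> carrier N" "c \<in> carrier N'"
  shows "smooth_at N N' (\<lambda>x. c) p"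
proof -
  obtain U \<phi> where U: "(U, \<phi>) \<in> atlas N" "p \<in> U" using chart_exists[OF N(1)] assms by blast
  obtain V \<psi> where V: "(V, \<psi>) \<in> atlas N'" "c \<in> V" using chart_exists[OF N(2)] assms by blast
  show ?thesis unfolding smooth_at_def using U V chart_openin[OF N(1) U(1)]
    by (intro exI[of _ U] exI[of _ \<phi>] exI[of _ V] exI[of _ \<psi>]) (auto simp: smooth_on_const)
qed

lemma smooth_at_model_comp:
  assumes "smooth_atlas N" "smooth_at N model_manifold f p" "smooth_on UNIV h"
  shows "smooth_at N model_manifold (\<lambda>x. h (f x)) p"
proof (rule smooth_at_compose[OF assms(1) _ _ assms(2)])
  show "smooth_at model_manifold model_manifold h (f p)"
    unfolding smooth_at_model_iff using assms(3) by (intro exI[of _ UNIV]) auto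
qed auto

lemmas smooth_at_model_linear = smooth_at_model_comp[OF _ _ smooth_on_linear]

text \<open>Shared by two different targets: the model manifold of a product type, whose only chart
  is the identity, and the product of two manifolds.\<close>

lemma smooth_at_Pair_gen:
  assumes N: "smooth_atlas N" "smooth_atlas N1" "smooth_atlas N2"
    and f: "smooth_at N N1 f p" and g: "smooth_at N N2 g p"
  obtains O' U \<phi> V1 \<psi>1 V2 \<psi>2 where "(U, \<phi>) \<in> atlas N" "(V1, \<psi>1) \<in> atlas N1" "(V2, \<psi>2) \<in> atlas N2"
     "openin (mtop N) O'" "p \<in> O'" "O' \<subseteq> U" "f ` O' \<subseteq> V1" "g ` O' \<subseteq> V2"
     "smooth_on (\<phi> ` O') (\<lambda>y. (\<psi>1 (f (inv_into U \<phi> y)), \<psi>2 (g (inv_into U \<phi> y))))"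
proof -
  have p: "p \<in> carrier N" by (rule smooth_at_in_carrier[OF N(1,2) f])
  obtain U \<phi> where U: "(U, \<phi>) \<in> atlas N" "p \<in> U" using chart_exists[OF N(1) p] by blast
  obtain V1 \<psi>1 where V1: "(V1, \<psi>1) \<in> atlas N1" "f p \<in> V1"
    using chart_exists[OF N(2) smooth_at_in_carrier(2)[OF N(1,2) f]] by blast
  obtain V2 \<psi>2 where V2: "(V2, \<psi>2) \<in> atlas N2" "g p \<in> V2"
    using chart_exists[OF N(3) smooth_at_in_carrier(2)[OF N(1,3) g]] by blast
  obtain O1 where O1: "openin (mtop N) O1" "p \<in> O1" "O1 \<subseteq> U" "f ` O1 \<subseteq> V1"
    and s1: "smooth_on (\<phi> ` O1) (\<lambda>y. \<psi>1 (f (inv_into U \<phi> y)))"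
    by (rule smooth_at_any_charts[OF N(1,2) f U V1])
  obtain O2 where O2: "openin (mtop N) O2" "p \<in> O2" "O2 \<subseteq> U" "g ` O2 \<subseteq> V2"
    and s2: "smooth_on (\<phi> ` O2) (\<lambda>y. \<psi>2 (g (inv_into U \<phi> y)))"
    by (rule smooth_at_any_charts[OF N(1,3) g U V2])
  have o: "openin (mtop N) (O1 \<inter> O2)" using O1 O2 by blast
  have op: "open (\<phi> ` (O1 \<inter> O2))" by (rule chart_open_image[OF N(1) U(1) o]) (use O1 in auto)
  have "smooth_on (\<phi> ` (O1 \<inter> O2)) (\<lambda>y. (\<psi>1 (f (inv_into U \<phi> y)), \<psi>2 (g (inv_into U \<phi> y))))"
    by (intro smooth_on_Pair smooth_on_subset[OF s1] smooth_on_subset[OF s2] op) auto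
  with _ _ _ _ show ?thesis
    by (rule that[OF U(1) V1(1) V2(1) o]) (use O1 O2 in auto)
qed

lemma smooth_at_model_Pair:
  assumes N: "smooth_atlas N"
    and f: "smooth_at N model_manifold f p" and g: "smooth_at N model_manifold g p"
  shows "smooth_at N model_manifold (\<lambda>x. (f x, g x)) p"
proof -
  obtain O' U \<phi> V1 V2 and \<psi>1 \<psi>2 where h: "(U, \<phi>) \<in> atlas N" "(V1, \<psi>1) \<in> atlas model_manifold" "(V2, \<psi>2) \<in> atlas model_manifold"
     "openin (mtop N) O'" "p \<in> O'" "O' \<subseteq> U" "f ` O' \<subseteq> V1" "g ` O' \<subseteq> V2"
     "smooth_on (\<phi> ` O') (\<lambda>y. (\<psi>1 (f (inv_into U \<phi> y)), \<psi>2 (g (inv_into U \<phi> y))))"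
    by (rule smooth_at_Pair_gen[OF N _ _ f g]) auto
  then have "smooth_on (\<phi> ` O') (\<lambda>y. id (f (inv_into U \<phi> y), g (inv_into U \<phi> y)))"
    by (simp add: model_manifold_def)
  then show ?thesis
    unfolding smooth_at_def using h(1,4-6)
    by (intro exI[of _ O'] exI[of _ U] exI[of _ \<phi>] exI[of _ UNIV] exI[of _ id]) (auto simp: model_manifold_def)
qed

lemma smooth_at_model_add:
  assumes N: "smooth_atlas N"
    and f: "smooth_at N model_manifold f p" and g: "smooth_at N model_manifold g p"
  shows "smooth_at N model_manifold (\<lambda>x. f x + g x) p"
proof -
  have "linear (\<lambda>z::'c \<times> 'c. fst z + snd z)"
    by (auto intro!: linearI simp: algebra_simps)
  from smooth_at_model_linear[OF N smooth_at_model_Pair[OF N f g] this] show ?thesis by simp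
qed

lemma inv_into_map_prod:
  assumes "inj_on \<phi> U" "inj_on \<psi> V" "y \<in> \<phi> ` U" "z \<in> \<psi> ` V"
  shows "inv_into (U \<times> V) (map_prod \<phi> \<psi>) (y, z) = (inv_into U \<phi> y, inv_into V \<psi> z)"
proof -
  have i: "inj_on (map_prod \<phi> \<psi>) (U \<times> V)" using assms(1,2) by (rule map_prod_inj_on)
  have m: "(inv_into U \<phi> y, inv_into V \<psi> z) \<in> U \<times> V" using assms(3,4) by (simp add: inv_into_into)
  show ?thesis
    using inv_into_f_f[OF i m] assms(3,4) by (simp add: f_inv_into_f)
qed

lemma atlas_prod_iff:
  "c \<in> atlas (prod_manifold N N') \<longleftrightarrow>
     (\<exists>U \<phi> V \<psi>. c = (U \<times> V, map_prod \<phi> \<psi>) \<and> (U, \<phi>) \<in> atlas N \<and> (V, \<psi>) \<in> atlas N')"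
  by (auto simp: prod_manifold_def)

lemma smooth_atlas_prod [intro, simp]:
  fixes N :: "('x, 'e::euclidean_model) manifold" and N' :: "('y, 'f::euclidean_model) manifold"
  assumes N: "smooth_atlas N" and N': "smooth_atlas N'"
  shows "smooth_atlas (prod_manifold N N')"
  unfolding smooth_atlas_def
proof (intro conjI)
  show "carrier (prod_manifold N N') = (\<Union>(U, \<phi>)\<in>atlas (prod_manifold N N'). U)"
  proof (intro set_eqI iffI)
    fix x assume "x \<in> carrier (prod_manifold N N')"
    then obtain U \<phi> V \<psi> where "(U, \<phi>) \<in> atlas N" "(V, \<psi>) \<in> atlas N'" "x \<in> U \<times> V"
      using chart_exists[OF N] chart_exists[OF N'] by (cases x) (simp, blast)
    moreover then have "(U \<times> V, map_prod \<phi> \<psi>) \<in> atlas (prod_manifold N N')"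
      by (auto simp: atlas_prod_iff)
    ultimately show "x \<in> (\<Union>(U, \<phi>)\<in>atlas (prod_manifold N N'). U)" by blast
  next
    fix x assume "x \<in> (\<Union>(U, \<phi>)\<in>atlas (prod_manifold N N'). U)"
    then show "x \<in> carrier (prod_manifold N N')"
      using chart_subset[OF N] chart_subset[OF N'] by (auto simp: atlas_prod_iff) blast+
  qed
  show "\<forall>(U, \<phi>)\<in>atlas (prod_manifold N N'). openin (mtop (prod_manifold N N')) U \<and> open (\<phi> ` U) \<and>
      homeomorphic_map (subtopology (mtop (prod_manifold N N')) U) (top_of_set (\<phi> ` U)) \<phi>"
  proof clarify
    fix O' \<phi>' assume "(O', \<phi>') \<in> atlas (prod_manifold N N')"
    then obtain U \<phi> V \<psi> where e: "O' = U \<times> V" "\<phi>' = map_prod \<phi> \<psi>" and U: "(U, \<phi>) \<in> atlas N" and V: "(V, \<psi>) \<in> atlas N'"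
      by (auto simp: atlas_prod_iff)
    have im: "map_prod \<phi> \<psi> ` (U \<times> V) = \<phi> ` U \<times> \<psi> ` V" by (rule map_prod_surj_on[OF refl refl])
    obtain g h where "homeomorphic_maps (subtopology (mtop N) U) (top_of_set (\<phi> ` U)) \<phi> g"
      "homeomorphic_maps (subtopology (mtop N') V) (top_of_set (\<psi> ` V)) \<psi> h"
      using chart_homeo[OF N U] chart_homeo[OF N' V] unfolding homeomorphic_map_maps by blast
    then have "homeomorphic_maps (prod_topology (subtopology (mtop N) U) (subtopology (mtop N') V))
        (prod_topology (top_of_set (\<phi> ` U)) (top_of_set (\<psi> ` V))) (\<lambda>(x,y). (\<phi> x, \<psi> y)) (\<lambda>(x,y). (g x, h y))"
      by (simp only: homeomorphic_maps_prod simp_thms)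
    then have "homeomorphic_map (subtopology (prod_topology (mtop N) (mtop N')) (U \<times> V)) (top_of_set (\<phi> ` U \<times> \<psi> ` V)) (map_prod \<phi> \<psi>)"
      unfolding homeomorphic_map_maps by (auto simp: subtopology_Times map_prod_def)
    then show "openin (mtop (prod_manifold N N')) O' \<and> open (\<phi>' ` O') \<and>
      homeomorphic_map (subtopology (mtop (prod_manifold N N')) O') (top_of_set (\<phi>' ` O')) \<phi>'"
      unfolding e im using chart_openin[OF N U] chart_openin[OF N' V] chart_open_range[OF N U] chart_open_range[OF N' V]
      by (simp add: prod_manifold_def openin_prod_Times_iff open_Times)
  qed
  show "\<forall>(U, \<phi>)\<in>atlas (prod_manifold N N'). \<forall>(V, \<psi>)\<in>atlas (prod_manifold N N').
       smooth_on (\<phi> ` (U \<inter> V)) (\<psi> \<circ> inv_into U \<phi>)"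
  proof clarify
    fix O1 \<phi>1 O2 \<phi>2 assume "(O1, \<phi>1) \<in> atlas (prod_manifold N N')" "(O2, \<phi>2) \<in> atlas (prod_manifold N N')"
    then obtain U \<phi> V \<psi> U' \<phi>' V' \<psi>' where e: "O1 = U \<times> V" "\<phi>1 = map_prod \<phi> \<psi>" "O2 = U' \<times> V'" "\<phi>2 = map_prod \<phi>' \<psi>'"
       and U: "(U, \<phi>) \<in> atlas N" and V: "(V, \<psi>) \<in> atlas N'"
       and U': "(U', \<phi>') \<in> atlas N" and V': "(V', \<psi>') \<in> atlas N'"
      unfolding atlas_prod_iff by blast
    have im: "\<phi>1 ` (O1 \<inter> O2) = \<phi> ` (U \<inter> U') \<times> \<psi> ` (V \<inter> V')"
      unfolding e Times_Int_Times by (rule map_prod_surj_on[OF refl refl])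
    have op1: "open (\<phi> ` (U \<inter> U'))"
      using chart_openin[OF N U] chart_openin[OF N U'] by (intro chart_open_image[OF N U]) auto
    have op2: "open (\<psi> ` (V \<inter> V'))"
      using chart_openin[OF N' V] chart_openin[OF N' V'] by (intro chart_open_image[OF N' V]) auto
    let ?S = "\<phi> ` (U \<inter> U') \<times> \<psi> ` (V \<inter> V')"
    have op: "open ?S" using op1 op2 by (rule open_Times)
    have s1: "smooth_on ?S (\<lambda>z. \<phi>' (inv_into U \<phi> (fst z)))"
      by (rule smooth_on_compose[OF smooth_on_bounded_linear[OF bounded_linear_fst] chart_transition[OF N U U'] op op1]) auto
    have s2: "smooth_on ?S (\<lambda>z. \<psi>' (inv_into V \<psi> (snd z)))"
      by (rule smooth_on_compose[OF smooth_on_bounded_linear[OF bounded_linear_snd] chart_transition[OF N' V V'] op op2]) auto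
    show "smooth_on (\<phi>1 ` (O1 \<inter> O2)) (\<phi>2 \<circ> inv_into O1 \<phi>1)"
      unfolding im
    proof (rule smooth_on_cong[OF smooth_on_Pair[OF s1 s2 op] op])
      fix z assume z: "z \<in> ?S"
      have "inv_into (U \<times> V) (map_prod \<phi> \<psi>) (fst z, snd z) = (inv_into U \<phi> (fst z), inv_into V \<psi> (snd z))"
        by (rule inv_into_map_prod[OF chart_inj[OF N U] chart_inj[OF N' V]]) (use z in auto)
      then show "(\<phi>' (inv_into U \<phi> (fst z)), \<psi>' (inv_into V \<psi> (snd z))) = (\<phi>2 \<circ> inv_into O1 \<phi>1) z"
        by (simp add: e)
    qed
  qed
qed

lemma second_countable_prod_topology:
  assumes "second_countable X" "second_countable Y"
  shows "second_countable (prod_topology X Y)"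
proof -
  obtain B C where B: "countable B" "\<And>V. V \<in> B \<Longrightarrow> openin X V"
    "\<And>U x. openin X U \<Longrightarrow> x \<in> U \<Longrightarrow> \<exists>V\<in>B. x \<in> V \<and> V \<subseteq> U"
    and C: "countable C" "\<And>V. V \<in> C \<Longrightarrow> openin Y V"
    "\<And>U x. openin Y U \<Longrightarrow> x \<in> U \<Longrightarrow> \<exists>V\<in>C. x \<in> V \<and> V \<subseteq> U"
    using assms unfolding second_countable_def by metis
  show ?thesis unfolding second_countable_def
  proof (intro exI[of _ "(\<lambda>(b, c). b \<times> c) ` (B \<times> C)"] conjI allI impI ballI)
    show "countable ((\<lambda>(b, c). b \<times> c) ` (B \<times> C))" using B(1) C(1) by simp
    show "openin (prod_topology X Y) V" if "V \<in> (\<lambda>(b, c). b \<times> c) ` (B \<times> C)" for V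
      using that B(2) C(2) by (auto simp: openin_prod_Times_iff)
    fix U and z assume U: "openin (prod_topology X Y) U \<and> z \<in> U"
    obtain x y where z: "z = (x, y)" by (cases z)
    obtain U1 U2 where U12: "openin X U1" "openin Y U2" "x \<in> U1" "y \<in> U2" "U1 \<times> U2 \<subseteq> U"
      using U unfolding z openin_prod_topology_alt by blast
    obtain b where b: "b \<in> B" "x \<in> b" "b \<subseteq> U1" using B(3)[OF U12(1,3)] by blast
    obtain c where c: "c \<in> C" "y \<in> c" "c \<subseteq> U2" using C(3)[OF U12(2,4)] by blast
    show "\<exists>V\<in>(\<lambda>(b, c). b \<times> c) ` (B \<times> C). z \<in> V \<and> V \<subseteq> U"
      using b c U12 z by (intro bexI[of _ "b \<times> c"]) auto
  qed
qed

lemma smooth_manifold_prod [intro, simp]: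
  "smooth_manifold N \<Longrightarrow> smooth_manifold N' \<Longrightarrow> smooth_manifold (prod_manifold N N')"
  unfolding smooth_manifold_iff
proof -
  have "mtop (prod_manifold N N') = prod_topology (mtop N) (mtop N')" by (simp add: prod_manifold_def)
  then show "Hausdorff_space (mtop N) \<and> second_countable (mtop N) \<and> smooth_atlas N \<Longrightarrow>
    Hausdorff_space (mtop N') \<and> second_countable (mtop N') \<and> smooth_atlas N' \<Longrightarrow> Hausdorff_space (mtop (prod_manifold N N')) \<and> second_countable (mtop (prod_manifold N N')) \<and> smooth_atlas (prod_manifold N N')"
    by (simp add: Hausdorff_space_prod_topology second_countable_prod_topology)
qed

lemma smooth_at_Pair:
  assumes N: "smooth_atlas N" "smooth_atlas N1" "smooth_atlas N2"
    and f: "smooth_at N N1 f p" and g: "smooth_at N N2 g p"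
  shows "smooth_at N (prod_manifold N1 N2) (\<lambda>x. (f x, g x)) p"
proof -
  obtain O' U \<phi> V1 V2 and \<psi>1 \<psi>2 where h: "(U, \<phi>) \<in> atlas N" "(V1, \<psi>1) \<in> atlas N1" "(V2, \<psi>2) \<in> atlas N2"
     "openin (mtop N) O'" "p \<in> O'" "O' \<subseteq> U" "f ` O' \<subseteq> V1" "g ` O' \<subseteq> V2"
     "smooth_on (\<phi> ` O') (\<lambda>y. (\<psi>1 (f (inv_into U \<phi> y)), \<psi>2 (g (inv_into U \<phi> y))))"
    by (rule smooth_at_Pair_gen[OF N f g])
  have "(V1 \<times> V2, map_prod \<psi>1 \<psi>2) \<in> atlas (prod_manifold N1 N2)"
    using h(2,3) unfolding atlas_prod_iff by blast
  then show ?thesis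
    unfolding smooth_at_def using h
    by (intro exI[of _ O'] exI[of _ U] exI[of _ \<phi>] exI[of _ "V1 \<times> V2"] exI[of _ "map_prod \<psi>1 \<psi>2"]) auto
qed

lemma smooth_at_fst_snd:
  assumes N: "smooth_atlas N" "smooth_atlas N'" and p: "p \<in> carrier N \<times> carrier N'"
  shows "smooth_at (prod_manifold N N') N fst p" "smooth_at (prod_manifold N N') N' snd p"
proof -
  obtain U \<phi> V \<psi> where U: "(U, \<phi>) \<in> atlas N" and V: "(V, \<psi>) \<in> atlas N'" and x: "p \<in> U \<times> V"
    using p chart_exists[OF N(1)] chart_exists[OF N(2)] by (cases p) (simp, blast)
  have c: "(U \<times> V, map_prod \<phi> \<psi>) \<in> atlas (prod_manifold N N')"
    using U V unfolding atlas_prod_iff by blast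
  have P: "smooth_atlas (prod_manifold N N')" using N by simp
  have im: "map_prod \<phi> \<psi> ` (U \<times> V) = \<phi> ` U \<times> \<psi> ` V" by (rule map_prod_surj_on[OF refl refl])
  note op = chart_open_range[OF P c, unfolded im]
  have e: "inv_into (U \<times> V) (map_prod \<phi> \<psi>) (fst z, snd z) = (inv_into U \<phi> (fst z), inv_into V \<psi> (snd z))"
    if "z \<in> \<phi> ` U \<times> \<psi> ` V" for z
    by (rule inv_into_map_prod[OF chart_inj[OF N(1) U] chart_inj[OF N(2) V]]) (use that in auto)
  have 1: "smooth_on (\<phi> ` U \<times> \<psi> ` V) (\<lambda>y. \<phi> (fst (inv_into (U \<times> V) (map_prod \<phi> \<psi>) y)))"
    by (rule smooth_on_cong[OF smooth_on_bounded_linear[OF bounded_linear_fst] op]) (use e in \<open>auto simp: f_inv_into_f\<close>)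
  have 2: "smooth_on (\<phi> ` U \<times> \<psi> ` V) (\<lambda>y. \<psi> (snd (inv_into (U \<times> V) (map_prod \<phi> \<psi>) y)))"
    by (rule smooth_on_cong[OF smooth_on_bounded_linear[OF bounded_linear_snd] op]) (use e in \<open>auto simp: f_inv_into_f\<close>)
  show "smooth_at (prod_manifold N N') N fst p"
    unfolding smooth_at_def using U c x 1 chart_openin[OF P c]
    by (intro exI[of _ "U \<times> V"] exI[of _ "map_prod \<phi> \<psi>"] exI[of _ U] exI[of _ \<phi>]) (auto simp: im)
  show "smooth_at (prod_manifold N N') N' snd p"
    unfolding smooth_at_def using V c x 2 chart_openin[OF P c]
    by (intro exI[of _ "U \<times> V"] exI[of _ "map_prod \<phi> \<psi>"] exI[of _ V] exI[of _ \<psi>]) (auto simp: im)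
qed

lemma smooth_at_continuous_map:
  assumes "smooth_atlas N" "smooth_atlas N'" "openin (mtop N) O'" "\<And>x. x \<in> O' \<Longrightarrow> smooth_at N N' f x"
  shows "continuous_map (subtopology (mtop N) O') (mtop N') f"
proof -
  have "smooth_map (open_submanifold N O') N' f"
    using assms openin_subset[OF assms(3)]
    by (simp add: smooth_map_iff smooth_at_open_submanifold_dom)
  then show ?thesis by (simp add: smooth_map_def open_submanifold_def)
qed

text \<open>Near \<open>p\<close> the local extension of \<open>f\<close> can be used in its place,
  because \<open>h\<close> takes values in \<open>S\<close>. In this way a map such as \<otimes>,
  given only on a fibre product, enters compositions.\<close>

lemma smooth_at_compose_map_on:
  assumes N: "smooth_atlas N" "smooth_atlas N'" "smooth_atlas N''"
    and f: "smooth_map_on N' S N'' f" and h: "smooth_at N N' h p"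
    and Q: "openin (mtop N) Q" "p \<in> Q" "\<And>x. x \<in> Q \<Longrightarrow> h x \<in> S"
  shows "smooth_at N N'' (\<lambda>x. f (h x)) p"
proof -
  obtain W g where W: "openin (mtop N') W" "h p \<in> W" "smooth_map (open_submanifold N' W) N'' g"
    and g: "\<forall>x\<in>W \<inter> S. g x = f x"
    using f Q(2,3) unfolding smooth_map_on_def by blast
  have "h p \<in> carrier N'" using W openin_subset by blast
  then have "smooth_at (open_submanifold N' W) N'' g (h p)"
    using W by (intro smooth_map_smooth_at N smooth_atlas_open_submanifold) auto
  then have "smooth_at N' N'' g (h p)" using smooth_at_open_submanifold_dom[OF N(2,3) W(1)] by simp
  then have 1: "smooth_at N N'' (\<lambda>x. g (h x)) p" by (rule smooth_at_compose[OF N h])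
  obtain O' where O': "openin (mtop N) O'" "p \<in> O'" "\<And>x. x \<in> O' \<Longrightarrow> h x \<in> W"
    by (rule smooth_at_nbhd[OF N(1,2) h W(1,2)]) blast
  show ?thesis
    by (rule smooth_at_cong[OF N(1) 1, of "O' \<inter> Q"]) (use O' Q g in auto)
qed

lemma smooth_map_onI:
  assumes N: "smooth_atlas N" "smooth_atlas N'" and S: "S \<subseteq> carrier N"
    and g: "\<And>p. p \<in> S \<Longrightarrow> \<exists>W g. openin (mtop N) W \<and> p \<in> W \<and> (\<forall>x\<in>W. smooth_at N N' g x) \<and> (\<forall>x\<in>W \<inter> S. g x = f x)"
  shows "smooth_map_on N S N' f"
  unfolding smooth_map_on_def
proof (intro conjI S ballI)
  fix p assume "p \<in> S"
  then obtain W g where W: "openin (mtop N) W" "p \<in> W" "\<forall>x\<in>W. smooth_at N N' g x" "\<forall>x\<in>W \<inter> S. g x = f x"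
    using g by blast
  have "smooth_map (open_submanifold N W) N' g"
    using W N openin_subset[OF W(1)] by (simp add: smooth_map_iff smooth_at_open_submanifold_dom)
  then show "\<exists>W g. openin (mtop N) W \<and> p \<in> W \<and> smooth_map (open_submanifold N W) N' g \<and> (\<forall>x\<in>W \<inter> S. g x = f x)"
    using W by blast
qed

subsection \<open>Embedded submanifolds from charts\<close>

text \<open>Each chart of \<open>X\<close> extends smoothly to an open set of \<open>N\<close>, and
  its inverse is smooth as a map into \<open>N\<close>. Compatibility of any two charts is then
  automatic, as a transition map is an inverse followed by an extension, and the subspace topology
  is the chart topology for the same reason.\<close>

locale submanifold_charts =
  fixes N :: "('x, 'e::euclidean_model) manifold" and X :: "'x set"
    and \<A> :: "('x set \<times> ('x \<Rightarrow> 'd::euclidean_model)) set"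
  assumes manifold: "smooth_manifold N" and subset: "X \<subseteq> carrier N"
    and cover: "p \<in> X \<Longrightarrow> \<exists>U \<phi>. (U, \<phi>) \<in> \<A> \<and> p \<in> U"
    and charts: "(U, \<phi>) \<in> \<A> \<Longrightarrow> \<exists>O'. openin (mtop N) O' \<and> U = X \<inter> O' \<and> (\<forall>x\<in>O'. smooth_at N model_manifold \<phi> x)"
    and charts_inj: "(U, \<phi>) \<in> \<A> \<Longrightarrow> inj_on \<phi> U"
    and charts_open: "(U, \<phi>) \<in> \<A> \<Longrightarrow> open (\<phi> ` U)"
    and charts_inv: "(U, \<phi>) \<in> \<A> \<Longrightarrow> y \<in> \<phi> ` U \<Longrightarrow> smooth_at model_manifold N (inv_into U \<phi>) y"
begin

definition submanifold :: "('x, 'd) manifold" where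
  "submanifold = \<lparr>mtop = subtopology (mtop N) X, atlas = \<A>\<rparr>"

lemma atlas_N [simp, intro]: "smooth_atlas N"
  using manifold smooth_manifold_atlas by blast

lemma charts_subset: "(U, \<phi>) \<in> \<A> \<Longrightarrow> U \<subseteq> X"
  using charts by blast

lemma charts_smooth: "(U, \<phi>) \<in> \<A> \<Longrightarrow> x \<in> U \<Longrightarrow> smooth_at N model_manifold \<phi> x"
  using charts by blast

lemma carrier_submanifold [simp]: "carrier submanifold = X"
  using subset by (auto simp: submanifold_def)

lemma openin_submanifold: "openin (mtop N) O' \<Longrightarrow> openin (mtop submanifold) (X \<inter> O')"
  by (auto simp: submanifold_def openin_subtopology)

lemma smooth_transition:
  assumes U: "(U, \<phi>) \<in> \<A>" and y: "y \<in> \<phi> ` U"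
    and \<psi>: "smooth_at N model_manifold \<psi> (inv_into U \<phi> y)"
  shows "smooth_at model_manifold model_manifold (\<lambda>y. \<psi> (inv_into U \<phi> y)) y"
  using smooth_at_compose[OF _ _ _ charts_inv[OF U y] \<psi>] by simp

lemma smooth_atlas_submanifold [simp, intro]: "smooth_atlas submanifold"
  unfolding smooth_atlas_def
proof (intro conjI)
  show "carrier submanifold = (\<Union>(U, \<phi>)\<in>atlas submanifold. U)"
  proof (intro set_eqI iffI)
    fix p assume "p \<in> carrier submanifold"
    then show "p \<in> (\<Union>(U, \<phi>)\<in>atlas submanifold. U)"
      using cover[of p] by (fastforce simp: submanifold_def)
  next
    fix p assume "p \<in> (\<Union>(U, \<phi>)\<in>atlas submanifold. U)"
    then have "\<exists>U \<phi>. (U, \<phi>) \<in> \<A> \<and> p \<in> U" by (auto simp: submanifold_def)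
    then show "p \<in> carrier submanifold" using charts_subset by auto
  qed
  show "\<forall>(U, \<phi>)\<in>atlas submanifold. openin (mtop submanifold) U \<and> open (\<phi> ` U) \<and>
      homeomorphic_map (subtopology (mtop submanifold) U) (top_of_set (\<phi> ` U)) \<phi>"
  proof clarify
    fix U \<phi> assume "(U, \<phi>) \<in> atlas submanifold"
    then have U: "(U, \<phi>) \<in> \<A>" by (simp add: submanifold_def)
    obtain O' where O': "openin (mtop N) O'" "U = X \<inter> O'" "\<forall>x\<in>O'. smooth_at N model_manifold \<phi> x"
      using charts[OF U] by blast
    have o: "openin (mtop submanifold) U" using openin_submanifold O' by simp
    have top: "subtopology (mtop submanifold) U = subtopology (mtop N) U"
      using O' by (simp add: submanifold_def subtopology_subtopology)
    have sub: "U \<subseteq> carrier N" using O' subset by auto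
    have c0: "continuous_map (subtopology (mtop N) O') (mtop model_manifold) \<phi>"
      by (rule smooth_at_continuous_map) (use O' in auto)
    have c1: "continuous_map (subtopology (mtop N) U) euclidean \<phi>"
      using continuous_map_from_subtopology_mono[OF c0, of U] O'(2) by (simp add: model_manifold_def)
    have c2: "continuous_map (subtopology (mtop model_manifold) (\<phi> ` U)) (mtop N) (inv_into U \<phi>)"
      by (rule smooth_at_continuous_map) (use charts_inv[OF U] charts_open[OF U] in \<open>auto simp: openin_model\<close>)
    have "homeomorphic_maps (subtopology (mtop N) U) (top_of_set (\<phi> ` U)) \<phi> (inv_into U \<phi>)"
      unfolding homeomorphic_maps_def
      using c1 c2 charts_inj[OF U] sub
      by (auto simp: continuous_map_in_subtopology model_manifold_def inv_into_into f_inv_into_f)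
    then have "homeomorphic_map (subtopology (mtop N) U) (top_of_set (\<phi> ` U)) \<phi>"
      unfolding homeomorphic_map_maps by blast
    then show "openin (mtop submanifold) U \<and> open (\<phi> ` U) \<and>
      homeomorphic_map (subtopology (mtop submanifold) U) (top_of_set (\<phi> ` U)) \<phi>"
      using o charts_open[OF U] top by simp
  qed
  show "\<forall>(U, \<phi>)\<in>atlas submanifold. \<forall>(V, \<psi>)\<in>atlas submanifold.
       smooth_on (\<phi> ` (U \<inter> V)) (\<psi> \<circ> inv_into U \<phi>)"
  proof clarify
    fix U \<phi> V \<psi> assume "(U, \<phi>) \<in> atlas submanifold" "(V, \<psi>) \<in> atlas submanifold"
    then have U: "(U, \<phi>) \<in> \<A>" and V: "(V, \<psi>) \<in> \<A>" by (simp_all add: submanifold_def)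
    show "smooth_on (\<phi> ` (U \<inter> V)) (\<psi> \<circ> inv_into U \<phi>)"
      unfolding comp_def
    proof (rule smooth_at_imp_smooth_on)
      fix y assume "y \<in> \<phi> ` (U \<inter> V)"
      then obtain x where x: "x \<in> U" "x \<in> V" "y = \<phi> x" by blast
      then have i: "inv_into U \<phi> y = x" using charts_inj[OF U] by simp
      show "smooth_at model_manifold model_manifold (\<lambda>x. \<psi> (inv_into U \<phi> x)) y"
        by (rule smooth_transition[OF U]) (use x i charts_smooth[OF V x(2)] in auto)
    qed
  qed
qed

lemma atlas_submanifold [simp]: "atlas submanifold = \<A>"
  by (simp add: submanifold_def)

lemma smooth_manifold_submanifold: "smooth_manifold submanifold"
  using manifold unfolding smooth_manifold_iff
  by (simp add: submanifold_def[THEN arg_cong, of mtop] Hausdorff_space_subtopology second_countable_subtopology)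

text \<open>On a chart domain the inclusion is the chart followed by its inverse, and the latter is
  smooth into \<open>N\<close>.\<close>

lemma inclusion_smooth:
  assumes p: "p \<in> X"
  shows "smooth_at submanifold N (\<lambda>x. x) p"
proof -
  obtain U \<phi> where U: "(U, \<phi>) \<in> \<A>" "p \<in> U" using cover[OF p] by blast
  then have U': "(U, \<phi>) \<in> atlas submanifold" by simp
  have 1: "smooth_at submanifold N (\<lambda>x. inv_into U \<phi> (\<phi> x)) p"
    by (rule smooth_at_compose[OF _ _ _ smooth_at_chart[OF _ U' U(2)] charts_inv[OF U(1)]]) (use U in auto)
  show ?thesis
    by (rule smooth_at_cong[OF _ 1 chart_openin[OF _ U'] U(2)]) (use charts_inj[OF U(1)] in auto)
qed

lemma smooth_at_restrict:
  "smooth_atlas N' \<Longrightarrow> p \<in> X \<Longrightarrow> smooth_at N N' f p \<Longrightarrow> smooth_at submanifold N' f p"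
  using smooth_at_compose[OF _ _ _ inclusion_smooth] by auto

text \<open>Composing \<open>f\<close> with the extended chart gives smooth coordinates, and on a
  neighbourhood where \<open>f\<close> lands in the chart domain the inverse chart recovers
  \<open>f\<close>.\<close>

lemma smooth_at_into_submanifold:
  assumes N': "smooth_atlas N'" and f: "smooth_at N' N f p"
    and Q: "openin (mtop N') Q" "p \<in> Q" "\<And>x. x \<in> Q \<Longrightarrow> f x \<in> X"
  shows "smooth_at N' submanifold f p"
proof -
  obtain U \<phi> where U: "(U, \<phi>) \<in> \<A>" "f p \<in> U" using cover[OF Q(3)[OF Q(2)]] by blast
  obtain O' where O': "openin (mtop N) O'" "U = X \<inter> O'" using charts[OF U(1)] by blast
  have fO: "f p \<in> O'" using U O' by simp
  obtain P where P: "openin (mtop N') P" "p \<in> P" "\<And>x. x \<in> P \<Longrightarrow> f x \<in> O'"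
    by (rule smooth_at_nbhd[OF N' _ f O'(1) fO]) auto
  have 1: "smooth_at N' model_manifold (\<lambda>x. \<phi> (f x)) p"
    by (rule smooth_at_compose[OF N' _ _ f charts_smooth[OF U]]) auto
  have U': "(U, \<phi>) \<in> atlas submanifold" using U by simp
  have 2: "smooth_at N' submanifold (\<lambda>x. inv_into U \<phi> (\<phi> (f x))) p"
    by (rule smooth_at_compose[OF N' _ _ 1 smooth_at_chart_inv[OF _ U']]) (use U in auto)
  show ?thesis
    by (rule smooth_at_cong[OF N' 2, of "P \<inter> Q"]) (use P Q O' charts_inj[OF U(1)] in auto)
qed

lemma embedded: "embedded_submanifold submanifold N"
  unfolding embedded_submanifold_def
proof (intro conjI smooth_manifold_submanifold)
  show "carrier submanifold \<subseteq> carrier N" using subset by simp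
  show "mtop submanifold = subtopology (mtop N) (carrier submanifold)"
    by (simp only: carrier_submanifold) (simp add: submanifold_def)
  show "smooth_map submanifold N (\<lambda>x. x)" by (simp add: smooth_map_iff inclusion_smooth)
  show "\<forall>(U, \<phi>)\<in>atlas submanifold. \<forall>(V, \<psi>)\<in>atlas N. \<forall>p\<in>U \<inter> V.
        inj (frechet_derivative (\<psi> \<circ> inv_into U \<phi>) (at (\<phi> p)))"
  proof clarify
    fix U \<phi> V \<psi> p assume "(U, \<phi>) \<in> atlas submanifold" and V: "(V, \<psi>) \<in> atlas N" and p: "p \<in> U" "p \<in> V"
    then have U: "(U, \<phi>) \<in> \<A>" by simp
    define F where "F = \<psi> \<circ> inv_into U \<phi>"
    \<comment> \<open>Away from \<open>X\<close> this uses the smooth extension of the chart, so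
      \<open>G\<close> is differentiable in the ambient coordinates. As \<open>G\<close> after
      \<open>F\<close> is the identity near \<open>\<phi> p\<close>, the derivative of
      \<open>F\<close> has a left inverse.\<close>
    define G where "G = \<phi> \<circ> inv_into V \<psi>"
    have i: "inv_into U \<phi> (\<phi> x) = x" if "x \<in> U" for x using that charts_inj[OF U] by simp
    have j: "inv_into V \<psi> (\<psi> x) = x" if "x \<in> V" for x using that chart_inv[OF atlas_N V] by simp
    have "smooth_at model_manifold model_manifold F (\<phi> p)"
      unfolding F_def comp_def using p i smooth_at_chart[OF atlas_N V] by (intro smooth_transition[OF U]) auto
    then obtain F' where F': "(F has_derivative F') (at (\<phi> p))"
      unfolding smooth_at_model_iff using smooth_on_has_derivative by blast
    have 0: "smooth_at model_manifold N (inv_into V \<psi>) (\<psi> p)"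
      using p by (intro smooth_at_chart_inv[OF atlas_N V]) auto
    have "smooth_at model_manifold model_manifold G (\<psi> p)"
      unfolding G_def comp_def by (rule smooth_at_compose[OF _ _ _ 0]) (use charts_smooth[OF U] p j in auto)
    then have "smooth_at model_manifold model_manifold G (F (\<phi> p))"
      using p i by (simp add: F_def)
    then obtain G' where G': "(G has_derivative G') (at (F (\<phi> p)))"
      unfolding smooth_at_model_iff using smooth_on_has_derivative by blast
    have s: "smooth_at model_manifold N (inv_into U \<phi>) (\<phi> p)" using charts_inv[OF U] p by simp
    have pV: "inv_into U \<phi> (\<phi> p) \<in> V" using i p by simp
    obtain T where T: "openin (mtop (model_manifold :: ('d, 'd) manifold)) T" "\<phi> p \<in> T" "\<And>y. y \<in> T \<Longrightarrow> inv_into U \<phi> y \<in> V"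
      by (rule smooth_at_nbhd[OF _ atlas_N s chart_openin[OF atlas_N V] pV]) auto
    have "((\<lambda>y. G (F y)) has_derivative (\<lambda>v. G' (F' v))) (at (\<phi> p))"
      by (rule has_derivative_compose[OF F' G'])
    then have "((\<lambda>y. y) has_derivative (\<lambda>v. G' (F' v))) (at (\<phi> p))"
    proof (rule has_derivative_transform_within_open[of _ _ _ _ "T \<inter> \<phi> ` U"])
      show "open (T \<inter> \<phi> ` U)" using T charts_open[OF U] by (simp add: openin_model open_Int)
      show "\<phi> p \<in> T \<inter> \<phi> ` U" using T p by simp
      show "G (F y) = y" if "y \<in> T \<inter> \<phi> ` U" for y
        using that T(3)[of y] by (simp add: F_def G_def j f_inv_into_f)
    qed
    then have "(\<lambda>v. G' (F' v)) = (\<lambda>v. v)"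
      by (rule has_derivative_unique[OF _ has_derivative_ident])
    then have "inj F'" by (intro inj_on_inverseI[of _ G']) metis
    moreover have "frechet_derivative (\<psi> \<circ> inv_into U \<phi>) (at (\<phi> p)) = F'"
      using frechet_derivative_at[OF F'] by (simp add: F_def)
    ultimately show "inj (frechet_derivative (\<psi> \<circ> inv_into U \<phi>) (at (\<phi> p)))" by simp
  qed
qed

end

subsection \<open>Trivialised vector bundles\<close>

text \<open>Here \<open>\<iota>\<close> is the inverse of the trivialisation \<open>e \<mapsto> (vproj E e, \<phi> e)\<close>.\<close>

definition trivialized ::
  "('x, 'e::euclidean_model, 'y, 'm::euclidean_model) vbundle \<Rightarrow> 'y set
     \<Rightarrow> ('x \<Rightarrow> 'f::euclidean_model) \<Rightarrow> ('y \<times> 'f \<Rightarrow> 'x) \<Rightarrow> bool" where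
  "trivialized E U \<phi> \<iota> \<longleftrightarrow>
     openin (mtop (vbase E)) U \<and>
     (\<forall>e\<in>carrier (vtotal E). vproj E e \<in> U \<longrightarrow>
        smooth_at (vtotal E) model_manifold \<phi> e \<and> \<iota> (vproj E e, \<phi> e) = e) \<and>
     (\<forall>x\<in>U. \<forall>u. smooth_at (prod_manifold (vbase E) model_manifold) (vtotal E) \<iota> (x, u) \<and>
        vproj E (\<iota> (x, u)) = x \<and> \<phi> (\<iota> (x, u)) = u) \<and>
     (\<forall>p\<in>U. linear_map_on (fibre E p) (vadd E) (vscale E) UNIV (+) (*\<^sub>R) \<phi>)"

text \<open>What is needed of a bundle before its trivialisations are known. It allows the
  projections of D to be handled while the vector bundle property is still being proved.\<close>

definition smooth_projection :: "('x, 'e::euclidean_model, 'y, 'm::euclidean_model) vbundle \<Rightarrow> bool" where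
  "smooth_projection E \<longleftrightarrow> smooth_atlas (vtotal E) \<and> smooth_atlas (vbase E) \<and>
     (\<forall>e\<in>carrier (vtotal E). smooth_at (vtotal E) (vbase E) (vproj E) e)"

lemma vector_bundle_smooth_projection: "vector_bundle F E \<Longrightarrow> smooth_projection E"
  unfolding vector_bundle_def smooth_projection_def
  by (meson smooth_manifold_atlas smooth_map_smooth_at)

lemma smooth_projectionD:
  assumes "smooth_projection E"
  shows "smooth_atlas (vtotal E)" "smooth_atlas (vbase E)"
    "e \<in> carrier (vtotal E) \<Longrightarrow> smooth_at (vtotal E) (vbase E) (vproj E) e"
    "e \<in> carrier (vtotal E) \<Longrightarrow> vproj E e \<in> carrier (vbase E)"
  using assms smooth_at_in_carrier(2)[of "vtotal E" "vbase E" "vproj E" e] unfolding smooth_projection_def by auto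

lemma openin_over:
  assumes E: "smooth_projection E" and U: "openin (mtop (vbase E)) U"
  shows "openin (mtop (vtotal E)) {e \<in> carrier (vtotal E). vproj E e \<in> U}"
proof -
  note E' = smooth_projectionD[OF E]
  have "smooth_map (vtotal E) (vbase E) (vproj E)" using E' by (simp add: smooth_map_iff)
  then show ?thesis using U openin_continuous_map_preimage by (auto simp: smooth_map_def)
qed

text \<open>\<open>local_trivialization\<close> restricts the base to \<open>U\<close>, whereas
  \<open>trivialized\<close> keeps the whole base and quantifies over points of \<open>U\<close>.
  This lemma and the next translate between the two.\<close>

lemma smooth_at_prod_open_submanifold:
  assumes N: "smooth_atlas N" "smooth_atlas N1" "smooth_atlas N2" and U: "openin (mtop N1) U" and p: "fst p \<in> U"
    and f: "smooth_at (prod_manifold N1 N2) N f p"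
  shows "smooth_at (prod_manifold (open_submanifold N1 U) N2) N f p"
proof -
  have p': "p \<in> carrier N1 \<times> carrier N2" using smooth_at_in_carrier(1)[OF _ N(1) f] N by simp
  let ?P = "prod_manifold (open_submanifold N1 U) N2"
  have P: "smooth_atlas ?P" using N U by simp
  have "smooth_at ?P (open_submanifold N1 U) fst p" "smooth_at ?P N2 snd p"
    using smooth_at_fst_snd[of "open_submanifold N1 U" N2 p] N U p p' by auto
  then have "smooth_at ?P (prod_manifold N1 N2) (\<lambda>x. (fst x, snd x)) p"
    using smooth_at_open_submanifold_cod[OF P N(2) U] by (intro smooth_at_Pair P N) auto
  then show ?thesis
    using smooth_at_compose[OF P _ N(1), of "prod_manifold N1 N2" "\<lambda>x. (fst x, snd x)" p f] f N by simp
qed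

lemma smooth_at_prod_open_submanifoldD:
  assumes N: "smooth_atlas N" "smooth_atlas N1" "smooth_atlas N2" and U: "openin (mtop N1) U"
    and f: "smooth_at (prod_manifold (open_submanifold N1 U) N2) N f p"
  shows "smooth_at (prod_manifold N1 N2) N f p"
proof -
  let ?P = "prod_manifold (open_submanifold N1 U) N2"
  have P: "smooth_atlas ?P" using N U by simp
  have p': "p \<in> (carrier N1 \<inter> U) \<times> carrier N2" using smooth_at_in_carrier(1)[OF P N(1) f] by simp
  have "smooth_at (prod_manifold N1 N2) N1 fst p" "smooth_at (prod_manifold N1 N2) N2 snd p"
    using smooth_at_fst_snd[of N1 N2 p] N p' by auto
  then have "smooth_at (prod_manifold N1 N2) ?P (\<lambda>x. (fst x, snd x)) p"
    using smooth_at_open_submanifold_cod[OF smooth_atlas_prod[OF N(2,3)] N(2) U, of fst p] p' N U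
    by (intro smooth_at_Pair) auto
  then show ?thesis
    using smooth_at_compose[OF _ P N(1), of "prod_manifold N1 N2" "\<lambda>x. (fst x, snd x)" p f] f N by simp
qed

lemma local_trivialization_imp_trivialized:
  assumes E: "smooth_projection E" and t: "local_trivialization E U \<phi>"
  obtains \<iota> where "trivialized E U \<phi> \<iota>"
proof -
  note E' = smooth_projectionD[OF E]
  have U: "openin (mtop (vbase E)) U" using t by (simp add: local_trivialization_def)
  let ?V = "{e \<in> carrier (vtotal E). vproj E e \<in> U}"
  let ?T = "open_submanifold (vtotal E) ?V"
  let ?P = "prod_manifold (open_submanifold (vbase E) U) model_manifold :: ('c \<times> 'e, 'd \<times> 'e) manifold"
  have V: "openin (mtop (vtotal E)) ?V" by (rule openin_over[OF E U])
  have T: "smooth_atlas ?T" and P: "smooth_atlas ?P" using V U E' by auto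
  have d: "diffeomorphism ?T ?P (\<lambda>e. (vproj E e, \<phi> e))" using t by (simp add: local_trivialization_def)
  obtain \<iota> where s: "\<And>p. p \<in> carrier ?T \<Longrightarrow> smooth_at ?T ?P (\<lambda>e. (vproj E e, \<phi> e)) p"
    and si: "\<And>q. q \<in> carrier ?P \<Longrightarrow> smooth_at ?P ?T \<iota> q"
    and l: "\<And>p. p \<in> carrier ?T \<Longrightarrow> \<iota> (vproj E p, \<phi> p) = p"
    and r: "\<And>q. q \<in> carrier ?P \<Longrightarrow> (vproj E (\<iota> q), \<phi> (\<iota> q)) = q"
    by (rule diffeomorphismD[OF T P d]) blast
  have Us: "U \<subseteq> carrier (vbase E)" using U openin_subset by blast
  have "trivialized E U \<phi> \<iota>"
    unfolding trivialized_def
  proof (intro conjI ballI allI impI U)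
    fix e assume e: "e \<in> carrier (vtotal E)" "vproj E e \<in> U"
    then have e': "e \<in> carrier ?T" by simp
    have q: "(vproj E e, \<phi> e) \<in> carrier (open_submanifold (vbase E) U) \<times> carrier model_manifold"
      using e Us by auto
    have "smooth_at ?T model_manifold (\<lambda>e. snd (vproj E e, \<phi> e)) e"
      by (rule smooth_at_compose[OF T P _ s[OF e'] smooth_at_fst_snd(2)[OF _ _ q]]) (use E' U in auto)
    then show "smooth_at (vtotal E) model_manifold \<phi> e"
      using smooth_at_open_submanifold_dom[OF E'(1) smooth_atlas_model V, of \<phi> e] by simp
    show "\<iota> (vproj E e, \<phi> e) = e" by (rule l[OF e'])
  next
    fix x u assume x: "x \<in> U"
    then have q: "(x, u) \<in> carrier ?P" using Us by auto
    have "smooth_at ?P (vtotal E) \<iota> (x, u)"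
      using si[OF q] smooth_at_open_submanifold_cod[OF P E'(1) V] by simp
    then show "smooth_at (prod_manifold (vbase E) model_manifold) (vtotal E) \<iota> (x, u)"
      by (rule smooth_at_prod_open_submanifoldD[OF E'(1,2) smooth_atlas_model U])
    show "vproj E (\<iota> (x, u)) = x" "\<phi> (\<iota> (x, u)) = u" using r[OF q] by auto
  qed (use t in \<open>auto simp: local_trivialization_def\<close>)
  then show ?thesis by (rule that)
qed

lemma trivialized_imp_local_trivialization:
  assumes E: "smooth_projection E" and t: "trivialized E U \<phi> \<iota>"
  shows "local_trivialization E U \<phi>"
  unfolding local_trivialization_def
proof (intro conjI)
  note E' = smooth_projectionD[OF E]
  show U: "openin (mtop (vbase E)) U" using t by (simp add: trivialized_def)
  let ?V = "{e \<in> carrier (vtotal E). vproj E e \<in> U}"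
  let ?T = "open_submanifold (vtotal E) ?V"
  let ?P = "prod_manifold (open_submanifold (vbase E) U) model_manifold :: ('c \<times> 'e, 'd \<times> 'e) manifold"
  have V: "openin (mtop (vtotal E)) ?V" by (rule openin_over[OF E U])
  have T: "smooth_atlas ?T" and P: "smooth_atlas ?P" using V U E' by auto
  show "diffeomorphism ?T ?P (\<lambda>e. (vproj E e, \<phi> e))"
  proof (rule diffeomorphismI[OF T P, of _ \<iota>])
    fix e assume e: "e \<in> carrier ?T"
    then have e': "e \<in> carrier (vtotal E)" "vproj E e \<in> U" by auto
    have "smooth_at (vtotal E) ?P (\<lambda>e. (vproj E e, \<phi> e)) e"
      using t e' E' U by (intro smooth_at_Pair) (auto simp: trivialized_def smooth_at_open_submanifold_cod)
    then show "smooth_at ?T ?P (\<lambda>e. (vproj E e, \<phi> e)) e"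
      using smooth_at_open_submanifold_dom[OF E'(1) P V] e by simp
    show "\<iota> (vproj E e, \<phi> e) = e" using t e' by (simp add: trivialized_def)
  next
    fix q assume "q \<in> carrier ?P"
    then obtain x u where q: "q = (x, u)" "x \<in> U" by auto
    have 1: "smooth_at (prod_manifold (vbase E) model_manifold) (vtotal E) \<iota> q"
      using t q by (simp add: trivialized_def)
    have "\<iota> q \<in> carrier (vtotal E)" by (rule smooth_at_in_carrier(2)[OF _ _ 1]) (use E' in auto)
    then have "\<iota> q \<in> ?V" using t q by (simp add: trivialized_def)
    moreover have "smooth_at ?P (vtotal E) \<iota> q"
      by (rule smooth_at_prod_open_submanifold[OF E'(1,2) _ U _ 1]) (use q in auto)
    ultimately show "smooth_at ?P ?T \<iota> q"
      using smooth_at_open_submanifold_cod[OF P E'(1) V] by simp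
    show "(vproj E (\<iota> q), \<phi> (\<iota> q)) = q" using t q by (simp add: trivialized_def)
  qed
  show "\<forall>p\<in>U. linear_map_on (fibre E p) (vadd E) (vscale E) UNIV (+) (*\<^sub>R) \<phi>"
    using t by (simp add: trivialized_def)
qed

context
  fixes E :: "('x, 'e::euclidean_model, 'y, 'm::euclidean_model) vbundle" and U
    and \<phi> :: "'x \<Rightarrow> 'f::euclidean_model" and \<iota>
  assumes E: "smooth_projection E" and t: "trivialized E U \<phi> \<iota>"
begin

lemma trivialized_openin: "openin (mtop (vbase E)) U"
  using t by (simp add: trivialized_def)

lemma trivialized_smooth: "e \<in> carrier (vtotal E) \<Longrightarrow> vproj E e \<in> U \<Longrightarrow> smooth_at (vtotal E) model_manifold \<phi> e"
  using t by (simp add: trivialized_def)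

lemma trivialized_left: "e \<in> carrier (vtotal E) \<Longrightarrow> vproj E e \<in> U \<Longrightarrow> \<iota> (vproj E e, \<phi> e) = e"
  using t by (simp add: trivialized_def)

lemma trivialized_inv_carrier:
  assumes x: "x \<in> U"
  shows "\<iota> (x, u) \<in> carrier (vtotal E)"
proof -
  have 1: "smooth_at (prod_manifold (vbase E) model_manifold) (vtotal E) \<iota> (x, u)"
    using t x by (simp add: trivialized_def)
  show ?thesis
    using smooth_at_in_carrier(2)[OF _ smooth_projectionD(1)[OF E] 1] smooth_projectionD(2)[OF E] by simp
qed

lemma trivialized_right: "x \<in> U \<Longrightarrow> vproj E (\<iota> (x, u)) = x" "x \<in> U \<Longrightarrow> \<phi> (\<iota> (x, u)) = u"
  using t by (simp_all add: trivialized_def)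

lemma trivialized_add:
  "e \<in> carrier (vtotal E) \<Longrightarrow> e' \<in> carrier (vtotal E) \<Longrightarrow> vproj E e = vproj E e' \<Longrightarrow> vproj E e' \<in> U \<Longrightarrow>
    \<phi> (vadd E e e') = \<phi> e + \<phi> e'"
  using t unfolding trivialized_def linear_map_on_def fibre_def by auto

lemma trivialized_scale:
  "e \<in> carrier (vtotal E) \<Longrightarrow> vproj E e \<in> U \<Longrightarrow> \<phi> (vscale E r e) = r *\<^sub>R \<phi> e"
  using t unfolding trivialized_def linear_map_on_def fibre_def by auto

lemma smooth_at_trivialized_inv:
  assumes N: "smooth_atlas N" and X: "smooth_at N (vbase E) X p" and Y: "smooth_at N model_manifold Y p" and p: "X p \<in> U"
  shows "smooth_at N (vtotal E) (\<lambda>e. \<iota> (X e, Y e)) p"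
proof -
  note E' = smooth_projectionD[OF E]
  have P: "smooth_atlas (prod_manifold (vbase E) (model_manifold :: ('f, 'f) manifold))" using E' by simp
  have 1: "smooth_at N (prod_manifold (vbase E) model_manifold) (\<lambda>e. (X e, Y e)) p"
    by (rule smooth_at_Pair[OF N E'(2) smooth_atlas_model X Y])
  have 2: "smooth_at (prod_manifold (vbase E) model_manifold) (vtotal E) \<iota> (X p, Y p)"
    using t p by (simp add: trivialized_def)
  show ?thesis by (rule smooth_at_compose[OF N P E'(1) 1 2])
qed

end

lemma vector_bundleE:
  assumes "vector_bundle TYPE('f) E" and "p \<in> carrier (vbase E)"
  obtains U and \<phi> :: "_ \<Rightarrow> 'f::euclidean_model" and \<iota> where "p \<in> U" "trivialized E U \<phi> \<iota>"
proof -
  obtain U and \<phi> :: "_ \<Rightarrow> 'f" where U: "p \<in> U" "local_trivialization E U \<phi>"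
    using assms unfolding vector_bundle_def by blast
  obtain \<iota> where "trivialized E U \<phi> \<iota>"
    by (rule local_trivialization_imp_trivialized[OF vector_bundle_smooth_projection[OF assms(1)] U(2)])
  then show ?thesis using that U(1) by blast
qed

lemma trivialized_restrict:
  assumes "trivialized E U \<phi> \<iota>" "openin (mtop (vbase E)) U'" "U' \<subseteq> U"
  shows "trivialized E U' \<phi> \<iota>"
  using assms unfolding trivialized_def by blast

section \<open>Zero section, scaling and addition of a vector bundle\<close>

lemma vector_bundle_fibre:
  assumes "vector_bundle F E"
  shows "e \<in> carrier (vtotal E) \<Longrightarrow> e' \<in> carrier (vtotal E) \<Longrightarrow> vproj E e = vproj E e' \<Longrightarrow>
      vadd E e e' \<in> carrier (vtotal E) \<and> vproj E (vadd E e e') = vproj E e'"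
    and "e \<in> carrier (vtotal E) \<Longrightarrow> vscale E r e \<in> carrier (vtotal E) \<and> vproj E (vscale E r e) = vproj E e"
    and "p \<in> carrier (vbase E) \<Longrightarrow> vzero E p \<in> carrier (vtotal E) \<and> vproj E (vzero E p) = p"
    and "p \<in> carrier (vbase E) \<Longrightarrow> vadd E (vzero E p) (vzero E p) = vzero E p"
proof -
  have v: "real_vector_space_on (fibre E p) (vadd E) (vzero E p) (vscale E)" if "p \<in> carrier (vbase E)" for p
    using assms that by (simp add: vector_bundle_def)
  note E' = smooth_projectionD[OF vector_bundle_smooth_projection[OF assms]]
  show "vadd E e e' \<in> carrier (vtotal E) \<and> vproj E (vadd E e e') = vproj E e'"
    if "e \<in> carrier (vtotal E)" "e' \<in> carrier (vtotal E)" "vproj E e = vproj E e'"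
    using v[OF E'(4)[OF that(2)]] that unfolding real_vector_space_on_def fibre_def by auto
  show "vscale E r e \<in> carrier (vtotal E) \<and> vproj E (vscale E r e) = vproj E e"
    if "e \<in> carrier (vtotal E)"
    using v[OF E'(4)[OF that]] that unfolding real_vector_space_on_def fibre_def by auto
  show "vzero E p \<in> carrier (vtotal E) \<and> vproj E (vzero E p) = p" "vadd E (vzero E p) (vzero E p) = vzero E p"
    if "p \<in> carrier (vbase E)"
    using v[OF that] unfolding real_vector_space_on_def fibre_def by auto
qed

text \<open>\<open>linear_map_on\<close> has no clause for zero; the image of zero equals its own
  double and hence vanishes.\<close>

lemma trivialized_zero:
  assumes E: "vector_bundle F E" and t: "trivialized E U \<phi> \<iota>" and p: "p \<in> U"
  shows "\<phi> (vzero E p) = 0"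
proof -
  have p': "p \<in> carrier (vbase E)"
    using t p openin_subset unfolding trivialized_def by blast
  have "\<phi> (vadd E (vzero E p) (vzero E p)) = \<phi> (vzero E p) + \<phi> (vzero E p)"
    using vector_bundle_fibre(3)[OF E p'] p
    by (intro trivialized_add[OF vector_bundle_smooth_projection[OF E] t]) auto
  then show ?thesis using vector_bundle_fibre(4)[OF E p'] by simp
qed

text \<open>Both sides of every axiom lie in \<open>S\<close> and have the same image under the
  injective map \<open>f\<close>. Negatives are multiples by -1.\<close>

lemma real_vector_space_on_transport:
  fixes f :: "'v \<Rightarrow> 'w::real_vector"
  assumes f: "inj_on f S" and z: "z \<in> S" "f z = 0"
    and add: "\<And>x y. x \<in> S \<Longrightarrow> y \<in> S \<Longrightarrow> add x y \<in> S \<and> f (add x y) = f x + f y"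
    and smul: "\<And>r x. x \<in> S \<Longrightarrow> smul r x \<in> S \<and> f (smul r x) = r *\<^sub>R f x"
  shows "real_vector_space_on S add z smul"
proof -
  have eq: "x = y" if "x \<in> S" "y \<in> S" "f x = f y" for x y
    by (rule inj_onD[OF f that(3,1,2)])
  have neg: "\<exists>y\<in>S. add x y = z" if x: "x \<in> S" for x
    by (rule bexI[of _ "smul (-1) x"], rule eq) (use x z add smul in auto)
  show ?thesis
    unfolding real_vector_space_on_def
    by (intro conjI ballI allI neg; (rule eq)?) (simp_all add: z add smul algebra_simps)
qed

lemma linear_map_onI:
  assumes "\<And>x. x \<in> S \<Longrightarrow> f x \<in> S'" "\<And>x y. x \<in> S \<Longrightarrow> y \<in> S \<Longrightarrow> f (add x y) = add' (f x) (f y)"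
    "\<And>r x. x \<in> S \<Longrightarrow> f (smul r x) = smul' r (f x)"
  shows "linear_map_on S add smul S' add' smul' f"
  using assms by (simp add: linear_map_on_def)

lemma smooth_at_vzero:
  fixes E :: "('x, 'e::euclidean_model, 'y, 'm::euclidean_model) vbundle"
  assumes E: "vector_bundle TYPE('f::euclidean_model) E" and p: "p \<in> carrier (vbase E)"
  shows "smooth_at (vbase E) (vtotal E) (vzero E) p"
proof -
  obtain U and \<phi> :: "'x \<Rightarrow> 'f" and \<iota> where pU: "p \<in> U" and t: "trivialized E U \<phi> \<iota>"
    by (rule vector_bundleE[OF E p])
  note pr = vector_bundle_smooth_projection[OF E]
  note E' = smooth_projectionD[OF pr]
  have U: "openin (mtop (vbase E)) U" by (rule trivialized_openin[OF pr t])
  have 1: "smooth_at (vbase E) (vtotal E) (\<lambda>x. \<iota> (x, 0)) p"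
    using E' p pU by (intro smooth_at_trivialized_inv[OF pr t] smooth_at_id smooth_at_const) auto
  have eq: "\<iota> (x, 0) = vzero E x" if "x \<in> U" for x
  proof -
    have "x \<in> carrier (vbase E)" using that U openin_subset by blast
    then show ?thesis
      using trivialized_left[OF pr t, of "vzero E x"] vector_bundle_fibre(3)[OF E] trivialized_zero[OF E t that] that
      by simp
  qed
  show ?thesis by (rule smooth_at_cong[OF E'(2) 1 U pU eq])
qed

lemma smooth_at_vscale:
  fixes E :: "('x, 'e::euclidean_model, 'y, 'm::euclidean_model) vbundle"
  assumes E: "vector_bundle TYPE('f::euclidean_model) E" and e: "e \<in> carrier (vtotal E)"
  shows "smooth_at (vtotal E) (vtotal E) (vscale E r) e"
proof -
  note pr = vector_bundle_smooth_projection[OF E]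
  note E' = smooth_projectionD[OF pr]
  obtain U and \<phi> :: "'x \<Rightarrow> 'f" and \<iota> where pU: "vproj E e \<in> U" and t: "trivialized E U \<phi> \<iota>"
    by (rule vector_bundleE[OF E E'(4)[OF e]])
  have U: "openin (mtop (vbase E)) U" by (rule trivialized_openin[OF pr t])
  have lin: "linear ((*\<^sub>R) r :: 'f \<Rightarrow> 'f)" by (simp add: linear_iff scaleR_add_right)
  have s: "smooth_at (vtotal E) model_manifold (\<lambda>x. r *\<^sub>R \<phi> x) e"
    by (rule smooth_at_model_linear[OF E'(1) trivialized_smooth[OF pr t e pU] lin])
  have 1: "smooth_at (vtotal E) (vtotal E) (\<lambda>x. \<iota> (vproj E x, r *\<^sub>R \<phi> x)) e"
    by (rule smooth_at_trivialized_inv[OF pr t E'(1) E'(3)[OF e] s pU])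
  have eq: "\<iota> (vproj E x, r *\<^sub>R \<phi> x) = vscale E r x" if "x \<in> {x \<in> carrier (vtotal E). vproj E x \<in> U}" for x
    using trivialized_left[OF pr t, of "vscale E r x"] vector_bundle_fibre(2)[OF E] trivialized_scale[OF pr t] that
    by simp
  show ?thesis by (rule smooth_at_cong[OF E'(1) 1 openin_over[OF pr U] _ eq]) (use e pU in auto)
qed

lemma smooth_map_on_vadd:
  fixes E :: "('x, 'e::euclidean_model, 'y, 'm::euclidean_model) vbundle"
  assumes E: "vector_bundle TYPE('f::euclidean_model) E"
  shows "smooth_map_on (prod_manifold (vtotal E) (vtotal E)) (fibre_product E E) (vtotal E) (\<lambda>(b, b'). vadd E b b')"
proof -
  note pr = vector_bundle_smooth_projection[OF E]
  note E' = smooth_projectionD[OF pr]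
  have P: "smooth_atlas (prod_manifold (vtotal E) (vtotal E))" using E' by simp
  show ?thesis
  proof (rule smooth_map_onI[OF P E'(1)])
    show "fibre_product E E \<subseteq> carrier (prod_manifold (vtotal E) (vtotal E))"
      by (auto simp: fibre_product_def)
    fix p assume "p \<in> fibre_product E E"
    then have p: "fst p \<in> carrier (vtotal E)" "snd p \<in> carrier (vtotal E)" "vproj E (fst p) = vproj E (snd p)"
      by (auto simp: fibre_product_def)
    obtain U and \<phi> :: "'x \<Rightarrow> 'f" and \<iota> where pU: "vproj E (fst p) \<in> U" and t: "trivialized E U \<phi> \<iota>"
      by (rule vector_bundleE[OF E E'(4)[OF p(1)]])
    have U: "openin (mtop (vbase E)) U" by (rule trivialized_openin[OF pr t])
    define V where "V = {x \<in> carrier (vtotal E). vproj E x \<in> U}"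
    have V: "openin (mtop (vtotal E)) V" unfolding V_def by (rule openin_over[OF pr U])
    \<comment> \<open>This map also makes sense for pairs in different fibres: the fibre coordinates
      are added over the base point of the first entry. It is thus a smooth extension of the
      addition to the open set \<open>V \<times> V\<close>.\<close>
    have s: "smooth_at (prod_manifold (vtotal E) (vtotal E)) (vtotal E) (\<lambda>x. \<iota> (vproj E (fst x), \<phi> (fst x) + \<phi> (snd x))) q"
      if "q \<in> V \<times> V" for q
    proof -
      have q: "fst q \<in> carrier (vtotal E)" "vproj E (fst q) \<in> U" "snd q \<in> carrier (vtotal E)" "vproj E (snd q) \<in> U"
        using that by (auto simp: V_def)
      then have q': "q \<in> carrier (vtotal E) \<times> carrier (vtotal E)" by (cases q) auto
      note f = smooth_at_fst_snd[OF E'(1) E'(1) q']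
      show ?thesis
        by (intro smooth_at_trivialized_inv[OF pr t P] smooth_at_model_add[OF P]
            smooth_at_compose[OF P E'(1,2) f(1)] smooth_at_compose[OF P E'(1) smooth_atlas_model f(1)]
            smooth_at_compose[OF P E'(1) smooth_atlas_model f(2)] E'(3) q trivialized_smooth[OF pr t])
    qed
    have eq: "\<iota> (vproj E (fst q), \<phi> (fst q) + \<phi> (snd q)) = (\<lambda>(b, b'). vadd E b b') q"
      if "q \<in> V \<times> V \<inter> fibre_product E E" for q
    proof -
      obtain b b' where q: "q = (b, b')" by (cases q)
      have b: "b \<in> carrier (vtotal E)" "b' \<in> carrier (vtotal E)" "vproj E b = vproj E b'" "vproj E b' \<in> U"
        using that unfolding q by (auto simp: V_def fibre_product_def)
      show ?thesis
        using vector_bundle_fibre(1)[OF E b(1-3)] trivialized_add[OF pr t b] b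
          trivialized_left[OF pr t, of "vadd E b b'"] unfolding q by simp
    qed
    show "\<exists>W g. openin (mtop (prod_manifold (vtotal E) (vtotal E))) W \<and> p \<in> W \<and>
        (\<forall>x\<in>W. smooth_at (prod_manifold (vtotal E) (vtotal E)) (vtotal E) g x) \<and>
        (\<forall>x\<in>W \<inter> fibre_product E E. g x = (\<lambda>(b, b'). vadd E b b') x)"
    proof (intro exI conjI)
      show "openin (mtop (prod_manifold (vtotal E) (vtotal E))) (V \<times> V)"
        by (rule openin_Times_prod[OF V V])
      show "p \<in> V \<times> V" using p pU by (cases p) (auto simp: V_def)
    qed (use s eq in blast)+
  qed
qed

lemma fst_snd_linear: "linear fst" "linear snd"
  by (simp_all add: linear_iff)

text \<open>Replacing the second base coordinate by the difference of the two straightens the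
  condition of equal base points to a linear one. A slice chart must take values in the model space
  of the ambient manifold; with total spaces modelled on \<open>'m \<times> 'f\<close>, the
  coordinates given by base and fibre do.\<close>

lemma embedded_fibre_product:
  fixes E :: "('x, 'm::euclidean_model \<times> 'f::euclidean_model, 'y, 'm) vbundle"
  assumes E: "vector_bundle TYPE('f) E"
  shows "embedded_subset (prod_manifold (vtotal E) (vtotal E)) (fibre_product E E)"
  unfolding embedded_subset_def
proof (intro conjI)
  note pr = vector_bundle_smooth_projection[OF E]
  note E' = smooth_projectionD[OF pr]
  let ?N = "prod_manifold (vtotal E) (vtotal E)"
  have P: "smooth_atlas ?N" using E' by simp
  show "fibre_product E E \<subseteq> carrier ?N" by (auto simp: fibre_product_def)
  define L :: "(('m \<times> 'f) \<times> 'm \<times> 'f) set" where "L = {z. fst (snd z) = 0}"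
  show "\<exists>L :: (('m \<times> 'f) \<times> 'm \<times> 'f) set. subspace L \<and>
       (\<forall>p\<in>fibre_product E E. \<exists>U (\<phi> :: 'x \<times> 'x \<Rightarrow> ('m \<times> 'f) \<times> 'm \<times> 'f). p \<in> U \<and> openin (mtop ?N) U \<and> open (\<phi> ` U) \<and>
          diffeomorphism (open_submanifold ?N U) (open_submanifold model_manifold (\<phi> ` U)) \<phi> \<and>
          \<phi> ` (U \<inter> fibre_product E E) = \<phi> ` U \<inter> L)"
  proof (intro exI[of _ L] conjI ballI)
    show "subspace L" by (auto simp: L_def subspace_def)
    fix p assume "p \<in> fibre_product E E"
    then have p: "fst p \<in> carrier (vtotal E)" "snd p \<in> carrier (vtotal E)" "vproj E (fst p) = vproj E (snd p)"
      by (auto simp: fibre_product_def)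
    obtain U0 and \<phi> :: "'x \<Rightarrow> 'f" and \<iota> where pU0: "vproj E (fst p) \<in> U0" and t0: "trivialized E U0 \<phi> \<iota>"
      by (rule vector_bundleE[OF E E'(4)[OF p(1)]])
    obtain Um \<kappa> where c: "(Um, \<kappa>) \<in> atlas (vbase E)" and pUm: "vproj E (fst p) \<in> Um"
      using chart_exists[OF E'(2) E'(4)[OF p(1)]] by blast
    define U where "U = U0 \<inter> Um"
    have U: "openin (mtop (vbase E)) U"
      unfolding U_def using trivialized_openin[OF pr t0] chart_openin[OF E'(2) c] by blast
    have t: "trivialized E U \<phi> \<iota>" by (rule trivialized_restrict[OF t0 U]) (simp add: U_def)
    have pU: "vproj E (fst p) \<in> U" using pU0 pUm by (simp add: U_def)
    define S where "S = \<kappa> ` U"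
    have S: "open S" unfolding S_def by (rule chart_open_image[OF E'(2) c U]) (simp add: U_def)
    define k where "k = inv_into Um \<kappa>"
    have k: "k (\<kappa> x) = x" if "x \<in> U" for x
      using that chart_inv[OF E'(2) c] by (simp add: k_def U_def)
    have kS: "k y \<in> U" "\<kappa> (k y) = y" if "y \<in> S" for y using that k by (auto simp: S_def)
    have sk: "smooth_at model_manifold (vbase E) k y" if "y \<in> S" for y
      unfolding k_def by (rule smooth_at_chart_inv[OF E'(2) c]) (use that in \<open>auto simp: S_def U_def\<close>)
    have s\<kappa>: "smooth_at (vbase E) model_manifold \<kappa> x" if "x \<in> U" for x
      by (rule smooth_at_chart[OF E'(2) c]) (use that in \<open>auto simp: U_def\<close>)
    define V where "V = {x \<in> carrier (vtotal E). vproj E x \<in> U}"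
    have V: "openin (mtop (vtotal E)) V" unfolding V_def by (rule openin_over[OF pr U])
    have VV: "openin (mtop ?N) (V \<times> V)" by (rule openin_Times_prod[OF V V])
    have VVc: "V \<times> V \<subseteq> carrier (vtotal E) \<times> carrier (vtotal E)" by (auto simp: V_def)
    define \<Phi> where "\<Phi> e = ((\<kappa> (vproj E (fst e)), \<phi> (fst e)), (\<kappa> (vproj E (snd e)) - \<kappa> (vproj E (fst e)), \<phi> (snd e)))" for e
    define \<Psi> where "\<Psi> z = (\<iota> (k (fst (fst z)), snd (fst z)), \<iota> (k (fst (fst z) + fst (snd z)), snd (snd z)))" for z
    \<comment> \<open>The image of the chart is not a product: it is the set where the first base
      coordinate and the recovered second one both lie in the coordinate image
      \<open>S\<close>.\<close>
    define T where "T = {z :: ('m \<times> 'f) \<times> 'm \<times> 'f. fst (fst z) \<in> S \<and> fst (fst z) + fst (snd z) \<in> S}"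
    have left: "\<Psi> (\<Phi> e) = e" if "e \<in> V \<times> V" for e
      using that by (cases e) (auto simp: \<Phi>_def \<Psi>_def V_def k trivialized_left[OF pr t])
    have right: "\<Phi> (\<Psi> z) = z" if "z \<in> T" for z
      using that by (cases z) (auto simp: \<Phi>_def \<Psi>_def T_def kS trivialized_right[OF pr t])
    have \<Phi>T: "\<Phi> e \<in> T" if "e \<in> V \<times> V" for e
      using that by (auto simp: \<Phi>_def T_def V_def S_def)
    have \<Psi>V: "\<Psi> z \<in> V \<times> V" if "z \<in> T" for z
      using that by (auto simp: \<Psi>_def T_def V_def kS trivialized_right[OF pr t] trivialized_inv_carrier[OF pr t])
    have im: "\<Phi> ` (V \<times> V) = T"
      using \<Phi>T \<Psi>V right by (metis (no_types, lifting) image_eqI image_subsetI subsetI subset_antisym)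
    have T: "open T"
    proof -
      have "T = (\<lambda>z. fst (fst z)) -` S \<inter> (\<lambda>z. fst (fst z) + fst (snd z)) -` S" by (auto simp: T_def)
      moreover have "open \<dots>" by (intro open_Int open_vimage S continuous_intros)
      ultimately show ?thesis by simp
    qed
    have s\<Phi>: "smooth_at ?N model_manifold \<Phi> e" if e: "e \<in> V \<times> V" for e
    proof -
      have e': "fst e \<in> carrier (vtotal E)" "vproj E (fst e) \<in> U" "snd e \<in> carrier (vtotal E)" "vproj E (snd e) \<in> U"
        using e by (auto simp: V_def)
      have ec: "e \<in> carrier (vtotal E) \<times> carrier (vtotal E)" using e VVc by blast
      note f = smooth_at_fst_snd[OF E'(1) E'(1) ec]
      have 1: "smooth_at ?N model_manifold (\<lambda>e. \<kappa> (vproj E (fst e))) e"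
        by (rule smooth_at_compose[OF P E'(2) smooth_atlas_model smooth_at_compose[OF P E'(1,2) f(1) E'(3)[OF e'(1)]] s\<kappa>[OF e'(2)]])
      have 2: "smooth_at ?N model_manifold (\<lambda>e. \<kappa> (vproj E (snd e))) e"
        by (rule smooth_at_compose[OF P E'(2) smooth_atlas_model smooth_at_compose[OF P E'(1,2) f(2) E'(3)[OF e'(3)]] s\<kappa>[OF e'(4)]])
      have 3: "smooth_at ?N model_manifold (\<lambda>e. \<phi> (fst e)) e" "smooth_at ?N model_manifold (\<lambda>e. \<phi> (snd e)) e"
        by (rule smooth_at_compose[OF P E'(1) smooth_atlas_model f(1) trivialized_smooth[OF pr t e'(1,2)]],
            rule smooth_at_compose[OF P E'(1) smooth_atlas_model f(2) trivialized_smooth[OF pr t e'(3,4)]])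
      have lin: "linear (uminus :: 'm \<Rightarrow> 'm)" by (simp add: linear_iff)
      have 4: "smooth_at ?N model_manifold (\<lambda>e. \<kappa> (vproj E (snd e)) + - \<kappa> (vproj E (fst e))) e"
        by (intro smooth_at_model_add[OF P 2] smooth_at_model_linear[OF P 1 lin])
      show ?thesis
        using smooth_at_model_Pair[OF P smooth_at_model_Pair[OF P 1 3(1)] smooth_at_model_Pair[OF P 4 3(2)]]
        by (simp add: \<Phi>_def[abs_def])
    qed
    have s\<Psi>: "smooth_at model_manifold ?N \<Psi> z" if z: "z \<in> T" for z
    proof -
      have z': "fst (fst z) \<in> S" "fst (fst z) + fst (snd z) \<in> S" using z by (auto simp: T_def)
      have i: "smooth_at model_manifold model_manifold (\<lambda>z. z) z" by (rule smooth_at_id) auto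
      have l: "linear (\<lambda>z. fst (fst z) :: 'm)" "linear (\<lambda>z. snd (fst z) :: 'f)"
         "linear (\<lambda>z. fst (fst z) + fst (snd z) :: 'm)" "linear (\<lambda>z. snd (snd z) :: 'f)"
        by (auto simp: linear_iff algebra_simps)
      note i' = smooth_at_model_linear[OF smooth_atlas_model i]
      note c = smooth_at_compose[OF smooth_atlas_model smooth_atlas_model E'(2)]
      show ?thesis unfolding \<Psi>_def[abs_def]
        by (rule smooth_at_Pair[OF smooth_atlas_model E'(1,1)];
            rule smooth_at_trivialized_inv[OF pr t smooth_atlas_model])
          (rule c[OF i'[OF l(1)] sk] c[OF i'[OF l(3)] sk] i'[OF l(2)] i'[OF l(4)] z' kS(1))+
    qed
    have diff: "diffeomorphism (open_submanifold ?N (V \<times> V)) (open_submanifold model_manifold T) \<Phi>"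
    proof (rule diffeomorphismI[of _ _ _ \<Psi>])
      have oT: "openin (mtop model_manifold) T" using T by (simp add: openin_model)
      show at: "smooth_atlas (open_submanifold ?N (V \<times> V))" "smooth_atlas (open_submanifold model_manifold T)"
        using P VV oT by auto
      show "smooth_at (open_submanifold ?N (V \<times> V)) (open_submanifold model_manifold T) \<Phi> e"
        if "e \<in> carrier (open_submanifold ?N (V \<times> V))" for e
        using that s\<Phi>[of e] \<Phi>T[of e] smooth_at_open_submanifold_dom[OF P at(2) VV]
          smooth_at_open_submanifold_cod[OF P smooth_atlas_model oT] by auto
      show "smooth_at (open_submanifold model_manifold T) (open_submanifold ?N (V \<times> V)) \<Psi> z"
        if "z \<in> carrier (open_submanifold model_manifold T)" for z
        using that s\<Psi>[of z] \<Psi>V[of z] smooth_at_open_submanifold_dom[OF smooth_atlas_model at(1) oT]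
          smooth_at_open_submanifold_cod[OF smooth_atlas_model P VV, of \<Psi> z] by simp
    qed (use left right in auto)
    show "\<exists>U (\<phi> :: 'x \<times> 'x \<Rightarrow> ('m \<times> 'f) \<times> 'm \<times> 'f). p \<in> U \<and> openin (mtop ?N) U \<and> open (\<phi> ` U) \<and>
          diffeomorphism (open_submanifold ?N U) (open_submanifold model_manifold (\<phi> ` U)) \<phi> \<and>
          \<phi> ` (U \<inter> fibre_product E E) = \<phi> ` U \<inter> L"
    proof (intro exI conjI)
      show "p \<in> V \<times> V" using p pU by (cases p) (auto simp: V_def)
      show "openin (mtop ?N) (V \<times> V)" by (rule VV)
      show "open (\<Phi> ` (V \<times> V))" using T im by simp
      show "diffeomorphism (open_submanifold ?N (V \<times> V)) (open_submanifold model_manifold (\<Phi> ` (V \<times> V))) \<Phi>"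
        using diff im by simp
      show "\<Phi> ` (V \<times> V \<inter> fibre_product E E) = \<Phi> ` (V \<times> V) \<inter> L"
      proof (intro equalityI subsetI)
        fix z assume "z \<in> \<Phi> ` (V \<times> V \<inter> fibre_product E E)"
        then show "z \<in> \<Phi> ` (V \<times> V) \<inter> L" by (auto simp: L_def \<Phi>_def fibre_product_def)
      next
        fix z assume "z \<in> \<Phi> ` (V \<times> V) \<inter> L"
        then obtain e where e: "e \<in> V \<times> V" "z = \<Phi> e" "\<Phi> e \<in> L" by auto
        then have "\<kappa> (vproj E (snd e)) = \<kappa> (vproj E (fst e))" by (simp add: L_def \<Phi>_def)
        then have "vproj E (snd e) = vproj E (fst e)"
          using e(1) k[of "vproj E (snd e)"] k[of "vproj E (fst e)"] by (auto simp: V_def)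
        then have "e \<in> fibre_product E E" using e(1) by (cases e) (auto simp: V_def fibre_product_def)
        then show "z \<in> \<Phi> ` (V \<times> V \<inter> fibre_product E E)" using e by blast
      qed
    qed
  qed
qed

section \<open>Products of vector bundles\<close>

lemma smooth_projection_prod:
  assumes E: "smooth_projection E" and F: "smooth_projection F"
  shows "smooth_projection (prod_vbundle E F)"
proof -
  note E' = smooth_projectionD[OF E] and F' = smooth_projectionD[OF F]
  have P: "smooth_atlas (prod_manifold (vtotal E) (vtotal F))" using E' F' by simp
  have "smooth_at (prod_manifold (vtotal E) (vtotal F)) (prod_manifold (vbase E) (vbase F)) (map_prod (vproj E) (vproj F)) e"
    if e: "e \<in> carrier (vtotal E) \<times> carrier (vtotal F)" for e
  proof -
    note f = smooth_at_fst_snd[OF E'(1) F'(1) e]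
    have "smooth_at (prod_manifold (vtotal E) (vtotal F)) (prod_manifold (vbase E) (vbase F)) (\<lambda>e. (vproj E (fst e), vproj F (snd e))) e"
      by (intro smooth_at_Pair[OF P E'(2) F'(2)] smooth_at_compose[OF P E'(1,2) f(1)] smooth_at_compose[OF P F'(1,2) f(2)] E'(3) F'(3))
        (use e in auto)
    then show ?thesis by (simp add: map_prod_def case_prod_beta')
  qed
  then show ?thesis
    using E' F' by (simp add: smooth_projection_def prod_vbundle_def)
qed

lemma trivialized_prod:
  fixes E :: "('x, 'e::euclidean_model, 'y, 'm::euclidean_model) vbundle" and \<phi> :: "'x \<Rightarrow> 'f::euclidean_model"
    and E2 :: "('x2, 'e2::euclidean_model, 'y2, 'm2::euclidean_model) vbundle" and \<phi>2 :: "'x2 \<Rightarrow> 'f2::euclidean_model"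
  assumes E: "smooth_projection E" and E2: "smooth_projection E2"
    and t: "trivialized E U \<phi> \<iota>" and t2: "trivialized E2 U2 \<phi>2 \<iota>2"
  shows "trivialized (prod_vbundle E E2) (U \<times> U2) (map_prod \<phi> \<phi>2)
    (\<lambda>z. (\<iota> (fst (fst z), fst (snd z)), \<iota>2 (snd (fst z), snd (snd z))))"
  unfolding trivialized_def
proof (intro conjI ballI allI impI)
  note E' = smooth_projectionD[OF E] and F' = smooth_projectionD[OF E2]
  let ?T = "prod_manifold (vtotal E) (vtotal E2)" and ?B = "prod_manifold (vbase E) (vbase E2)"
  have P: "smooth_atlas ?T" "smooth_atlas ?B" using E' F' by auto
  have [simp]: "vtotal (prod_vbundle E E2) = ?T" "vbase (prod_vbundle E E2) = ?B"
    "vproj (prod_vbundle E E2) = map_prod (vproj E) (vproj E2)" by (simp_all add: prod_vbundle_def)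
  note U = trivialized_openin[OF E t] and U2 = trivialized_openin[OF E2 t2]
  show "openin (mtop (vbase (prod_vbundle E E2))) (U \<times> U2)"
    using openin_Times_prod[OF U U2] by simp
  {
    fix e assume "e \<in> carrier (vtotal (prod_vbundle E E2))" "vproj (prod_vbundle E E2) e \<in> U \<times> U2"
    then obtain x y where e: "e = (x, y)" "x \<in> carrier (vtotal E)" "y \<in> carrier (vtotal E2)" "vproj E x \<in> U" "vproj E2 y \<in> U2"
      by (cases e) auto
    then have ec: "e \<in> carrier (vtotal E) \<times> carrier (vtotal E2)" by auto
    note f = smooth_at_fst_snd[OF E'(1) F'(1) ec]
    have "smooth_at ?T model_manifold (\<lambda>e. (\<phi> (fst e), \<phi>2 (snd e))) e"
      by (intro smooth_at_model_Pair[OF P(1)] smooth_at_compose[OF P(1) E'(1) smooth_atlas_model f(1)]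
          smooth_at_compose[OF P(1) F'(1) smooth_atlas_model f(2)] trivialized_smooth[OF E t] trivialized_smooth[OF E2 t2]) (use e in auto)
    then show "smooth_at (vtotal (prod_vbundle E E2)) model_manifold (map_prod \<phi> \<phi>2) e"
      by (simp add: map_prod_def case_prod_beta')
    show "(\<iota> (fst (fst (vproj (prod_vbundle E E2) e, map_prod \<phi> \<phi>2 e)), fst (snd (vproj (prod_vbundle E E2) e, map_prod \<phi> \<phi>2 e))),
       \<iota>2 (snd (fst (vproj (prod_vbundle E E2) e, map_prod \<phi> \<phi>2 e)), snd (snd (vproj (prod_vbundle E E2) e, map_prod \<phi> \<phi>2 e)))) = e"
      using e by (simp add: trivialized_left[OF E t] trivialized_left[OF E2 t2])
  }
  {
    fix x and u :: "'f \<times> 'f2" assume x: "x \<in> U \<times> U2"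
    then have xc: "fst x \<in> carrier (vbase E)" "snd x \<in> carrier (vbase E2)" using U U2 openin_subset by fastforce+
    let ?M = "model_manifold :: ('f \<times> 'f2, 'f \<times> 'f2) manifold"
    let ?P = "prod_manifold ?B ?M"
    have Q: "smooth_atlas ?P" using P by simp
    have c: "(x, u) \<in> carrier ?B \<times> carrier ?M" using xc by (cases x) auto
    then have c': "fst (x, u) \<in> carrier (vbase E) \<times> carrier (vbase E2)" by simp
    note f = smooth_at_fst_snd[OF P(2) smooth_atlas_model c] and g = smooth_at_fst_snd[OF E'(2) F'(2) c']
    have b: "smooth_at ?P (vbase E) (\<lambda>z. fst (fst z)) (x, u)" "smooth_at ?P (vbase E2) (\<lambda>z. snd (fst z)) (x, u)"
      by (rule smooth_at_compose[OF Q P(2) E'(2) f(1) g(1)], rule smooth_at_compose[OF Q P(2) F'(2) f(1) g(2)])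
    note l = smooth_at_model_linear[OF Q f(2) fst_snd_linear(1)] smooth_at_model_linear[OF Q f(2) fst_snd_linear(2)]
    have "smooth_at ?P ?T (\<lambda>z. (\<iota> (fst (fst z), fst (snd z)), \<iota>2 (snd (fst z), snd (snd z)))) (x, u)"
      by (intro smooth_at_Pair[OF Q E'(1) F'(1)] smooth_at_trivialized_inv[OF E t Q b(1) l(1)]
          smooth_at_trivialized_inv[OF E2 t2 Q b(2) l(2)]) (use x in auto)
    then show "smooth_at (prod_manifold (vbase (prod_vbundle E E2)) ?M) (vtotal (prod_vbundle E E2))
      (\<lambda>z. (\<iota> (fst (fst z), fst (snd z)), \<iota>2 (snd (fst z), snd (snd z)))) (x, u)" by simp
    show "vproj (prod_vbundle E E2) (\<iota> (fst (fst (x, u)), fst (snd (x, u))), \<iota>2 (snd (fst (x, u)), snd (snd (x, u)))) = x"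
      "map_prod \<phi> \<phi>2 (\<iota> (fst (fst (x, u)), fst (snd (x, u))), \<iota>2 (snd (fst (x, u)), snd (snd (x, u)))) = u"
      using x by (auto simp: trivialized_right[OF E t] trivialized_right[OF E2 t2])
  }
  fix p assume p: "p \<in> U \<times> U2"
  show "linear_map_on (fibre (prod_vbundle E E2) p) (vadd (prod_vbundle E E2)) (vscale (prod_vbundle E E2)) UNIV (+) (*\<^sub>R) (map_prod \<phi> \<phi>2)"
    using p by (auto intro!: linear_map_onI simp: fibre_def prod_vbundle_def
        trivialized_add[OF E t] trivialized_add[OF E2 t2] trivialized_scale[OF E t] trivialized_scale[OF E2 t2])
qed

subsection \<open>Double vector bundles from decomposing charts\<close>

text \<open>
  Over \<open>U\<close>, the map \<open>d \<mapsto> (\<alpha> (vproj V d), \<beta> (vproj H d), \<gamma> d)\<close> decomposes the double vector bundle into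
  its two side bundles and its core; \<open>\<Psi>\<close> is the inverse.
\<close>

definition dvb_chart ::
  "('d, 'ed::euclidean_model, 'a, 'ea::euclidean_model) vbundle \<Rightarrow> ('d, 'ed, 'b, 'eb::euclidean_model) vbundle
     \<Rightarrow> ('a, 'ea, 'm, 'em::euclidean_model) vbundle \<Rightarrow> ('b, 'eb, 'm, 'em) vbundle \<Rightarrow> 'm set
     \<Rightarrow> ('a \<Rightarrow> 'fa::euclidean_model) \<Rightarrow> ('m \<times> 'fa \<Rightarrow> 'a) \<Rightarrow> ('b \<Rightarrow> 'fb::euclidean_model) \<Rightarrow> ('m \<times> 'fb \<Rightarrow> 'b)
     \<Rightarrow> ('d \<Rightarrow> 'fc::euclidean_model) \<Rightarrow> ('m \<times> ('fa \<times> 'fb \<times> 'fc) \<Rightarrow> 'd) \<Rightarrow> bool" where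
  "dvb_chart V H A B U \<alpha> \<alpha>i \<beta> \<beta>i \<gamma> \<Psi> \<longleftrightarrow>
     trivialized A U \<alpha> \<alpha>i \<and> trivialized B U \<beta> \<beta>i \<and>
     (\<forall>d\<in>carrier (vtotal H). vproj A (vproj V d) \<in> U \<longrightarrow>
        smooth_at (vtotal H) model_manifold \<gamma> d \<and>
        \<Psi> (vproj A (vproj V d), (\<alpha> (vproj V d), \<beta> (vproj H d), \<gamma> d)) = d) \<and>
     (\<forall>x\<in>U. \<forall>u v c. smooth_at (prod_manifold (vbase A) model_manifold) (vtotal H) \<Psi> (x, (u, v, c)) \<and>
        vproj V (\<Psi> (x, (u, v, c))) = \<alpha>i (x, u) \<and> vproj H (\<Psi> (x, (u, v, c))) = \<beta>i (x, v) \<and>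
        \<gamma> (\<Psi> (x, (u, v, c))) = c) \<and>
     (\<forall>d\<in>carrier (vtotal H). \<forall>d'\<in>carrier (vtotal H). vproj A (vproj V d) \<in> U \<longrightarrow>
        (vproj V d = vproj V d' \<longrightarrow> \<gamma> (vadd V d d') = \<gamma> d + \<gamma> d') \<and>
        (vproj H d = vproj H d' \<longrightarrow> \<gamma> (vadd H d d') = \<gamma> d + \<gamma> d')) \<and>
     (\<forall>d\<in>carrier (vtotal H). \<forall>r. vproj A (vproj V d) \<in> U \<longrightarrow>
        \<gamma> (vscale V r d) = r *\<^sub>R \<gamma> d \<and> \<gamma> (vscale H r d) = r *\<^sub>R \<gamma> d) \<and>
     (\<forall>a\<in>carrier (vtotal A). vproj A a \<in> U \<longrightarrow> \<gamma> (vzero V a) = 0) \<and>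
     (\<forall>b\<in>carrier (vtotal B). vproj B b \<in> U \<longrightarrow> \<gamma> (vzero H b) = 0)"

text \<open>\<open>V\<close> and \<open>H\<close> are not assumed to be vector bundles; that is
  deduced from the charts. The remaining assumptions say where each structure map lands and how it
  acts on the other side bundle. The list is symmetric under exchange of the two structures, so
  statements about \<open>H\<close> can be read for \<open>V\<close>.\<close>

locale dvb_data =
  fixes V :: "('d, 'ed::euclidean_model, 'a, 'em::euclidean_model \<times> 'fa::euclidean_model) vbundle"
    and H :: "('d, 'ed, 'b, 'em \<times> 'fb::euclidean_model) vbundle"
    and A :: "('a, 'em \<times> 'fa, 'm, 'em) vbundle" and B :: "('b, 'em \<times> 'fb, 'm, 'em) vbundle"
  assumes bA: "vector_bundle TYPE('fa) A" and bB: "vector_bundle TYPE('fb) B"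
    and tot: "vtotal V = vtotal H" and baseV: "vbase V = vtotal A" and baseH: "vbase H = vtotal B"
    and base: "vbase A = vbase B"
    and mfd: "smooth_manifold (vtotal H)"
    and sV: "d \<in> carrier (vtotal H) \<Longrightarrow> smooth_at (vtotal H) (vtotal A) (vproj V) d"
    and sH: "d \<in> carrier (vtotal H) \<Longrightarrow> smooth_at (vtotal H) (vtotal B) (vproj H) d"
    and comm: "d \<in> carrier (vtotal H) \<Longrightarrow> vproj A (vproj V d) = vproj B (vproj H d)"
    and addV: "d \<in> carrier (vtotal H) \<Longrightarrow> d' \<in> carrier (vtotal H) \<Longrightarrow> vproj V d = vproj V d' \<Longrightarrow>
      vadd V d d' \<in> carrier (vtotal H) \<and> vproj V (vadd V d d') = vproj V d \<and>
      vproj H (vadd V d d') = vadd B (vproj H d) (vproj H d')"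
    and addH: "d \<in> carrier (vtotal H) \<Longrightarrow> d' \<in> carrier (vtotal H) \<Longrightarrow> vproj H d = vproj H d' \<Longrightarrow>
      vadd H d d' \<in> carrier (vtotal H) \<and> vproj H (vadd H d d') = vproj H d \<and>
      vproj V (vadd H d d') = vadd A (vproj V d) (vproj V d')"
    and scaleV: "d \<in> carrier (vtotal H) \<Longrightarrow> vscale V r d \<in> carrier (vtotal H) \<and> vproj V (vscale V r d) = vproj V d \<and>
      vproj H (vscale V r d) = vscale B r (vproj H d)"
    and scaleH: "d \<in> carrier (vtotal H) \<Longrightarrow> vscale H r d \<in> carrier (vtotal H) \<and> vproj H (vscale H r d) = vproj H d \<and>
      vproj V (vscale H r d) = vscale A r (vproj V d)"
    and zeroV: "a \<in> carrier (vtotal A) \<Longrightarrow> vzero V a \<in> carrier (vtotal H) \<and> vproj V (vzero V a) = a \<and>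
      vproj H (vzero V a) = vzero B (vproj A a)"
    and zeroH: "b \<in> carrier (vtotal B) \<Longrightarrow> vzero H b \<in> carrier (vtotal H) \<and> vproj H (vzero H b) = b \<and>
      vproj V (vzero H b) = vzero A (vproj B b)"
    and charts: "x \<in> carrier (vbase A) \<Longrightarrow> \<exists>U (\<alpha> :: 'a \<Rightarrow> 'fa) \<alpha>i (\<beta> :: 'b \<Rightarrow> 'fb) \<beta>i (\<gamma> :: 'd \<Rightarrow> 'fc::euclidean_model) \<Psi>.
      x \<in> U \<and> dvb_chart V H A B U \<alpha> \<alpha>i \<beta> \<beta>i \<gamma> \<Psi>"
begin

lemmas pA = vector_bundle_smooth_projection[OF bA] and pB = vector_bundle_smooth_projection[OF bB]
lemmas atA = smooth_projectionD(1,2)[OF pA] and atB = smooth_projectionD(1,2)[OF pB]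
lemmas atD = smooth_manifold_atlas[OF mfd]

lemma projV: "d \<in> carrier (vtotal H) \<Longrightarrow> vproj V d \<in> carrier (vtotal A)"
  by (rule smooth_at_in_carrier(2)[OF atD atA(1) sV])

lemma projH: "d \<in> carrier (vtotal H) \<Longrightarrow> vproj H d \<in> carrier (vtotal B)"
  by (rule smooth_at_in_carrier(2)[OF atD atB(1) sH])

lemma smooth_proj_base: "d \<in> carrier (vtotal H) \<Longrightarrow> smooth_at (vtotal H) (vbase A) (\<lambda>d. vproj A (vproj V d)) d"
  by (rule smooth_at_compose[OF atD atA sV smooth_projectionD(3)[OF pA projV]])

context
  fixes U and \<alpha> :: "'a \<Rightarrow> 'fa" and \<alpha>i and \<beta> :: "'b \<Rightarrow> 'fb" and \<beta>i and \<gamma> :: "'d \<Rightarrow> 'fc" and \<Psi>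
  assumes ch: "dvb_chart V H A B U \<alpha> \<alpha>i \<beta> \<beta>i \<gamma> \<Psi>"
begin

lemma tA: "trivialized A U \<alpha> \<alpha>i" and tB: "trivialized B U \<beta> \<beta>i"
  using ch by (simp_all add: dvb_chart_def)

lemma U_open: "openin (mtop (vbase A)) U" by (rule trivialized_openin[OF pA tA])

lemma \<gamma>_smooth: "d \<in> carrier (vtotal H) \<Longrightarrow> vproj A (vproj V d) \<in> U \<Longrightarrow> smooth_at (vtotal H) model_manifold \<gamma> d"
  using ch by (simp add: dvb_chart_def)

lemma \<Psi>_left: "d \<in> carrier (vtotal H) \<Longrightarrow> vproj A (vproj V d) \<in> U \<Longrightarrow>
    \<Psi> (vproj A (vproj V d), (\<alpha> (vproj V d), \<beta> (vproj H d), \<gamma> d)) = d"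
  using ch by (simp add: dvb_chart_def)

lemma \<Psi>_right:
  assumes "x \<in> U"
  shows "vproj V (\<Psi> (x, (u, v, c))) = \<alpha>i (x, u)" "vproj H (\<Psi> (x, (u, v, c))) = \<beta>i (x, v)" "\<gamma> (\<Psi> (x, (u, v, c))) = c"
  using ch assms by (simp_all add: dvb_chart_def)

lemma \<gamma>_addV: "d \<in> carrier (vtotal H) \<Longrightarrow> d' \<in> carrier (vtotal H) \<Longrightarrow> vproj V d = vproj V d' \<Longrightarrow> vproj A (vproj V d) \<in> U \<Longrightarrow>
    \<gamma> (vadd V d d') = \<gamma> d + \<gamma> d'"
  using ch unfolding dvb_chart_def by blast

lemma \<gamma>_addH: "d \<in> carrier (vtotal H) \<Longrightarrow> d' \<in> carrier (vtotal H) \<Longrightarrow> vproj H d = vproj H d' \<Longrightarrow> vproj A (vproj V d) \<in> U \<Longrightarrow>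
    \<gamma> (vadd H d d') = \<gamma> d + \<gamma> d'"
  using ch unfolding dvb_chart_def by blast

lemma \<gamma>_scale: "d \<in> carrier (vtotal H) \<Longrightarrow> vproj A (vproj V d) \<in> U \<Longrightarrow> \<gamma> (vscale V r d) = r *\<^sub>R \<gamma> d"
  "d \<in> carrier (vtotal H) \<Longrightarrow> vproj A (vproj V d) \<in> U \<Longrightarrow> \<gamma> (vscale H r d) = r *\<^sub>R \<gamma> d"
  using ch by (simp_all add: dvb_chart_def)

lemma \<gamma>_zero: "a \<in> carrier (vtotal A) \<Longrightarrow> vproj A a \<in> U \<Longrightarrow> \<gamma> (vzero V a) = 0"
  "b \<in> carrier (vtotal B) \<Longrightarrow> vproj B b \<in> U \<Longrightarrow> \<gamma> (vzero H b) = 0"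
  using ch by (simp_all add: dvb_chart_def)

text \<open>The criterion behind all identities between the two structures: over \<open>U\<close> an
  element is determined by its projections, known from the assumptions, and by \<gamma>, which is
  linear for both structures.\<close>

lemma chart_eqI:
  assumes "d \<in> carrier (vtotal H)" "d' \<in> carrier (vtotal H)" "vproj A (vproj V d) \<in> U"
    "vproj V d = vproj V d'" "vproj H d = vproj H d'" "\<gamma> d = \<gamma> d'"
  shows "d = d'"
  using \<Psi>_left[of d] \<Psi>_left[of d'] assms by simp

lemma smooth_at_\<Psi>:
  assumes N: "smooth_atlas N" and X: "smooth_at N (vbase A) X p" and p: "X p \<in> U"
    and u: "smooth_at N model_manifold u p" and v: "smooth_at N model_manifold v p" and c: "smooth_at N model_manifold c p"
  shows "smooth_at N (vtotal H) (\<lambda>e. \<Psi> (X e, (u e, v e, c e))) p"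
proof -
  have P: "smooth_atlas (prod_manifold (vbase A) (model_manifold :: ('fa \<times> 'fb \<times> 'fc, _) manifold))"
    using atA by simp
  have 1: "smooth_at N (prod_manifold (vbase A) model_manifold) (\<lambda>e. (X e, (u e, v e, c e))) p"
    by (rule smooth_at_Pair[OF N atA(2) smooth_atlas_model X smooth_at_model_Pair[OF N u smooth_at_model_Pair[OF N v c]]])
  have 2: "smooth_at (prod_manifold (vbase A) model_manifold) (vtotal H) \<Psi> (X p, (u p, v p, c p))"
    using ch p by (simp add: dvb_chart_def)
  show ?thesis by (rule smooth_at_compose[OF N P atD 1 2])
qed

lemma smooth_coords:
  assumes "d \<in> carrier (vtotal H)" "vproj A (vproj V d) \<in> U"
  shows "smooth_at (vtotal H) model_manifold (\<lambda>d. \<alpha> (vproj V d)) d" "smooth_at (vtotal H) model_manifold (\<lambda>d. \<beta> (vproj H d)) d"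
proof -
  show "smooth_at (vtotal H) model_manifold (\<lambda>d. \<alpha> (vproj V d)) d"
    by (rule smooth_at_compose[OF atD atA(1) smooth_atlas_model sV[OF assms(1)] trivialized_smooth[OF pA tA projV[OF assms(1)] assms(2)]])
  have "vproj B (vproj H d) \<in> U" using assms comm by simp
  then show "smooth_at (vtotal H) model_manifold (\<lambda>d. \<beta> (vproj H d)) d"
    by (rule smooth_at_compose[OF atD atB(1) smooth_atlas_model sH[OF assms(1)] trivialized_smooth[OF pB tB projH[OF assms(1)]]])
qed

definition overU where "overU = {d \<in> carrier (vtotal H). vproj A (vproj V d) \<in> U}"

lemma overU_open: "openin (mtop (vtotal H)) overU"
proof -
  have "smooth_map (vtotal H) (vbase A) (\<lambda>d. vproj A (vproj V d))"
    using smooth_proj_base by (simp add: smooth_map_iff[OF atD atA(2)])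
  then show ?thesis using U_open openin_continuous_map_preimage by (auto simp: smooth_map_def overU_def)
qed

text \<open>Over a fixed element b of B the B-coordinate is constant, so the typical fibre of D
  \<rightarrow> B is the A-coordinate together with the core coordinate.\<close>

definition \<phi>H where "\<phi>H d = (\<alpha> (vproj V d), \<gamma> d)"

text \<open>The missing base point and B-coordinate are read off from the element of B.\<close>

definition \<iota>H where "\<iota>H z = \<Psi> (vproj B (fst z), (fst (snd z), \<beta> (fst z), snd (snd z)))"

lemma trivialized_H: "trivialized H {b \<in> carrier (vtotal B). vproj B b \<in> U} \<phi>H \<iota>H"
  unfolding trivialized_def
proof (intro conjI ballI allI impI)
  have U: "openin (mtop (vbase B)) U" using U_open base by simp
  show "openin (mtop (vbase H)) {b \<in> carrier (vtotal B). vproj B b \<in> U}"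
    using openin_over[OF pB U] baseH by simp
  {
    fix d assume d: "d \<in> carrier (vtotal H)" "vproj H d \<in> {b \<in> carrier (vtotal B). vproj B b \<in> U}"
    then have dU: "vproj A (vproj V d) \<in> U" using comm by simp
    show "smooth_at (vtotal H) model_manifold \<phi>H d"
      unfolding \<phi>H_def[abs_def] by (rule smooth_at_model_Pair[OF atD smooth_coords(1)[OF d(1) dU] \<gamma>_smooth[OF d(1) dU]])
    show "\<iota>H (vproj H d, \<phi>H d) = d"
      using \<Psi>_left[OF d(1) dU] comm[OF d(1)] by (simp add: \<iota>H_def \<phi>H_def)
  }
  {
    fix b and w :: "'fa \<times> 'fc" assume "b \<in> {b \<in> carrier (vtotal B). vproj B b \<in> U}"
    then have b: "b \<in> carrier (vtotal B)" "vproj B b \<in> U" by auto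
    let ?M = "model_manifold :: ('fa \<times> 'fc, 'fa \<times> 'fc) manifold"
    let ?P = "prod_manifold (vtotal B) ?M"
    have P: "smooth_atlas ?P" using atB by simp
    have c: "(b, w) \<in> carrier (vtotal B) \<times> carrier ?M" using b by simp
    note f = smooth_at_fst_snd[OF atB(1) smooth_atlas_model c]
    have b': "fst (b, w) \<in> carrier (vtotal B)" "vproj B (fst (b, w)) \<in> U" using b by simp_all
    have x: "smooth_at ?P (vbase B) (\<lambda>z. vproj B (fst z)) (b, w)"
      by (rule smooth_at_compose[OF P atB f(1) smooth_projectionD(3)[OF pB b'(1)]])
    have v: "smooth_at ?P model_manifold (\<lambda>z. \<beta> (fst z)) (b, w)"
      by (rule smooth_at_compose[OF P atB(1) smooth_atlas_model f(1) trivialized_smooth[OF pB tB b']])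
    show "smooth_at (prod_manifold (vbase H) ?M) (vtotal H) \<iota>H (b, w)"
      unfolding \<iota>H_def[abs_def] baseH
      by (rule smooth_at_\<Psi>[OF P x[folded base] b'(2) smooth_at_model_linear[OF P f(2) fst_snd_linear(1)] v
            smooth_at_model_linear[OF P f(2) fst_snd_linear(2)]])
    show "vproj H (\<iota>H (b, w)) = b"
      using b by (simp add: \<iota>H_def \<Psi>_right trivialized_left[OF pB tB])
    show "\<phi>H (\<iota>H (b, w)) = w"
      using b by (simp add: \<iota>H_def \<phi>H_def \<Psi>_right trivialized_right[OF pA tA])
  }
  fix b assume b: "b \<in> {b \<in> carrier (vtotal B). vproj B b \<in> U}"
  show "linear_map_on (fibre H b) (vadd H) (vscale H) UNIV (+) (*\<^sub>R) \<phi>H"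
    using b comm addH scaleH projV
    by (auto intro!: linear_map_onI simp: fibre_def \<phi>H_def \<gamma>_addH \<gamma>_scale trivialized_add[OF pA tA] trivialized_scale[OF pA tA])
qed

lemma vector_space_H:
  assumes b: "b \<in> carrier (vtotal B)" "vproj B b \<in> U"
  shows "real_vector_space_on (fibre H b) (vadd H) (vzero H b) (vscale H)"
proof (rule real_vector_space_on_transport[where f = \<phi>H])
  have l: "linear_map_on (fibre H b) (vadd H) (vscale H) UNIV (+) (*\<^sub>R) \<phi>H"
    using trivialized_H b by (simp add: trivialized_def)
  \<comment> \<open>The trivialisation has a left inverse on each fibre already at the level of
    sets, so the vector space axioms can be transported.\<close>
  show "inj_on \<phi>H (fibre H b)"
    by (rule inj_on_inverseI[of _ "\<lambda>w. \<iota>H (b, w)"])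
      (use trivialized_H b in \<open>auto simp: trivialized_def fibre_def\<close>)
  show "vzero H b \<in> fibre H b" using zeroH[OF b(1)] by (simp add: fibre_def)
  show "\<phi>H (vzero H b) = 0"
    using zeroH[OF b(1)] \<gamma>_zero(2)[OF b] trivialized_zero[OF bA tA b(2)] by (simp add: \<phi>H_def zero_prod_def)
  show "vadd H x y \<in> fibre H b \<and> \<phi>H (vadd H x y) = \<phi>H x + \<phi>H y" if "x \<in> fibre H b" "y \<in> fibre H b" for x y
    using l that addH[of x y] by (auto simp: linear_map_on_def fibre_def)
  show "vscale H r x \<in> fibre H b \<and> \<phi>H (vscale H r x) = r *\<^sub>R \<phi>H x" if "x \<in> fibre H b" for r x
    using l that scaleH[of x r] by (auto simp: linear_map_on_def fibre_def)
qed

end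

lemma projection_H: "smooth_projection H"
  using sH atD atB by (simp add: smooth_projection_def baseH)

lemma chart_at_H:
  assumes "b \<in> carrier (vtotal B)"
  obtains U and \<alpha> :: "'a \<Rightarrow> 'fa" and \<alpha>i and \<beta> :: "'b \<Rightarrow> 'fb" and \<beta>i and \<gamma> :: "'d \<Rightarrow> 'fc" and \<Psi>
  where "vproj B b \<in> U" "dvb_chart V H A B U \<alpha> \<alpha>i \<beta> \<beta>i \<gamma> \<Psi>"
  using charts[of "vproj B b"] smooth_projectionD(4)[OF pB assms] base by auto

lemma vector_bundle_H: "vector_bundle TYPE('fa \<times> 'fc) H"
  unfolding vector_bundle_def baseH
proof (intro conjI ballI mfd)
  show "smooth_manifold (vtotal B)" using bB by (simp add: vector_bundle_def)
  show "smooth_map (vtotal H) (vtotal B) (vproj H)" using sH by (simp add: smooth_map_iff[OF atD atB(1)])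
  fix b assume b: "b \<in> carrier (vtotal B)"
  obtain U and \<alpha> :: "'a \<Rightarrow> 'fa" and \<alpha>i and \<beta> :: "'b \<Rightarrow> 'fb" and \<beta>i and \<gamma> :: "'d \<Rightarrow> 'fc" and \<Psi>
    where U: "vproj B b \<in> U" and ch: "dvb_chart V H A B U \<alpha> \<alpha>i \<beta> \<beta>i \<gamma> \<Psi>"
    by (rule chart_at_H[OF b])
  show "real_vector_space_on (fibre H b) (vadd H) (vzero H b) (vscale H)"
    by (rule vector_space_H[OF ch b U])
  show "\<exists>U (\<phi> :: 'd \<Rightarrow> 'fa \<times> 'fc). b \<in> U \<and> local_trivialization H U \<phi>"
    using trivialized_imp_local_trivialization[OF projection_H trivialized_H[OF ch]] b U
    by (intro exI[of _ "{b \<in> carrier (vtotal B). vproj B b \<in> U}"] exI) auto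
qed

section \<open>The structure maps as bundle morphisms\<close>

lemma morphism_proj: "vb_morphism H A (vproj V) (vproj B)"
  unfolding vb_morphism_def
proof (intro conjI ballI)
  show "smooth_map (vtotal H) (vtotal A) (vproj V)" using sV by (simp add: smooth_map_iff[OF atD atA(1)])
  show "smooth_map (vbase H) (vbase A) (vproj B)"
    using smooth_projectionD(3)[OF pB] baseH base by (simp add: smooth_map_iff[OF atB])
  show "vproj A (vproj V e) = vproj B (vproj H e)" if "e \<in> carrier (vtotal H)" for e using comm[OF that] .
  fix p assume "p \<in> carrier (vbase H)"
  show "linear_map_on (fibre H p) (vadd H) (vscale H) (fibre A (vproj B p)) (vadd A) (vscale A) (vproj V)"
    using projV comm addH scaleH by (auto intro!: linear_map_onI simp: fibre_def)
qed

lemma chart_at: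
  assumes "d \<in> carrier (vtotal H)"
  obtains U and \<alpha> :: "'a \<Rightarrow> 'fa" and \<alpha>i and \<beta> :: "'b \<Rightarrow> 'fb" and \<beta>i and \<gamma> :: "'d \<Rightarrow> 'fc" and \<Psi>
  where "vproj A (vproj V d) \<in> U" "dvb_chart V H A B U \<alpha> \<alpha>i \<beta> \<beta>i \<gamma> \<Psi>"
  using charts[OF smooth_projectionD(4)[OF pA projV[OF assms]]] by auto

lemma morphism_zero: "vb_morphism A H (vzero V) (vzero B)"
  unfolding vb_morphism_def
proof (intro conjI ballI)
  show "smooth_map (vtotal A) (vtotal H) (vzero V)"
    unfolding smooth_map_iff[OF atA(1) atD]
  proof
    fix a assume a: "a \<in> carrier (vtotal A)"
    obtain U and \<alpha> :: "'a \<Rightarrow> 'fa" and \<alpha>i and \<beta> :: "'b \<Rightarrow> 'fb" and \<beta>i and \<gamma> :: "'d \<Rightarrow> 'fc" and \<Psi>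
      where U: "vproj A a \<in> U" and ch: "dvb_chart V H A B U \<alpha> \<alpha>i \<beta> \<beta>i \<gamma> \<Psi>"
      using charts[OF smooth_projectionD(4)[OF pA a]] by blast
    have 0: "smooth_at (vtotal A) (model_manifold :: ('z::euclidean_model, 'z) manifold) (\<lambda>a. 0) a"
      by (rule smooth_at_const[OF atA(1) smooth_atlas_model a]) simp
    \<comment> \<open>In coordinates the zero section of D \<rightarrow> A has vanishing B- and core
      coordinates.\<close>
    have 1: "smooth_at (vtotal A) (vtotal H) (\<lambda>a. \<Psi> (vproj A a, (\<alpha> a, 0, 0))) a"
      by (rule smooth_at_\<Psi>[OF ch atA(1) smooth_projectionD(3)[OF pA a] U trivialized_smooth[OF pA tA[OF ch] a U] 0 0])
    have eq: "\<Psi> (vproj A e, (\<alpha> e, 0, 0)) = vzero V e" if "e \<in> {e \<in> carrier (vtotal A). vproj A e \<in> U}" for e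
      using \<Psi>_left[OF ch, of "vzero V e"] zeroV[of e] \<gamma>_zero(1)[OF ch, of e] trivialized_zero[OF bB tB[OF ch]] that
      by simp
    show "smooth_at (vtotal A) (vtotal H) (vzero V) a"
      by (rule smooth_at_cong[OF atA(1) 1 openin_over[OF pA U_open[OF ch]] _ eq]) (use a U in auto)
  qed
  show "smooth_map (vbase A) (vbase H) (vzero B)"
    using smooth_at_vzero[OF bB] base baseH by (simp add: smooth_map_iff[OF atB(2,1)])
  show "vproj H (vzero V e) = vzero B (vproj A e)" if "e \<in> carrier (vtotal A)" for e using zeroV[OF that] by simp
  fix p assume p: "p \<in> carrier (vbase A)"
  obtain U and \<alpha> :: "'a \<Rightarrow> 'fa" and \<alpha>i and \<beta> :: "'b \<Rightarrow> 'fb" and \<beta>i and \<gamma> :: "'d \<Rightarrow> 'fc" and \<Psi>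
    where U: "p \<in> U" and ch: "dvb_chart V H A B U \<alpha> \<alpha>i \<beta> \<beta>i \<gamma> \<Psi>"
    using charts[OF p] by blast
  show "linear_map_on (fibre A p) (vadd A) (vscale A) (fibre H (vzero B p)) (vadd H) (vscale H) (vzero V)"
  proof (rule linear_map_onI)
    fix a assume "a \<in> fibre A p"
    then have a: "a \<in> carrier (vtotal A)" "vproj A a = p" by (auto simp: fibre_def)
    show "vzero V a \<in> fibre H (vzero B p)" using zeroV[OF a(1)] a by (simp add: fibre_def)
    {
      fix a' assume "a' \<in> fibre A p"
      then have a': "a' \<in> carrier (vtotal A)" "vproj A a' = p" by (auto simp: fibre_def)
      have s: "vadd A a a' \<in> carrier (vtotal A)" "vproj A (vadd A a a') = p"
        using vector_bundle_fibre(1)[OF bA a(1) a'(1)] a a' by auto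
      have h: "vproj H (vzero V a) = vproj H (vzero V a')" using zeroV[OF a(1)] zeroV[OF a'(1)] a a' by simp
      note z = zeroV[OF a(1)] zeroV[OF a'(1)] zeroV[OF s(1)]
      show "vzero V (vadd A a a') = vadd H (vzero V a) (vzero V a')"
        by (rule chart_eqI[OF ch])
          (use z addH[of "vzero V a" "vzero V a'"] h a a' s U in \<open>simp_all add: \<gamma>_zero[OF ch] \<gamma>_addH[OF ch]\<close>)
    }
    fix r
    have s: "vscale A r a \<in> carrier (vtotal A)" "vproj A (vscale A r a) = p"
      using vector_bundle_fibre(2)[OF bA a(1)] a by auto
    note z = zeroV[OF a(1)] zeroV[OF s(1)]
    show "vzero V (vscale A r a) = vscale H r (vzero V a)"
      by (rule chart_eqI[OF ch])
        (use z scaleH[of "vzero V a" r] a s U in \<open>simp_all add: \<gamma>_zero[OF ch] \<gamma>_scale[OF ch]\<close>)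
  qed
qed

lemma morphism_scale: "vb_morphism H H (vscale V r) (vscale B r)"
  unfolding vb_morphism_def
proof (intro conjI ballI)
  show "smooth_map (vtotal H) (vtotal H) (vscale V r)"
    unfolding smooth_map_iff[OF atD atD]
  proof
    fix d assume d: "d \<in> carrier (vtotal H)"
    obtain U and \<alpha> :: "'a \<Rightarrow> 'fa" and \<alpha>i and \<beta> :: "'b \<Rightarrow> 'fb" and \<beta>i and \<gamma> :: "'d \<Rightarrow> 'fc" and \<Psi>
      where U: "vproj A (vproj V d) \<in> U" and ch: "dvb_chart V H A B U \<alpha> \<alpha>i \<beta> \<beta>i \<gamma> \<Psi>"
      by (rule chart_at[OF d])
    have l1: "linear ((*\<^sub>R) r :: 'fb \<Rightarrow> 'fb)" and l2: "linear ((*\<^sub>R) r :: 'fc \<Rightarrow> 'fc)"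
      by (simp_all add: linear_iff scaleR_add_right)
    \<comment> \<open>Scaling over A keeps the A-coordinate and multiplies the B- and core
      coordinates.\<close>
    have 1: "smooth_at (vtotal H) (vtotal H) (\<lambda>d. \<Psi> (vproj A (vproj V d), (\<alpha> (vproj V d), r *\<^sub>R \<beta> (vproj H d), r *\<^sub>R \<gamma> d))) d"
      by (rule smooth_at_\<Psi>[OF ch atD smooth_proj_base[OF d] U smooth_coords(1)[OF ch d U]
            smooth_at_model_linear[OF atD smooth_coords(2)[OF ch d U] l1] smooth_at_model_linear[OF atD \<gamma>_smooth[OF ch d U] l2]])
    have eq: "\<Psi> (vproj A (vproj V e), (\<alpha> (vproj V e), r *\<^sub>R \<beta> (vproj H e), r *\<^sub>R \<gamma> e)) = vscale V r e"
      if "e \<in> overU U" for e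
    proof -
      have e: "e \<in> carrier (vtotal H)" "vproj A (vproj V e) \<in> U" using that by (auto simp: overU_def[OF ch])
      have "\<beta> (vscale B r (vproj H e)) = r *\<^sub>R \<beta> (vproj H e)"
        using e comm by (intro trivialized_scale[OF pB tB[OF ch]] projH) auto
      then show ?thesis
        using \<Psi>_left[OF ch, of "vscale V r e"] scaleV[OF e(1), of r] \<gamma>_scale(1)[OF ch e, of r] e by simp
    qed
    show "smooth_at (vtotal H) (vtotal H) (vscale V r) d"
      by (rule smooth_at_cong[OF atD 1 overU_open[OF ch] _ eq]) (use d U in \<open>auto simp: overU_def[OF ch]\<close>)
  qed
  show "smooth_map (vbase H) (vbase H) (vscale B r)"
    using smooth_at_vscale[OF bB] by (simp add: baseH smooth_map_iff[OF atB(1,1)])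
  show "vproj H (vscale V r e) = vscale B r (vproj H e)" if "e \<in> carrier (vtotal H)" for e using scaleV[OF that] by simp
  fix b assume "b \<in> carrier (vbase H)"
  then have b: "b \<in> carrier (vtotal B)" by (simp add: baseH)
  obtain U and \<alpha> :: "'a \<Rightarrow> 'fa" and \<alpha>i and \<beta> :: "'b \<Rightarrow> 'fb" and \<beta>i and \<gamma> :: "'d \<Rightarrow> 'fc" and \<Psi>
    where U: "vproj B b \<in> U" and ch: "dvb_chart V H A B U \<alpha> \<alpha>i \<beta> \<beta>i \<gamma> \<Psi>"
    by (rule chart_at_H[OF b])
  show "linear_map_on (fibre H b) (vadd H) (vscale H) (fibre H (vscale B r b)) (vadd H) (vscale H) (vscale V r)"
  proof (rule linear_map_onI)
    fix d assume "d \<in> fibre H b"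
    then have d: "d \<in> carrier (vtotal H)" "vproj H d = b" "vproj A (vproj V d) \<in> U" using comm U by (auto simp: fibre_def)
    show "vscale V r d \<in> fibre H (vscale B r b)" using scaleV[OF d(1)] d by (simp add: fibre_def)
    {
      fix d' assume "d' \<in> fibre H b"
      then have d': "d' \<in> carrier (vtotal H)" "vproj H d' = b" "vproj A (vproj V d') \<in> U" using comm U by (auto simp: fibre_def)
      note s = scaleV[OF d(1), of r] scaleV[OF d'(1), of r]
      have a: "vadd H d d' \<in> carrier (vtotal H)" "vproj H (vadd H d d') = b" "vproj V (vadd H d d') = vadd A (vproj V d) (vproj V d')"
        using addH[OF d(1) d'(1)] d d' by auto
      have aU: "vproj A (vadd A (vproj V d) (vproj V d')) \<in> U" using comm[OF a(1)] a U by simp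
      note sa = scaleV[OF a(1), of r]
      show "vscale V r (vadd H d d') = vadd H (vscale V r d) (vscale V r d')"
        by (rule chart_eqI[OF ch])
          (use s a sa addH[of "vscale V r d" "vscale V r d'"] d d' U aU in
           \<open>simp_all add: \<gamma>_scale[OF ch] \<gamma>_addH[OF ch] scaleR_add_right\<close>)
    }
    fix s
    note s = scaleV[OF d(1), of r]
    have a: "vscale H s d \<in> carrier (vtotal H)" "vproj H (vscale H s d) = b" "vproj V (vscale H s d) = vscale A s (vproj V d)"
      using scaleH[OF d(1)] d by auto
    have aU: "vproj A (vscale A s (vproj V d)) \<in> U" using comm[OF a(1)] a U by simp
    note sa = scaleV[OF a(1), of r]
    show "vscale V r (vscale H s d) = vscale H s (vscale V r d)"
      by (rule chart_eqI[OF ch])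
        (use s a sa scaleH[of "vscale V r d" s] d U aU in \<open>simp_all add: \<gamma>_scale[OF ch] mult.commute\<close>)
  qed
qed

lemma vproj_prod: "vproj (prod_vbundle E E') = map_prod (vproj E) (vproj E')"
  and vtotal_prod: "vtotal (prod_vbundle E E') = prod_manifold (vtotal E) (vtotal E')"
  and vbase_prod: "vbase (prod_vbundle E E') = prod_manifold (vbase E) (vbase E')"
  by (simp_all add: prod_vbundle_def)

text \<open>In the product of two copies of a trivialisation of \<open>H\<close>, a pair has equal
  projections to A exactly when it lies over the fibre product of B with itself and its
  A-coordinates agree; the latter is a linear condition on the typical fibre.\<close>

lemma subbundle: "vector_subbundle TYPE(('fa \<times> 'fc) \<times> ('fa \<times> 'fc)) (prod_vbundle H H) (fibre_product V V) (fibre_product B B)"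
  unfolding vector_subbundle_def
proof (intro conjI)
  show "embedded_subset (vbase (prod_vbundle H H)) (fibre_product B B)"
    using embedded_fibre_product[OF bB] by (simp add: vbase_prod baseH)
  show "fibre_product V V \<subseteq> carrier (vtotal (prod_vbundle H H))"
    by (auto simp: fibre_product_def vtotal_prod tot)
  show "vproj (prod_vbundle H H) ` fibre_product V V \<subseteq> fibre_product B B"
  proof (rule image_subsetI)
    fix e assume "e \<in> fibre_product V V"
    then obtain d d' where "e = (d, d')" "d \<in> carrier (vtotal H)" "d' \<in> carrier (vtotal H)" "vproj V d = vproj V d'"
      by (auto simp: fibre_product_def tot)
    then show "vproj (prod_vbundle H H) e \<in> fibre_product B B"
      using comm[of d] comm[of d'] by (simp add: fibre_product_def vproj_prod projH)
  qed
  define L :: "(('fa \<times> 'fc) \<times> ('fa \<times> 'fc)) set" where "L = {w. fst (fst w) = fst (snd w)}"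
  show "\<exists>L. subspace L \<and> (\<forall>p\<in>fibre_product B B. \<exists>U (\<phi> :: 'd \<times> 'd \<Rightarrow> ('fa \<times> 'fc) \<times> ('fa \<times> 'fc)).
      p \<in> U \<and> local_trivialization (prod_vbundle H H) U \<phi> \<and>
      {e \<in> fibre_product V V. vproj (prod_vbundle H H) e \<in> U}
        = {e \<in> carrier (vtotal (prod_vbundle H H)). vproj (prod_vbundle H H) e \<in> fibre_product B B \<inter> U \<and> \<phi> e \<in> L})"
  proof (intro exI[of _ L] conjI ballI)
    show "subspace L" by (auto simp: L_def subspace_def)
    fix p assume "p \<in> fibre_product B B"
    then have p: "fst p \<in> carrier (vtotal B)" "snd p \<in> carrier (vtotal B)" "vproj B (fst p) = vproj B (snd p)"
      by (auto simp: fibre_product_def)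
    obtain U and \<alpha> :: "'a \<Rightarrow> 'fa" and \<alpha>i and \<beta> :: "'b \<Rightarrow> 'fb" and \<beta>i and \<gamma> :: "'d \<Rightarrow> 'fc" and \<Psi>
      where U: "vproj B (fst p) \<in> U" and ch: "dvb_chart V H A B U \<alpha> \<alpha>i \<beta> \<beta>i \<gamma> \<Psi>"
      by (rule chart_at_H[OF p(1)])
    let ?U = "{b \<in> carrier (vtotal B). vproj B b \<in> U}" and ?\<phi> = "\<phi>H \<alpha> \<gamma>"
    note t = trivialized_H[OF ch]
    \<comment> \<open>The same chart serves both factors, since the two entries of \<open>p\<close>
      lie over one point of the base.\<close>
    have lt: "local_trivialization (prod_vbundle H H) (?U \<times> ?U) (map_prod ?\<phi> ?\<phi>)"
      by (rule trivialized_imp_local_trivialization[OF smooth_projection_prod[OF projection_H projection_H]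
            trivialized_prod[OF projection_H projection_H t t]])
    have eq: "(d, d') \<in> fibre_product V V \<longleftrightarrow> vproj B (vproj H d) = vproj B (vproj H d') \<and> map_prod ?\<phi> ?\<phi> (d, d') \<in> L"
      if d: "d \<in> carrier (vtotal H)" "d' \<in> carrier (vtotal H)" "vproj H d \<in> ?U" "vproj H d' \<in> ?U" for d d'
    proof -
      have "vproj V d = vproj V d'"
        if "vproj B (vproj H d) = vproj B (vproj H d')" "\<alpha> (vproj V d) = \<alpha> (vproj V d')"
        using that d trivialized_left[OF pA tA[OF ch] projV[OF d(1)]] trivialized_left[OF pA tA[OF ch] projV[OF d(2)]]
        by (simp add: comm)
      moreover have "vproj B (vproj H d) = vproj B (vproj H d')" if "vproj V d = vproj V d'"
        using that comm d by metis
      ultimately show ?thesis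
        using d by (auto simp: fibre_product_def L_def \<phi>H_def[OF ch] tot)
    qed
    show "\<exists>U (\<phi> :: 'd \<times> 'd \<Rightarrow> ('fa \<times> 'fc) \<times> ('fa \<times> 'fc)).
      p \<in> U \<and> local_trivialization (prod_vbundle H H) U \<phi> \<and>
      {e \<in> fibre_product V V. vproj (prod_vbundle H H) e \<in> U}
        = {e \<in> carrier (vtotal (prod_vbundle H H)). vproj (prod_vbundle H H) e \<in> fibre_product B B \<inter> U \<and> \<phi> e \<in> L}"
    proof (intro exI conjI)
      show "local_trivialization (prod_vbundle H H) (?U \<times> ?U) (map_prod ?\<phi> ?\<phi>)" by (rule lt)
      show "p \<in> ?U \<times> ?U" using p U by (cases p) auto
      show "{e \<in> fibre_product V V. vproj (prod_vbundle H H) e \<in> ?U \<times> ?U}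
        = {e \<in> carrier (vtotal (prod_vbundle H H)). vproj (prod_vbundle H H) e \<in> fibre_product B B \<inter> ?U \<times> ?U \<and> map_prod ?\<phi> ?\<phi> e \<in> L}"
        (is "?l = ?r")
      proof (intro set_eqI)
        fix e :: "'d \<times> 'd"
        obtain d d' where e: "e = (d, d')" by (cases e)
        show "e \<in> ?l \<longleftrightarrow> e \<in> ?r"
        proof (cases "d \<in> carrier (vtotal H) \<and> d' \<in> carrier (vtotal H) \<and> vproj H d \<in> ?U \<and> vproj H d' \<in> ?U")
          case True
          then show ?thesis
            using eq[of d d'] unfolding e by (auto simp: vproj_prod vtotal_prod fibre_product_def)
        next
          case False
          then show ?thesis unfolding e by (auto simp: vproj_prod vtotal_prod fibre_product_def tot)
        qed
      qed
    qed
  qed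
qed

text \<open>The interchange law. Each side has projections obtained by one addition in A and one in
  B, and \<gamma> sends both sides to the sum of the same four vectors.\<close>

lemma interchange_add:
  assumes d: "d1 \<in> carrier (vtotal H)" "d2 \<in> carrier (vtotal H)" "d1' \<in> carrier (vtotal H)" "d2' \<in> carrier (vtotal H)"
    and v: "vproj V d1 = vproj V d1'" "vproj V d2 = vproj V d2'" and h: "vproj H d1 = vproj H d2" "vproj H d1' = vproj H d2'"
  shows "vadd V (vadd H d1 d2) (vadd H d1' d2') = vadd H (vadd V d1 d1') (vadd V d2 d2')"
proof -
  obtain U and \<alpha> :: "'a \<Rightarrow> 'fa" and \<alpha>i and \<beta> :: "'b \<Rightarrow> 'fb" and \<beta>i and \<gamma> :: "'d \<Rightarrow> 'fc" and \<Psi>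
    where U: "vproj A (vproj V d1) \<in> U" and ch: "dvb_chart V H A B U \<alpha> \<alpha>i \<beta> \<beta>i \<gamma> \<Psi>"
    by (rule chart_at[OF d(1)])
  note H12 = addH[OF d(1,2) h(1)] addH[OF d(3,4) h(2)]
  note V12 = addV[OF d(1,3) v(1)] addV[OF d(2,4) v(2)]
  have U2: "vproj A (vproj V d2) \<in> U" using U comm[OF d(1)] comm[OF d(2)] h by simp
  have U1': "vproj A (vproj V d1') \<in> U" "vproj A (vproj V d2') \<in> U" using U U2 v by simp_all
  \<comment> \<open>The sum taken in A still lies over \<open>U\<close>, because the sum in D has
    the same projection to B as its summands.\<close>
  have UH: "vproj A (vadd A (vproj V d1) (vproj V d2)) \<in> U"
    using comm[of "vadd H d1 d2"] H12 U comm[OF d(1)] by simp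
  have VH: "vproj V (vadd H d1 d2) = vproj V (vadd H d1' d2')" using H12 v by simp
  have HV: "vproj H (vadd V d1 d1') = vproj H (vadd V d2 d2')" using V12 h by simp
  have "vadd V (vadd H d1 d2) (vadd H d1' d2') \<in> carrier (vtotal H) \<and>
      vproj V (vadd V (vadd H d1 d2) (vadd H d1' d2')) = vproj V (vadd H d1 d2) \<and>
      vproj H (vadd V (vadd H d1 d2) (vadd H d1' d2')) = vadd B (vproj H (vadd H d1 d2)) (vproj H (vadd H d1' d2'))"
    using H12 by (intro addV VH) auto
  moreover have "vadd H (vadd V d1 d1') (vadd V d2 d2') \<in> carrier (vtotal H) \<and>
      vproj H (vadd H (vadd V d1 d1') (vadd V d2 d2')) = vproj H (vadd V d1 d1') \<and>
      vproj V (vadd H (vadd V d1 d1') (vadd V d2 d2')) = vadd A (vproj V (vadd V d1 d1')) (vproj V (vadd V d2 d2'))"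
    using V12 by (intro addH HV) auto
  moreover have "\<gamma> (vadd V (vadd H d1 d2) (vadd H d1' d2')) = \<gamma> d1 + \<gamma> d2 + (\<gamma> d1' + \<gamma> d2')"
    using \<gamma>_addV[OF ch, of "vadd H d1 d2" "vadd H d1' d2'"] VH H12 UH \<gamma>_addH[OF ch d(1,2) h(1) U] \<gamma>_addH[OF ch d(3,4) h(2) U1'(1)]
    by simp
  moreover have "\<gamma> (vadd H (vadd V d1 d1') (vadd V d2 d2')) = \<gamma> d1 + \<gamma> d1' + (\<gamma> d2 + \<gamma> d2')"
    using \<gamma>_addH[OF ch, of "vadd V d1 d1'" "vadd V d2 d2'"] HV V12 U \<gamma>_addV[OF ch d(1,3) v(1) U] \<gamma>_addV[OF ch d(2,4) v(2) U2]
    by simp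
  ultimately show ?thesis
    by (intro chart_eqI[OF ch]) (use H12 V12 UH in \<open>simp_all add: add_ac\<close>)
qed

lemma interchange_scale:
  assumes d: "d1 \<in> carrier (vtotal H)" "d1' \<in> carrier (vtotal H)" and v: "vproj V d1 = vproj V d1'"
  shows "vadd V (vscale H r d1) (vscale H r d1') = vscale H r (vadd V d1 d1')"
proof -
  obtain U and \<alpha> :: "'a \<Rightarrow> 'fa" and \<alpha>i and \<beta> :: "'b \<Rightarrow> 'fb" and \<beta>i and \<gamma> :: "'d \<Rightarrow> 'fc" and \<Psi>
    where U: "vproj A (vproj V d1) \<in> U" and ch: "dvb_chart V H A B U \<alpha> \<alpha>i \<beta> \<beta>i \<gamma> \<Psi>"
    by (rule chart_at[OF d(1)])
  note S = scaleH[OF d(1), of r] scaleH[OF d(2), of r]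
  note V12 = addV[OF d v]
  note SV = scaleH[of "vadd V d1 d1'" r]
  have UH: "vproj A (vscale A r (vproj V d1)) \<in> U"
    using comm[of "vscale H r d1"] S U comm[OF d(1)] by simp
  have VS: "vproj V (vscale H r d1) = vproj V (vscale H r d1')" using S v by simp
  have hb: "vproj B (vproj H d1) = vproj B (vproj H d1')" using comm[OF d(1)] comm[OF d(2)] v by simp
  have "vadd V (vscale H r d1) (vscale H r d1') \<in> carrier (vtotal H) \<and>
      vproj V (vadd V (vscale H r d1) (vscale H r d1')) = vproj V (vscale H r d1) \<and>
      vproj H (vadd V (vscale H r d1) (vscale H r d1')) = vadd B (vproj H (vscale H r d1)) (vproj H (vscale H r d1'))"
    using S by (intro addV VS) auto
  moreover have "\<gamma> (vadd V (vscale H r d1) (vscale H r d1')) = r *\<^sub>R \<gamma> d1 + r *\<^sub>R \<gamma> d1'"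
    using \<gamma>_addV[OF ch, of "vscale H r d1" "vscale H r d1'"] VS S UH \<gamma>_scale(2)[OF ch d(1) U] \<gamma>_scale(2)[OF ch d(2)] v U by simp
  moreover have "\<gamma> (vscale H r (vadd V d1 d1')) = r *\<^sub>R (\<gamma> d1 + \<gamma> d1')"
    using \<gamma>_scale(2)[OF ch, of "vadd V d1 d1'"] V12 U \<gamma>_addV[OF ch d v U] by simp
  ultimately show ?thesis
    by (intro chart_eqI[OF ch]) (use S V12 SV UH in \<open>simp_all add: scaleR_add_right\<close>)
qed

text \<open>Linearity over the addition of B consists of the two interchange laws; smoothness calls
  for an extension beyond the fibre product.\<close>

lemma morphism_add: "vb_morphism_on (prod_vbundle H H) (fibre_product V V) (fibre_product B B) H
   (\<lambda>(d, d'). vadd V d d') (\<lambda>(b, b'). vadd B b b')"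
  unfolding vb_morphism_on_def vtotal_prod vbase_prod
proof (intro conjI ballI)
  let ?N = "prod_manifold (vtotal H) (vtotal H)"
  have P: "smooth_atlas ?N" using atD by simp
  show "smooth_map_on ?N (fibre_product V V) (vtotal H) (\<lambda>(d, d'). vadd V d d')"
  proof (rule smooth_map_onI[OF P atD])
    show "fibre_product V V \<subseteq> carrier ?N" by (auto simp: fibre_product_def tot)
    fix p assume "p \<in> fibre_product V V"
    then have p: "fst p \<in> carrier (vtotal H)" "snd p \<in> carrier (vtotal H)" "vproj V (fst p) = vproj V (snd p)"
      by (auto simp: fibre_product_def tot)
    obtain U and \<alpha> :: "'a \<Rightarrow> 'fa" and \<alpha>i and \<beta> :: "'b \<Rightarrow> 'fb" and \<beta>i and \<gamma> :: "'d \<Rightarrow> 'fc" and \<Psi>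
      where U: "vproj A (vproj V (fst p)) \<in> U" and ch: "dvb_chart V H A B U \<alpha> \<alpha>i \<beta> \<beta>i \<gamma> \<Psi>"
      by (rule chart_at[OF p(1)])
    let ?W = "overU U \<times> overU U"
    \<comment> \<open>A smooth extension to pairs with different projections to A: the base point
      and A-coordinate are those of the first entry, the B- and core coordinates are added.\<close>
    let ?g = "\<lambda>q. \<Psi> (vproj A (vproj V (fst q)), (\<alpha> (vproj V (fst q)), \<beta> (vproj H (fst q)) + \<beta> (vproj H (snd q)), \<gamma> (fst q) + \<gamma> (snd q)))"
    have s: "smooth_at ?N (vtotal H) ?g q" if "q \<in> ?W" for q
    proof -
      have q: "fst q \<in> carrier (vtotal H)" "vproj A (vproj V (fst q)) \<in> U" "snd q \<in> carrier (vtotal H)" "vproj A (vproj V (snd q)) \<in> U"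
        using that by (auto simp: overU_def[OF ch])
      then have q': "q \<in> carrier (vtotal H) \<times> carrier (vtotal H)" by (cases q) auto
      note f = smooth_at_fst_snd[OF atD atD q']
      note c1 = smooth_at_compose[OF P atD smooth_atlas_model f(1)] and c2 = smooth_at_compose[OF P atD smooth_atlas_model f(2)]
      note k1 = smooth_coords[OF ch q(1,2)] and k2 = smooth_coords[OF ch q(3,4)]
      note g1 = \<gamma>_smooth[OF ch q(1,2)] and g2 = \<gamma>_smooth[OF ch q(3,4)]
      have x: "smooth_at ?N (vbase A) (\<lambda>q. vproj A (vproj V (fst q))) q"
        by (rule smooth_at_compose[OF P atD atA(2) f(1) smooth_proj_base[OF q(1)]])
      show ?thesis
        by (rule smooth_at_\<Psi>[OF ch P x q(2) c1[OF k1(1)] smooth_at_model_add[OF P c1[OF k1(2)] c2[OF k2(2)]]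
              smooth_at_model_add[OF P c1[OF g1] c2[OF g2]]])
    qed
    have eq: "?g q = (\<lambda>(d, d'). vadd V d d') q" if "q \<in> ?W \<inter> fibre_product V V" for q
    proof -
      obtain d d' where q: "q = (d, d')" by (cases q)
      have d: "d \<in> carrier (vtotal H)" "vproj A (vproj V d) \<in> U" "d' \<in> carrier (vtotal H)" "vproj V d = vproj V d'"
        using that unfolding q by (auto simp: overU_def[OF ch] fibre_product_def)
      have "\<beta> (vadd B (vproj H d) (vproj H d')) = \<beta> (vproj H d) + \<beta> (vproj H d')"
        using comm[OF d(1)] comm[OF d(3)] d by (intro trivialized_add[OF pB tB[OF ch]] projH) auto
      then show ?thesis
        using \<Psi>_left[OF ch, of "vadd V d d'"] addV[OF d(1,3,4)] \<gamma>_addV[OF ch d(1,3,4,2)] d(2) by (simp add: q)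
    qed
    show "\<exists>W g. openin (mtop ?N) W \<and> p \<in> W \<and> (\<forall>x\<in>W. smooth_at ?N (vtotal H) g x) \<and>
        (\<forall>x\<in>W \<inter> fibre_product V V. g x = (\<lambda>(d, d'). vadd V d d') x)"
    proof (intro exI conjI)
      show "openin (mtop ?N) ?W" by (rule openin_Times_prod[OF overU_open[OF ch] overU_open[OF ch]])
      show "p \<in> ?W" using p U by (cases p) (auto simp: overU_def[OF ch])
    qed (use s eq in blast)+
  qed
  show "smooth_map_on (prod_manifold (vbase H) (vbase H)) (fibre_product B B) (vbase H) (\<lambda>(b, b'). vadd B b b')"
    using smooth_map_on_vadd[OF bB] by (simp add: baseH)
  show "vproj H (case e of (d, d') \<Rightarrow> vadd V d d') = (case vproj (prod_vbundle H H) e of (b, b') \<Rightarrow> vadd B b b')"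
    if "e \<in> fibre_product V V" for e
    using that addV by (auto simp: fibre_product_def vproj_prod tot)
  fix p assume "p \<in> fibre_product B B"
  obtain b b' where p: "p = (b, b')" by (cases p)
  have mem: "e \<in> fibre (prod_vbundle H H) p \<inter> fibre_product V V \<longleftrightarrow>
      (\<exists>d d'. e = (d, d') \<and> d \<in> carrier (vtotal H) \<and> d' \<in> carrier (vtotal H) \<and> vproj H d = b \<and> vproj H d' = b' \<and> vproj V d = vproj V d')" for e
    unfolding p by (cases e) (auto simp: fibre_def fibre_product_def vproj_prod vtotal_prod tot)
  show "linear_map_on (fibre (prod_vbundle H H) p \<inter> fibre_product V V) (vadd (prod_vbundle H H)) (vscale (prod_vbundle H H))
     (fibre H (case p of (b, b') \<Rightarrow> vadd B b b')) (vadd H) (vscale H) (\<lambda>(d, d'). vadd V d d')"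
  proof (rule linear_map_onI)
    fix e assume "e \<in> fibre (prod_vbundle H H) p \<inter> fibre_product V V"
    then obtain d d' where e: "e = (d, d')" and d: "d \<in> carrier (vtotal H)" "d' \<in> carrier (vtotal H)"
      "vproj H d = b" "vproj H d' = b'" "vproj V d = vproj V d'" unfolding mem by blast
    show "(case e of (d, d') \<Rightarrow> vadd V d d') \<in> fibre H (case p of (b, b') \<Rightarrow> vadd B b b')"
      using addV[OF d(1,2,5)] d by (simp add: e p fibre_def)
    {
      fix f assume "f \<in> fibre (prod_vbundle H H) p \<inter> fibre_product V V"
      then obtain d2 d2' where f: "f = (d2, d2')" and d2: "d2 \<in> carrier (vtotal H)" "d2' \<in> carrier (vtotal H)"
        "vproj H d2 = b" "vproj H d2' = b'" "vproj V d2 = vproj V d2'" unfolding mem by blast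
      show "(case vadd (prod_vbundle H H) e f of (d, d') \<Rightarrow> vadd V d d') =
         vadd H (case e of (d, d') \<Rightarrow> vadd V d d') (case f of (d, d') \<Rightarrow> vadd V d d')"
        using interchange_add[OF d(1) d2(1) d(2) d2(2) d(5) d2(5)] d d2 by (simp add: e f prod_vbundle_def)
    }
    show "(case vscale (prod_vbundle H H) r e of (d, d') \<Rightarrow> vadd V d d') = vscale H r (case e of (d, d') \<Rightarrow> vadd V d d')" for r
      using interchange_scale[OF d(1,2,5)] by (simp add: e prod_vbundle_def)
  qed
qed

lemma structure_maps: "structure_maps_morphisms TYPE('fa \<times> 'fc) V H A B"
  unfolding structure_maps_morphisms_def
  by (intro conjI allI morphism_proj morphism_zero subbundle morphism_add morphism_scale)

end

text \<open>The conditions on \<gamma> are symmetric in the two structures; only the A- and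
  B-arguments of \<Psi> have to be permuted, which is a linear map of model spaces.\<close>

lemma dvb_chart_swap:
  fixes V :: "('d, 'ed::euclidean_model, 'a, 'ea::euclidean_model) vbundle"
    and A :: "('a, 'ea, 'm, 'em::euclidean_model) vbundle"
    and \<alpha> :: "'a \<Rightarrow> 'fa::euclidean_model" and \<beta> :: "'b \<Rightarrow> 'fb::euclidean_model" and \<gamma> :: "'d \<Rightarrow> 'fc::euclidean_model"
  assumes ch: "dvb_chart V H A B U \<alpha> \<alpha>i \<beta> \<beta>i \<gamma> \<Psi>" and tot: "vtotal V = vtotal H" and base: "vbase A = vbase B"
    and at: "smooth_atlas (vtotal H)" "smooth_atlas (vbase A)"
    and comm: "\<And>d. d \<in> carrier (vtotal H) \<Longrightarrow> vproj A (vproj V d) = vproj B (vproj H d)"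
  shows "dvb_chart H V B A U \<beta> \<beta>i \<alpha> \<alpha>i \<gamma> (\<lambda>z. \<Psi> (fst z, (fst (snd (snd z)), fst (snd z), snd (snd (snd z)))))"
proof -
  let ?M1 = "model_manifold :: ('fb \<times> 'fa \<times> 'fc, 'fb \<times> 'fa \<times> 'fc) manifold"
  let ?M2 = "model_manifold :: ('fa \<times> 'fb \<times> 'fc, 'fa \<times> 'fb \<times> 'fc) manifold"
  have "smooth_at (prod_manifold (vbase B) ?M1) (vtotal H) (\<lambda>z. \<Psi> (fst z, (fst (snd (snd z)), fst (snd z), snd (snd (snd z))))) (x, (v, u, c))"
    if x: "x \<in> U" for x u v c
  proof -
    have "openin (mtop (vbase A)) U" using ch by (simp add: dvb_chart_def trivialized_def)
    then have "x \<in> carrier (vbase A)" using x openin_subset by blast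
    then have xc: "(x, (v, u, c)) \<in> carrier (vbase A) \<times> carrier ?M1" by simp
    have P: "smooth_atlas (prod_manifold (vbase A) ?M1)" "smooth_atlas (prod_manifold (vbase A) ?M2)" using at by auto
    note f = smooth_at_fst_snd[OF at(2) smooth_atlas_model xc]
    have l: "linear (\<lambda>w :: 'fb \<times> 'fa \<times> 'fc. (fst (snd w), fst w, snd (snd w)))" by (simp add: linear_iff)
    have 1: "smooth_at (prod_manifold (vbase A) ?M1) (prod_manifold (vbase A) ?M2)
        (\<lambda>z. (fst z, (fst (snd (snd z)), fst (snd z), snd (snd (snd z))))) (x, (v, u, c))"
      by (rule smooth_at_Pair[OF P(1) at(2) smooth_atlas_model f(1) smooth_at_model_linear[OF P(1) f(2) l]])
    have 2: "smooth_at (prod_manifold (vbase A) ?M2) (vtotal H) \<Psi>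
       (fst (x, (v, u, c)), (fst (snd (snd (x, (v, u, c)))), fst (snd (x, (v, u, c))), snd (snd (snd (x, (v, u, c))))))"
      using ch x by (simp add: dvb_chart_def)
    show ?thesis unfolding base[symmetric] by (rule smooth_at_compose[OF P at(1) 1 2])
  qed
  then show ?thesis
    using ch tot comm unfolding dvb_chart_def by simp blast
qed

lemma (in dvb_data) swap: "dvb_data TYPE('fc) H V B A"
proof (unfold_locales, goal_cases)
  \<comment> \<open>Goal 17 is the assumption \<open>charts\<close>; the other assumptions are
    self-symmetric or exchanged in pairs.\<close>
  case (17 x)
  then obtain U \<alpha> \<alpha>i \<beta> \<beta>i \<gamma> \<Psi> where "x \<in> U" and ch: "dvb_chart V H A B U (\<alpha> :: 'a \<Rightarrow> 'fa) \<alpha>i (\<beta> :: 'b \<Rightarrow> 'fb) \<beta>i (\<gamma> :: 'd \<Rightarrow> 'fc) \<Psi>"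
    using charts[of x] base by auto
  then show ?case using dvb_chart_swap[OF ch tot base atD atA(2) comm] by blast
qed (use bA bB tot baseV baseH base mfd sV sH comm addV addH scaleV scaleH zeroV zeroH in \<open>simp_all\<close>)

theorem (in dvb_data) double_vector_bundle:
  "double_vector_bundle TYPE('fb \<times> 'fc) TYPE('fa \<times> 'fc) TYPE('fa) TYPE('fb) V H A B"
  unfolding double_vector_bundle_def
  using bA bB tot baseV baseH base comm vector_bundle_H structure_maps
    dvb_data.vector_bundle_H[OF swap] dvb_data.structure_maps[OF swap]
  by simp

subsection \<open>Local splittings of the sequence\<close>

text \<open>Adding a negative of \<open>e\<close> to both sides leaves \<open>e\<close> equal to
  zero. It shows that fibrewise additive maps preserve zero.\<close>

lemma vector_bundle_double_eq_self:
  assumes E: "vector_bundle F E" and e: "e \<in> fibre E p" "p \<in> carrier (vbase E)" "vadd E e e = e"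
  shows "e = vzero E p"
proof -
  have v: "real_vector_space_on (fibre E p) (vadd E) (vzero E p) (vscale E)"
    using E e(2) by (simp add: vector_bundle_def)
  then have "\<forall>x\<in>fibre E p. \<exists>y\<in>fibre E p. vadd E x y = vzero E p"
    unfolding real_vector_space_on_def by (elim conjE)
  then obtain y where y: "y \<in> fibre E p" "vadd E e y = vzero E p" using e(1) by blast
  have z: "vzero E p \<in> fibre E p" "vadd E (vzero E p) e = e" "vadd E e (vzero E p) = vadd E (vzero E p) e"
    using v e(1) unfolding real_vector_space_on_def by auto
  have "vadd E (vadd E e e) y = vadd E e (vadd E e y)"
    using v e(1) y(1) unfolding real_vector_space_on_def by auto
  then show ?thesis using y e(3) z by simp
qed

lemma linear_map_on_vzero:
  assumes E: "vector_bundle F E" "p \<in> carrier (vbase E)" and E': "vector_bundle F' E'" "p' \<in> carrier (vbase E')"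
    and f: "linear_map_on (fibre E p) (vadd E) (vscale E) (fibre E' p') (vadd E') (vscale E') f"
  shows "f (vzero E p) = vzero E' p'"
proof -
  have z: "vzero E p \<in> fibre E p" using vector_bundle_fibre(3)[OF E] by (simp add: fibre_def)
  have "f (vadd E (vzero E p) (vzero E p)) = vadd E' (f (vzero E p)) (f (vzero E p))"
    using f z by (simp add: linear_map_on_def)
  then show ?thesis
    using f z vector_bundle_fibre(4)[OF E]
    by (intro vector_bundle_double_eq_self[OF E'(1) _ E'(2)]) (auto simp: linear_map_on_def)
qed

lemma trivialized_inv_linear:
  assumes E: "vector_bundle F E" and t: "trivialized E U \<phi> \<iota>" and x: "x \<in> U"
  shows "\<iota> (x, u + v) = vadd E (\<iota> (x, u)) (\<iota> (x, v))" "\<iota> (x, r *\<^sub>R u) = vscale E r (\<iota> (x, u))"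
    and "\<iota> (x, 0) = vzero E x"
proof -
  note pr = vector_bundle_smooth_projection[OF E]
  note c = trivialized_inv_carrier[OF pr t x] and rt = trivialized_right[OF pr t x]
  have a: "vadd E (\<iota> (x, u)) (\<iota> (x, v)) \<in> carrier (vtotal E)" "vproj E (vadd E (\<iota> (x, u)) (\<iota> (x, v))) = x"
    using vector_bundle_fibre(1)[OF E c c] rt by auto
  show "\<iota> (x, u + v) = vadd E (\<iota> (x, u)) (\<iota> (x, v))"
    using trivialized_left[OF pr t a(1)] trivialized_add[OF pr t c c] a(2) rt x by simp
  have s: "vscale E r (\<iota> (x, u)) \<in> carrier (vtotal E)" "vproj E (vscale E r (\<iota> (x, u))) = x"
    using vector_bundle_fibre(2)[OF E c] rt by auto
  show "\<iota> (x, r *\<^sub>R u) = vscale E r (\<iota> (x, u))"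
    using trivialized_left[OF pr t s(1)] trivialized_scale[OF pr t c] s(2) rt x by simp
  have "x \<in> carrier (vbase E)" using trivialized_openin[OF pr t] x openin_subset by blast
  then have z: "vzero E x \<in> carrier (vtotal E)" "vproj E (vzero E x) = x"
    using vector_bundle_fibre(3)[OF E] by auto
  show "\<iota> (x, 0) = vzero E x"
    using trivialized_left[OF pr t z(1)] trivialized_zero[OF E t x] z(2) x by simp
qed

lemma smooth_at_model_scaleR:
  assumes N: "smooth_atlas N" and f: "smooth_at N (model_manifold :: (real, real) manifold) f p"
    and g: "smooth_at N model_manifold g p"
  shows "smooth_at N model_manifold (\<lambda>x. f x *\<^sub>R g x) p"
proof -
  have "smooth_on UNIV (\<lambda>z :: real \<times> 'c. fst z *\<^sub>R snd z)"
    by (intro smooth_on_scaleR smooth_on_bounded_linear bounded_linear_fst bounded_linear_snd open_UNIV)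
  from smooth_at_model_comp[OF N smooth_at_model_Pair[OF N f g] this] show ?thesis by simp
qed

lemma smooth_at_model_sum:
  assumes N: "smooth_atlas N" "p \<in> carrier N" and f: "\<And>i. i \<in> I \<Longrightarrow> smooth_at N model_manifold (f i) p"
  shows "smooth_at N model_manifold (\<lambda>x. \<Sum>i\<in>I. f i x) p"
  using f
proof (induction I rule: infinite_finite_induct)
  case (insert i I)
  then show ?case using smooth_at_model_add[OF N(1), of "f i" p "\<lambda>x. \<Sum>i\<in>I. f i x"] by simp
qed (use smooth_at_const[OF N(1) smooth_atlas_model N(2)] in simp_all)

text \<open>Smoothness for each fixed vector gives joint smoothness: the moving vector is expanded
  along \<open>onb\<close>, leaving finitely many products of smooth functions.\<close>

lemma smooth_at_linear_family:
  fixes g :: "'y \<Rightarrow> 'a::euclidean_model \<Rightarrow> 'b::euclidean_model"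
  assumes N: "smooth_atlas N" and M: "smooth_atlas M" and X: "smooth_at N M X p" and Z: "smooth_at N model_manifold Z p"
    and U: "openin (mtop M) U" "X p \<in> U"
    and lin: "\<And>x. x \<in> U \<Longrightarrow> linear (g x)" and g: "\<And>z. smooth_at M model_manifold (\<lambda>x. g x z) (X p)"
  shows "smooth_at N model_manifold (\<lambda>e. g (X e) (Z e)) p"
proof -
  have p: "p \<in> carrier N" by (rule smooth_at_in_carrier(1)[OF N M X])
  have l: "linear (\<lambda>z. inner z b)" for b :: 'a by (simp add: linear_iff inner_add_left)
  have 1: "smooth_at N model_manifold (\<lambda>e. inner (Z e) b *\<^sub>R g (X e) b) p" for b
    by (intro smooth_at_model_scaleR[OF N smooth_at_model_linear[OF N Z l] smooth_at_compose[OF N M smooth_atlas_model X g]])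
  have 2: "smooth_at N model_manifold (\<lambda>e. \<Sum>b\<in>onb. inner (Z e) b *\<^sub>R g (X e) b) p"
    by (rule smooth_at_model_sum[OF N p 1])
  obtain O' where O': "openin (mtop N) O'" "p \<in> O'" "\<And>x. x \<in> O' \<Longrightarrow> X x \<in> U"
    by (rule smooth_at_nbhd[OF N M X U]) blast
  have eq: "(\<Sum>b\<in>onb. inner (Z e) b *\<^sub>R g (X e) b) = g (X e) (Z e)" if "e \<in> O'" for e
    by (rule linear_onb[OF lin[OF O'(3)[OF that]], symmetric])
  show ?thesis by (rule smooth_at_cong[OF N 2 O'(1,2) eq])
qed

locale dvb_sequence =
  fixes A :: "('a, 'em::euclidean_model \<times> 'fa::euclidean_model, 'm, 'em) vbundle"
    and B :: "('b, 'em \<times> 'fb::euclidean_model, 'm, 'em) vbundle"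
    and C :: "('c, 'em \<times> 'fc::euclidean_model, 'm, 'em) vbundle"
    and W :: "('w, 'em \<times> 'fw::euclidean_model, 'm, 'em) vbundle"
    and T :: "('t, 'em \<times> 'ft::euclidean_model, 'm, 'em) vbundle"
    and \<tau> :: "'a \<Rightarrow> 'b \<Rightarrow> 't" and \<e> :: "'c \<Rightarrow> 'w" and \<p> :: "'w \<Rightarrow> 't"
  assumes bA: "vector_bundle TYPE('fa) A" and baseA: "vbase A = vbase W"
    and bB: "vector_bundle TYPE('fb) B" and baseB: "vbase B = vbase W"
    and bC: "vector_bundle TYPE('fc) C" and baseC: "vbase C = vbase W"
    and bW: "vector_bundle TYPE('fw) W"
    and bT: "vector_bundle TYPE('ft) T" and baseT: "vbase T = vbase W"
    and tensor: "tensor_product_bundle A B T \<tau>"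
    and exact: "short_exact_sequence C \<e> W \<p> T"
begin

abbreviation "M \<equiv> vbase W"

lemmas pA = vector_bundle_smooth_projection[OF bA] and pB = vector_bundle_smooth_projection[OF bB]
  and pC = vector_bundle_smooth_projection[OF bC] and pW = vector_bundle_smooth_projection[OF bW]
  and pT = vector_bundle_smooth_projection[OF bT]

lemmas atA = smooth_projectionD(1)[OF pA] and atB = smooth_projectionD(1)[OF pB]
  and atC = smooth_projectionD(1)[OF pC] and atW = smooth_projectionD(1)[OF pW]
  and atT = smooth_projectionD(1)[OF pT] and atM = smooth_projectionD(2)[OF pW]

lemma \<p>_linear: "x \<in> carrier M \<Longrightarrow> linear_map_on (fibre W x) (vadd W) (vscale W) (fibre T x) (vadd T) (vscale T) \<p>"
  using exact by (simp add: short_exact_sequence_def vb_morphism_def)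

lemma \<e>_linear: "x \<in> carrier M \<Longrightarrow> linear_map_on (fibre C x) (vadd C) (vscale C) (fibre W x) (vadd W) (vscale W) \<e>"
  using exact by (simp add: short_exact_sequence_def vb_morphism_def)

lemma \<p>_smooth: "w \<in> carrier (vtotal W) \<Longrightarrow> smooth_at (vtotal W) (vtotal T) \<p> w"
  using exact by (simp add: short_exact_sequence_def vb_morphism_def smooth_map_iff[OF atW atT])

lemma \<tau>_linear:
  assumes "x \<in> carrier M"
  shows "a \<in> fibre A x \<Longrightarrow> linear_map_on (fibre B x) (vadd B) (vscale B) (fibre T x) (vadd T) (vscale T) (\<tau> a)"
    "b \<in> fibre B x \<Longrightarrow> linear_map_on (fibre A x) (vadd A) (vscale A) (fibre T x) (vadd T) (vscale T) (\<lambda>a. \<tau> a b)"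
  using tensor assms baseT unfolding tensor_product_bundle_def bilinear_on_fibres_def by auto

lemma \<tau>_fibre: "x \<in> carrier M \<Longrightarrow> a \<in> fibre A x \<Longrightarrow> b \<in> fibre B x \<Longrightarrow> \<tau> a b \<in> fibre T x"
  using \<tau>_linear(1)[of x a] by (simp add: linear_map_on_def)

lemma \<p>_fibre: "w \<in> carrier (vtotal W) \<Longrightarrow> \<p> w \<in> carrier (vtotal T) \<and> vproj T (\<p> w) = vproj W w"
  using \<p>_linear[OF smooth_projectionD(4)[OF pW]] by (auto simp: linear_map_on_def fibre_def)

text \<open>
  Over \<open>U\<close>, the linear map \<open>\<rho>\<close> is complementary to \<open>\<p>\<close> in the trivialisations: \<open>G x\<close> inverts
  \<open>w \<mapsto> (\<rho> w, \<p> w)\<close> on the typical fibre of \<open>W\<close>. Any linear left inverse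
  of \<open>\<e>\<close> at a single point is complementary there, and stays so nearby.
\<close>

definition split_chart ::
  "'m set \<Rightarrow> 'm set \<Rightarrow> ('m \<Rightarrow> 'em) \<Rightarrow> ('w \<Rightarrow> 'fw) \<Rightarrow> ('m \<times> 'fw \<Rightarrow> 'w) \<Rightarrow> ('a \<Rightarrow> 'fa) \<Rightarrow> ('m \<times> 'fa \<Rightarrow> 'a)
    \<Rightarrow> ('b \<Rightarrow> 'fb) \<Rightarrow> ('m \<times> 'fb \<Rightarrow> 'b) \<Rightarrow> ('t \<Rightarrow> 'ft) \<Rightarrow> ('m \<times> 'ft \<Rightarrow> 't) \<Rightarrow> ('fw \<Rightarrow> 'fc) \<Rightarrow> ('m \<Rightarrow> 'fc \<times> 'ft \<Rightarrow> 'fw) \<Rightarrow> bool"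
where
  "split_chart U Um \<kappa> \<omega> \<omega>i \<alpha> \<alpha>i \<beta> \<beta>i \<theta> \<theta>i \<rho> G \<longleftrightarrow>
     openin (mtop M) U \<and> (Um, \<kappa>) \<in> atlas M \<and> U \<subseteq> Um \<and>
     trivialized W U \<omega> \<omega>i \<and> trivialized A U \<alpha> \<alpha>i \<and> trivialized B U \<beta> \<beta>i \<and> trivialized T U \<theta> \<theta>i \<and>
     linear \<rho> \<and> (\<forall>x\<in>U. linear (G x)) \<and> (\<forall>x\<in>U. \<forall>z. smooth_at M model_manifold (\<lambda>x. G x z) x) \<and>
     (\<forall>x\<in>U. \<forall>w. G x (\<rho> w, \<theta> (\<p> (\<omega>i (x, w)))) = w) \<and>
     (\<forall>x\<in>U. \<forall>z. (\<rho> (G x z), \<theta> (\<p> (\<omega>i (x, G x z)))) = z)"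

text \<open>At \<open>x0\<close> exactness makes w \<mapsto> (\<open>\<rho> w\<close>,
  \<open>P x0 w\<close>) bijective. A vector killed by \<open>P x0\<close> has the form
  \<open>K c\<close>, and \<rho> returns c; a preimage under \<open>P x0\<close> can be corrected by
  some \<open>K c\<close> to attain any prescribed value of \<rho>. The inverse then extends
  smoothly to a neighbourhood, with \<rho> kept constant.\<close>

lemma split_chart_exists:
  assumes x0: "x0 \<in> carrier M"
  shows "\<exists>U Um \<kappa> \<omega> \<omega>i \<alpha> \<alpha>i \<beta> \<beta>i \<theta> \<theta>i \<rho> G. x0 \<in> U \<and> split_chart U Um \<kappa> \<omega> \<omega>i \<alpha> \<alpha>i \<beta> \<beta>i \<theta> \<theta>i \<rho> G"
proof -
  obtain Um \<kappa> where c: "(Um, \<kappa>) \<in> atlas M" "x0 \<in> Um" using chart_exists[OF atM x0] by blast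
  obtain UA and \<alpha> :: "'a \<Rightarrow> 'fa" and \<alpha>i where A: "x0 \<in> UA" "trivialized A UA \<alpha> \<alpha>i"
    by (rule vector_bundleE[OF bA x0[folded baseA]])
  obtain UB and \<beta> :: "'b \<Rightarrow> 'fb" and \<beta>i where B: "x0 \<in> UB" "trivialized B UB \<beta> \<beta>i"
    by (rule vector_bundleE[OF bB x0[folded baseB]])
  obtain UC and \<gamma> :: "'c \<Rightarrow> 'fc" and \<gamma>i where C: "x0 \<in> UC" "trivialized C UC \<gamma> \<gamma>i"
    by (rule vector_bundleE[OF bC x0[folded baseC]])
  obtain UW and \<omega> :: "'w \<Rightarrow> 'fw" and \<omega>i where W: "x0 \<in> UW" "trivialized W UW \<omega> \<omega>i"
    by (rule vector_bundleE[OF bW x0])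
  obtain UT and \<theta> :: "'t \<Rightarrow> 'ft" and \<theta>i where T: "x0 \<in> UT" "trivialized T UT \<theta> \<theta>i"
    by (rule vector_bundleE[OF bT x0[folded baseT]])
  define U0 where "U0 = Um \<inter> UA \<inter> UB \<inter> UW \<inter> UT"
  have U0: "openin (mtop M) U0"
    unfolding U0_def
    using chart_openin[OF atM c(1)] trivialized_openin[OF pA A(2)] trivialized_openin[OF pB B(2)]
      trivialized_openin[OF pW W(2)] trivialized_openin[OF pT T(2)] baseA baseB baseT by (simp add: openin_Int)
  have xU0: "x0 \<in> U0" using c A B W T by (simp add: U0_def)
  have U0c: "x \<in> carrier M" if "x \<in> U0" for x using U0 that openin_subset by blast
  have U0m: "U0 \<subseteq> Um" by (auto simp: U0_def)
  have tW: "trivialized W U0 \<omega> \<omega>i" by (rule trivialized_restrict[OF W(2) U0]) (auto simp: U0_def)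
  have tT: "trivialized T U0 \<theta> \<theta>i" by (rule trivialized_restrict[OF T(2)]) (use U0 baseT in \<open>auto simp: U0_def\<close>)
  define P where "P x w = \<theta> (\<p> (\<omega>i (x, w)))" for x w
  have Wi: "\<omega>i (x, w) \<in> carrier (vtotal W)" "vproj W (\<omega>i (x, w)) = x" if "x \<in> U0" for x w
    using trivialized_inv_carrier[OF pW tW that] trivialized_right[OF pW tW that] by auto
  have linP: "linear (P x)" if x: "x \<in> U0" for x
  proof (rule linearI)
    note l = \<p>_linear[OF U0c[OF x]]
    show "P x (u + v) = P x u + P x v" for u v
    proof -
      have "\<p> (\<omega>i (x, u + v)) = vadd T (\<p> (\<omega>i (x, u))) (\<p> (\<omega>i (x, v)))"
        using l Wi[OF x] by (simp add: trivialized_inv_linear(1)[OF bW tW x] linear_map_on_def fibre_def)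
      then show ?thesis
        using Wi[OF x] x \<p>_fibre unfolding P_def by (simp add: trivialized_add[OF pT tT])
    qed
    show "P x (r *\<^sub>R u) = r *\<^sub>R P x u" for r u
    proof -
      have "\<p> (\<omega>i (x, r *\<^sub>R u)) = vscale T r (\<p> (\<omega>i (x, u)))"
        using l Wi[OF x] by (simp add: trivialized_inv_linear(2)[OF bW tW x] linear_map_on_def fibre_def)
      then show ?thesis
        using Wi[OF x] x \<p>_fibre unfolding P_def by (simp add: trivialized_scale[OF pT tT])
    qed
  qed
  have smP: "smooth_at M model_manifold (\<lambda>x. P x w) x" if x: "x \<in> U0" for x w
  proof -
    have 1: "smooth_at M (vtotal W) (\<lambda>x. \<omega>i (x, w)) x"
      using U0c[OF x]
      by (intro smooth_at_trivialized_inv[OF pW tW atM smooth_at_id[OF atM] smooth_at_const[OF atM smooth_atlas_model]] x) auto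
    have 2: "smooth_at M (vtotal T) (\<lambda>x. \<p> (\<omega>i (x, w))) x"
      by (rule smooth_at_compose[OF atM atW atT 1 \<p>_smooth]) (use Wi[OF x] in auto)
    show ?thesis unfolding P_def
      by (rule smooth_at_compose[OF atM atT smooth_atlas_model 2 trivialized_smooth[OF pT tT]])
        (use Wi[OF x] \<p>_fibre x in auto)
  qed
  \<comment> \<open>The coordinate expression of \<open>\<e>\<close> at the single point
    \<open>x0\<close>; the trivialisation of C enters only there.\<close>
  define K where "K c = \<omega> (\<e> (\<gamma>i (x0, c)))" for c
  have Ci: "\<gamma>i (x0, c) \<in> fibre C x0" for c
    using trivialized_inv_carrier[OF pC C(2,1)] trivialized_right[OF pC C(2,1)] by (auto simp: fibre_def)
  have eC: "\<e> (\<gamma>i (x0, c)) \<in> fibre W x0" for c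
    using \<e>_linear[OF x0] Ci by (simp add: linear_map_on_def)
  have KW: "\<omega>i (x0, K c) = \<e> (\<gamma>i (x0, c))" for c
    using eC[of c] trivialized_left[OF pW tW, of "\<e> (\<gamma>i (x0, c))"] xU0 by (simp add: K_def fibre_def)
  have linK: "linear K"
  proof (rule linearI)
    show "K (u + v) = K u + K v" for u v
      using \<e>_linear[OF x0] Ci eC xU0
      by (simp add: K_def trivialized_inv_linear(1)[OF bC C(2,1)] linear_map_on_def fibre_def trivialized_add[OF pW tW])
    show "K (r *\<^sub>R u) = r *\<^sub>R K u" for r u
      using \<e>_linear[OF x0] Ci eC xU0
      by (simp add: K_def trivialized_inv_linear(2)[OF bC C(2,1)] linear_map_on_def fibre_def trivialized_scale[OF pW tW])
  qed
  have ex: "inj_on \<e> (fibre C x0)" "\<e> ` fibre C x0 = {w \<in> fibre W x0. \<p> w = vzero T x0}" "\<p> ` fibre W x0 = fibre T x0"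
    using exact x0 by (auto simp: short_exact_sequence_def)
  have "inj K"
  proof (rule injI)
    fix c c' assume "K c = K c'"
    then have "\<e> (\<gamma>i (x0, c)) = \<e> (\<gamma>i (x0, c'))" using KW by metis
    then have "\<gamma>i (x0, c) = \<gamma>i (x0, c')" using ex(1) Ci by (simp add: inj_on_eq_iff)
    then show "c = c'" using trivialized_right(2)[OF pC C(2,1)] by metis
  qed
  then obtain \<rho> where lin\<rho>: "linear \<rho>" and \<rho>K: "\<rho> \<circ> K = id"
    using linear_injective_left_inverse[OF linK] by blast
  have \<rho>K': "\<rho> (K c) = c" for c using \<rho>K by (simp add: fun_eq_iff)
  have \<theta>0: "\<theta> (vzero T x0) = 0" by (rule trivialized_zero[OF bT tT xU0])
  have PK: "P x0 (K c) = 0" for c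
  proof -
    have "\<e> (\<gamma>i (x0, c)) \<in> {w \<in> fibre W x0. \<p> w = vzero T x0}" using ex(2) Ci by blast
    then show ?thesis using \<theta>0 by (simp add: P_def KW)
  qed
  have kerP: "\<exists>c. w = K c" if "P x0 w = 0" for w
  proof -
    have "\<p> (\<omega>i (x0, w)) \<in> carrier (vtotal T)" "vproj T (\<p> (\<omega>i (x0, w))) = x0"
      using \<p>_fibre[OF Wi(1)[OF xU0]] Wi(2)[OF xU0] by auto
    then have "\<p> (\<omega>i (x0, w)) = vzero T x0"
      using trivialized_left[OF pT tT, of "\<p> (\<omega>i (x0, w))"] that xU0 trivialized_inv_linear(3)[OF bT tT xU0] by (simp add: P_def)
    then have "\<omega>i (x0, w) \<in> \<e> ` fibre C x0" using ex(2) Wi[OF xU0] by (simp add: fibre_def)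
    then obtain y where y: "y \<in> fibre C x0" "\<omega>i (x0, w) = \<e> y" by blast
    then have "y = \<gamma>i (x0, \<gamma> y)" using trivialized_left[OF pC C(2), of y] C(1) by (simp add: fibre_def)
    then have "K (\<gamma> y) = \<omega> (\<omega>i (x0, w))" using y by (simp add: K_def)
    then show ?thesis using trivialized_right(2)[OF pW tW xU0] by metis
  qed
  have surjP: "\<exists>w. P x0 w = t" for t
  proof -
    have "\<theta>i (x0, t) \<in> fibre T x0"
      using trivialized_inv_carrier[OF pT tT xU0] trivialized_right[OF pT tT xU0] by (simp add: fibre_def)
    then obtain w where w: "w \<in> fibre W x0" "\<p> w = \<theta>i (x0, t)" using ex(3) by (metis imageE)
    then have "\<omega>i (x0, \<omega> w) = w" using trivialized_left[OF pW tW, of w] xU0 by (simp add: fibre_def)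
    then have "P x0 (\<omega> w) = t" using w trivialized_right(2)[OF pT tT xU0] by (simp add: P_def)
    then show ?thesis by blast
  qed
  define k where "k = inv_into Um \<kappa>"
  define S where "S = \<kappa> ` U0"
  have S: "open S" unfolding S_def by (rule chart_open_image[OF atM c(1) U0 U0m])
  have k: "k (\<kappa> x) = x" if "x \<in> U0" for x
    using that chart_inv[OF atM c(1)] U0m by (auto simp: k_def)
  have kS: "k y \<in> U0" "\<kappa> (k y) = y" if "y \<in> S" for y using that k by (auto simp: S_def)
  \<comment> \<open>The family is moved to the model space by the inverse chart \<open>k\<close>,
    where the result on inverse families applies. Its first component does not depend on the
    point.\<close>
  define Q where "Q y w = (\<rho> w, P (k y) w)" for y w
  have linQ: "linear (Q y)" if "y \<in> S" for y
    using lin\<rho> linP[OF kS(1)[OF that]] by (simp add: Q_def linear_iff)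
  have smQ: "smooth_on S (\<lambda>y. Q y w)" for w
  proof (rule smooth_at_imp_smooth_on)
    fix y assume y: "y \<in> S"
    have sk: "smooth_at model_manifold M k y"
      unfolding k_def by (rule smooth_at_chart_inv[OF atM c(1)]) (use y U0m in \<open>auto simp: S_def\<close>)
    have 1: "smooth_at model_manifold model_manifold (\<lambda>y. P (k y) w) y"
      by (rule smooth_at_compose[OF smooth_atlas_model atM smooth_atlas_model sk smP[OF kS(1)[OF y]]])
    show "smooth_at model_manifold model_manifold (\<lambda>y. Q y w) y"
      unfolding Q_def
      by (rule smooth_at_model_Pair[OF smooth_atlas_model smooth_at_const[OF smooth_atlas_model smooth_atlas_model] 1]) auto
  qed
  have \<kappa>x0: "\<kappa> x0 \<in> S" using xU0 by (simp add: S_def)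
  have bijQ: "bij (Q (\<kappa> x0))"
    unfolding bij_def
  proof
    note l = linP[OF xU0]
    show "inj (Q (\<kappa> x0))"
      unfolding linear_injective_0[OF linQ[OF \<kappa>x0]]
    proof (intro allI impI)
      fix w assume "Q (\<kappa> x0) w = 0"
      then have w: "\<rho> w = 0" "P x0 w = 0" by (simp_all add: Q_def k[OF xU0] zero_prod_def)
      then obtain c where "w = K c" using kerP by blast
      then show "w = 0" using w(1) \<rho>K' linear_0[OF linK] by simp
    qed
    show "surj (Q (\<kappa> x0))"
      unfolding surj_def
    proof
      fix z :: "'fc \<times> 'ft"
      obtain w where w: "P x0 w = snd z" using surjP by blast
      \<comment> \<open>The correction lies in the kernel of \<open>P x0\<close>, so it adjusts the
        value of \<rho> without changing the value of \<open>P x0\<close>.\<close>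
      have "Q (\<kappa> x0) (w + K (fst z - \<rho> w)) = z"
        by (simp add: Q_def k[OF xU0] linear_add[OF lin\<rho>] linear_add[OF l] \<rho>K' PK w)
      then show "\<exists>w. z = Q (\<kappa> x0) w" by metis
    qed
  qed
  obtain S' H where S': "open S'" "\<kappa> x0 \<in> S'" "S' \<subseteq> S" and linH: "\<And>y. y \<in> S' \<Longrightarrow> linear (H y)"
    and HQ: "\<And>y w. y \<in> S' \<Longrightarrow> H y (Q y w) = w" and QH: "\<And>y z. y \<in> S' \<Longrightarrow> Q y (H y z) = z"
    and smH: "\<And>z. smooth_on S' (\<lambda>y. H y z)"
    using exists_smooth_inverse_family[OF S linQ smQ \<kappa>x0 bijQ] by metis
  define U where "U = U0 \<inter> {x \<in> Um. \<kappa> x \<in> S'}"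
  have U: "openin (mtop M) U" unfolding U_def
    by (intro openin_Int U0 chart_open_preimage[OF atM c(1) S'(1)])
  have US: "\<kappa> x \<in> S'" "x \<in> U0" if "x \<in> U" for x using that by (auto simp: U_def)
  have smG: "smooth_at M model_manifold (\<lambda>x. H (\<kappa> x) z) x" if x: "x \<in> U" for x z
  proof -
    have 1: "smooth_at M model_manifold \<kappa> x"
      by (rule smooth_at_chart[OF atM c(1)]) (use x in \<open>auto simp: U_def\<close>)
    have 2: "smooth_at model_manifold model_manifold (\<lambda>y. H y z) (\<kappa> x)"
      unfolding smooth_at_model_iff using S'(1) US[OF x] smH by blast
    show ?thesis by (rule smooth_at_compose[OF atM smooth_atlas_model smooth_atlas_model 1 2])
  qed
  have "split_chart U Um \<kappa> \<omega> \<omega>i \<alpha> \<alpha>i \<beta> \<beta>i \<theta> \<theta>i \<rho> (\<lambda>x. H (\<kappa> x))"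
    unfolding split_chart_def
  proof (intro conjI ballI allI U c(1) lin\<rho> smG)
    show "trivialized W U \<omega> \<omega>i" by (rule trivialized_restrict[OF W(2) U]) (auto simp: U_def U0_def)
    show "trivialized T U \<theta> \<theta>i" by (rule trivialized_restrict[OF T(2)]) (use U baseT in \<open>auto simp: U_def U0_def\<close>)
    show "trivialized A U \<alpha> \<alpha>i" by (rule trivialized_restrict[OF A(2)]) (use U baseA in \<open>auto simp: U_def U0_def\<close>)
    show "trivialized B U \<beta> \<beta>i" by (rule trivialized_restrict[OF B(2)]) (use U baseB in \<open>auto simp: U_def U0_def\<close>)
    fix x assume x: "x \<in> U"
    show "linear (H (\<kappa> x))" by (rule linH[OF US(1)[OF x]])
    show "H (\<kappa> x) (\<rho> w, \<theta> (\<p> (\<omega>i (x, w)))) = w" for w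
      using HQ[OF US(1)[OF x], of w] k[OF US(2)[OF x]] by (simp add: Q_def P_def)
    show "(\<rho> (H (\<kappa> x) z), \<theta> (\<p> (\<omega>i (x, H (\<kappa> x) z)))) = z" for z
      using QH[OF US(1)[OF x], of z] k[OF US(2)[OF x]] by (simp add: Q_def P_def)
  qed (auto simp: U_def)
  moreover have "x0 \<in> U" using xU0 S'(2) c(2) by (simp add: U_def)
  ultimately show ?thesis by blast
qed

subsection \<open>The double vector bundle of the sequence\<close>

abbreviation "X \<equiv> dvb_set W A B \<tau> \<p>"
abbreviation "N \<equiv> prod_manifold (vtotal W) (prod_manifold (vtotal A) (vtotal B))"

lemma atN: "smooth_atlas N" and atAB: "smooth_atlas (prod_manifold (vtotal A) (vtotal B))"
  using atW atA atB by simp_all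

lemma X_iff: "(w, a, b) \<in> X \<longleftrightarrow> w \<in> carrier (vtotal W) \<and> a \<in> carrier (vtotal A) \<and> b \<in> carrier (vtotal B) \<and>
   vproj A a = vproj W w \<and> vproj B b = vproj W w \<and> \<p> w = \<tau> a b"
  by (auto simp: dvb_set_def)

lemma X_subset: "X \<subseteq> carrier N"
  by (auto simp: dvb_set_def)

lemma base_carrier: "w \<in> carrier (vtotal W) \<Longrightarrow> vproj W w \<in> carrier M"
  by (rule smooth_projectionD(4)[OF pW])

text \<open>The common entry \<open>a\<close> is what makes the sum admissible: \<open>\<p>\<close>
  is linear on fibres, and \<tau> is linear in its second argument while the first is held
  fixed.\<close>

lemma X_add_vertical:
  assumes "(w1, a, b1) \<in> X" "(w2, a, b2) \<in> X"
  shows "(vadd W w1 w2, a, vadd B b1 b2) \<in> X"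
proof -
  note h = assms[unfolded X_iff]
  obtain x where f: "w1 \<in> fibre W x" "w2 \<in> fibre W x" "a \<in> fibre A x" "b1 \<in> fibre B x" "b2 \<in> fibre B x"
    by (rule that[of "vproj W w1"]) (use h in \<open>auto simp: fibre_def\<close>)
  then have x: "x \<in> carrier M" using base_carrier by (auto simp: fibre_def)
  note p = \<p>_linear[OF x] and t = \<tau>_linear(1)[OF x f(3)]
  have "\<p> (vadd W w1 w2) = vadd T (\<p> w1) (\<p> w2)"
    using p f by (simp add: linear_map_on_def)
  moreover have "\<tau> a (vadd B b1 b2) = vadd T (\<tau> a b1) (\<tau> a b2)"
    using t f by (simp add: linear_map_on_def)
  moreover have "vadd W w1 w2 \<in> carrier (vtotal W) \<and> vproj W (vadd W w1 w2) = vproj W w2"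
    using h by (intro vector_bundle_fibre(1)[OF bW]) auto
  moreover have "vadd B b1 b2 \<in> carrier (vtotal B) \<and> vproj B (vadd B b1 b2) = vproj B b2"
    using h by (intro vector_bundle_fibre(1)[OF bB]) auto
  ultimately show ?thesis using h by (simp add: X_iff)
qed

lemma X_add_horizontal:
  assumes "(w1, a1, b) \<in> X" "(w2, a2, b) \<in> X"
  shows "(vadd W w1 w2, vadd A a1 a2, b) \<in> X"
proof -
  note h = assms[unfolded X_iff]
  obtain x where f: "w1 \<in> fibre W x" "w2 \<in> fibre W x" "b \<in> fibre B x" "a1 \<in> fibre A x" "a2 \<in> fibre A x"
    by (rule that[of "vproj W w1"]) (use h in \<open>auto simp: fibre_def\<close>)
  then have x: "x \<in> carrier M" using base_carrier by (auto simp: fibre_def)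
  note p = \<p>_linear[OF x] and t = \<tau>_linear(2)[OF x f(3)]
  have "\<p> (vadd W w1 w2) = vadd T (\<p> w1) (\<p> w2)"
    using p f by (simp add: linear_map_on_def)
  moreover have "\<tau> (vadd A a1 a2) b = vadd T (\<tau> a1 b) (\<tau> a2 b)"
    using t f by (simp add: linear_map_on_def)
  moreover have "vadd W w1 w2 \<in> carrier (vtotal W) \<and> vproj W (vadd W w1 w2) = vproj W w2"
    using h by (intro vector_bundle_fibre(1)[OF bW]) auto
  moreover have "vadd A a1 a2 \<in> carrier (vtotal A) \<and> vproj A (vadd A a1 a2) = vproj A a2"
    using h by (intro vector_bundle_fibre(1)[OF bA]) auto
  ultimately show ?thesis using h by (simp add: X_iff)
qed

lemma X_scale:
  assumes "(w, a, b) \<in> X"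
  shows "(vscale W r w, a, vscale B r b) \<in> X" "(vscale W r w, vscale A r a, b) \<in> X"
proof -
  note h = assms[unfolded X_iff]
  obtain x where f: "w \<in> fibre W x" "a \<in> fibre A x" "b \<in> fibre B x"
    by (rule that[of "vproj W w"]) (use h in \<open>auto simp: fibre_def\<close>)
  then have x: "x \<in> carrier M" using base_carrier by (auto simp: fibre_def)
  have p: "\<p> (vscale W r w) = vscale T r (\<p> w)"
    using \<p>_linear[OF x] f by (simp add: linear_map_on_def)
  have t: "\<tau> a (vscale B r b) = vscale T r (\<tau> a b)" "\<tau> (vscale A r a) b = vscale T r (\<tau> a b)"
    using \<tau>_linear(1)[OF x f(2)] \<tau>_linear(2)[OF x f(3)] f by (simp_all add: linear_map_on_def)
  show "(vscale W r w, a, vscale B r b) \<in> X" "(vscale W r w, vscale A r a, b) \<in> X"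
    using h p t vector_bundle_fibre(2)[OF bW, of w r] vector_bundle_fibre(2)[OF bA, of a r] vector_bundle_fibre(2)[OF bB, of b r]
    by (simp_all add: X_iff)
qed

text \<open>A bilinear map vanishes when one argument is zero, matching the image of the zero vector
  under \<open>\<p>\<close>.\<close>

lemma X_zero:
  shows "a \<in> carrier (vtotal A) \<Longrightarrow> (vzero W (vproj A a), a, vzero B (vproj A a)) \<in> X"
    and "b \<in> carrier (vtotal B) \<Longrightarrow> (vzero W (vproj B b), vzero A (vproj B b), b) \<in> X"
proof -
  have z: "vzero W x \<in> carrier (vtotal W) \<and> vproj W (vzero W x) = x" "vzero A x \<in> carrier (vtotal A) \<and> vproj A (vzero A x) = x"
    "vzero B x \<in> carrier (vtotal B) \<and> vproj B (vzero B x) = x" "\<p> (vzero W x) = vzero T x" if "x \<in> carrier M" for x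
    using that baseA baseB baseT vector_bundle_fibre(3)[OF bW] vector_bundle_fibre(3)[OF bA] vector_bundle_fibre(3)[OF bB]
      linear_map_on_vzero[OF bW _ bT _ \<p>_linear] by simp_all
  show "(vzero W (vproj A a), a, vzero B (vproj A a)) \<in> X" if a: "a \<in> carrier (vtotal A)"
  proof -
    have x: "vproj A a \<in> carrier M" using smooth_projectionD(4)[OF pA a] baseA by simp
    have "\<tau> a (vzero B (vproj A a)) = vzero T (vproj A a)"
      using a x baseB baseT by (intro linear_map_on_vzero[OF bB _ bT _ \<tau>_linear(1)[OF x]]) (auto simp: fibre_def)
    then show ?thesis using z[OF x] a by (simp add: X_iff)
  qed
  show "(vzero W (vproj B b), vzero A (vproj B b), b) \<in> X" if b: "b \<in> carrier (vtotal B)"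
  proof -
    have x: "vproj B b \<in> carrier M" using smooth_projectionD(4)[OF pB b] baseB by simp
    have "\<tau> (vzero A (vproj B b)) b = vzero T (vproj B b)"
      using b x baseA baseT by (intro linear_map_on_vzero[OF bA _ bT _ \<tau>_linear(2)[OF x]]) (auto simp: fibre_def)
    then show ?thesis using z[OF x] b by (simp add: X_iff)
  qed
qed

lemma smooth_at_N:
  assumes "q \<in> carrier N"
  shows "smooth_at N (vtotal W) fst q" "smooth_at N (vtotal A) (\<lambda>z. fst (snd z)) q" "smooth_at N (vtotal B) (\<lambda>z. snd (snd z)) q"
proof -
  have q: "q \<in> carrier (vtotal W) \<times> carrier (prod_manifold (vtotal A) (vtotal B))" using assms by simp
  then have q': "snd q \<in> carrier (vtotal A) \<times> carrier (vtotal B)" by auto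
  note f = smooth_at_fst_snd[OF atW atAB q] and g = smooth_at_fst_snd[OF atA atB q']
  show "smooth_at N (vtotal W) fst q" by (rule f(1))
  show "smooth_at N (vtotal A) (\<lambda>z. fst (snd z)) q" by (rule smooth_at_compose[OF atN atAB atA f(2) g(1)])
  show "smooth_at N (vtotal B) (\<lambda>z. snd (snd z)) q" by (rule smooth_at_compose[OF atN atAB atB f(2) g(2)])
qed

section \<open>The chart of the double vector bundle attached to a splitting\<close>

context
  fixes U Um \<kappa> \<omega> \<omega>i \<alpha> \<alpha>i \<beta> \<beta>i \<theta> \<theta>i \<rho> G
  assumes sc: "split_chart U Um \<kappa> \<omega> \<omega>i \<alpha> \<alpha>i \<beta> \<beta>i \<theta> \<theta>i \<rho> G"
begin

lemma U_open: "openin (mtop M) U" and chartM: "(Um, \<kappa>) \<in> atlas M" and U_sub: "U \<subseteq> Um"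
  and tW: "trivialized W U \<omega> \<omega>i" and tA: "trivialized A U \<alpha> \<alpha>i" and tB: "trivialized B U \<beta> \<beta>i"
  and tT: "trivialized T U \<theta> \<theta>i" and lin\<rho>: "linear \<rho>"
  and linG: "x \<in> U \<Longrightarrow> linear (G x)" and smG: "x \<in> U \<Longrightarrow> smooth_at M model_manifold (\<lambda>x. G x z) x"
  and G_left: "x \<in> U \<Longrightarrow> G x (\<rho> w, \<theta> (\<p> (\<omega>i (x, w)))) = w"
  and G_right: "x \<in> U \<Longrightarrow> \<rho> (G x z) = fst z" "x \<in> U \<Longrightarrow> \<theta> (\<p> (\<omega>i (x, G x z))) = snd z"
proof -
  show "openin (mtop M) U" "(Um, \<kappa>) \<in> atlas M" "U \<subseteq> Um" "trivialized W U \<omega> \<omega>i" "trivialized A U \<alpha> \<alpha>i"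
    "trivialized B U \<beta> \<beta>i" "trivialized T U \<theta> \<theta>i" "linear \<rho>" using sc unfolding split_chart_def by blast+
  show "x \<in> U \<Longrightarrow> linear (G x)" "x \<in> U \<Longrightarrow> smooth_at M model_manifold (\<lambda>x. G x z) x"
    "x \<in> U \<Longrightarrow> G x (\<rho> w, \<theta> (\<p> (\<omega>i (x, w)))) = w"
    using sc unfolding split_chart_def by (simp_all del: split_paired_All)
  have "x \<in> U \<Longrightarrow> (\<rho> (G x z), \<theta> (\<p> (\<omega>i (x, G x z)))) = z" using sc unfolding split_chart_def by (simp del: split_paired_All)
  then show "x \<in> U \<Longrightarrow> \<rho> (G x z) = fst z" "x \<in> U \<Longrightarrow> \<theta> (\<p> (\<omega>i (x, G x z))) = snd z" by (metis fst_conv, metis snd_conv)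
qed

lemma U_carrier: "x \<in> U \<Longrightarrow> x \<in> carrier M"
  using U_open openin_subset by blast

text \<open>The fibre coordinate of a \<otimes> b as a function of the base point and the
  coordinates of a and b.\<close>

definition \<sigma> where "\<sigma> x u v = \<theta> (\<tau> (\<alpha>i (x, u)) (\<beta>i (x, v)))"

text \<open>The first entry is the unique element over the base point with core coordinate c whose
  image under \<open>\<p>\<close> is the prescribed tensor: D is a graph over the remaining
  coordinates.\<close>

definition \<Psi> where "\<Psi> z = (\<omega>i (fst z, G (fst z) (snd (snd (snd z)), \<sigma> (fst z) (fst (snd z)) (fst (snd (snd z))))),
    \<alpha>i (fst z, fst (snd z)), \<beta>i (fst z, fst (snd (snd z))))"

definition \<Phi> where "\<Phi> z = (\<kappa> (vproj W (fst z)), \<alpha> (fst (snd z)), \<beta> (snd (snd z)), \<rho> (\<omega> (fst z)))"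

text \<open>The three base points need not coincide, so this is open in the ambient product, and
  \<open>\<Phi>\<close> is defined and smooth on all of it rather than on D alone.\<close>

definition chart_dom where "chart_dom = {w \<in> carrier (vtotal W). vproj W w \<in> U} \<times>
    ({a \<in> carrier (vtotal A). vproj A a \<in> U} \<times> {b \<in> carrier (vtotal B). vproj B b \<in> U})"

lemma chart_dom_open: "openin (mtop N) chart_dom"
  unfolding chart_dom_def using U_open baseA baseB
  by (intro openin_Times_prod openin_over pW pA pB) simp_all

lemma side_inverse:
  assumes "x \<in> U"
  shows "\<alpha>i (x, u) \<in> carrier (vtotal A)" "vproj A (\<alpha>i (x, u)) = x" "\<alpha> (\<alpha>i (x, u)) = u"
    "\<beta>i (x, v) \<in> carrier (vtotal B)" "vproj B (\<beta>i (x, v)) = x" "\<beta> (\<beta>i (x, v)) = v"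
    "\<omega>i (x, w) \<in> carrier (vtotal W)" "vproj W (\<omega>i (x, w)) = x" "\<omega> (\<omega>i (x, w)) = w"
  using trivialized_inv_carrier[OF pA tA assms] trivialized_right[OF pA tA assms]
    trivialized_inv_carrier[OF pB tB assms] trivialized_right[OF pB tB assms]
    trivialized_inv_carrier[OF pW tW assms] trivialized_right[OF pW tW assms] by auto

lemma \<tau>_side_inverse:
  assumes "x \<in> U"
  shows "\<tau> (\<alpha>i (x, u)) (\<beta>i (x, v)) \<in> carrier (vtotal T)" "vproj T (\<tau> (\<alpha>i (x, u)) (\<beta>i (x, v))) = x"
  using \<tau>_fibre[OF U_carrier[OF assms], of "\<alpha>i (x, u)" "\<beta>i (x, v)"] side_inverse[OF assms]
  by (simp_all add: fibre_def)

text \<open>The two inverse trivialisations use the same base point, so the pair stays in the fibre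
  product, where smoothness of \<tau> is available.\<close>

lemma smooth_at_\<sigma>:
  assumes K: "smooth_atlas K" and x: "smooth_at K M x p" and xp: "x p \<in> U"
    and u: "smooth_at K model_manifold u p" and v: "smooth_at K model_manifold v p"
  shows "smooth_at K model_manifold (\<lambda>e. \<sigma> (x e) (u e) (v e)) p"
proof -
  have a: "smooth_at K (vtotal A) (\<lambda>e. \<alpha>i (x e, u e)) p"
    by (rule smooth_at_trivialized_inv[OF pA tA K x[folded baseA] u xp])
  have b: "smooth_at K (vtotal B) (\<lambda>e. \<beta>i (x e, v e)) p"
    by (rule smooth_at_trivialized_inv[OF pB tB K x[folded baseB] v xp])
  have ab: "smooth_at K (prod_manifold (vtotal A) (vtotal B)) (\<lambda>e. (\<alpha>i (x e, u e), \<beta>i (x e, v e))) p"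
    by (rule smooth_at_Pair[OF K atA atB a b])
  obtain Q where Q: "openin (mtop K) Q" "p \<in> Q" "\<And>e. e \<in> Q \<Longrightarrow> x e \<in> U"
    by (rule smooth_at_nbhd[OF K atM x U_open xp]) blast
  have QS: "(\<alpha>i (x e, u e), \<beta>i (x e, v e)) \<in> fibre_product A B" if "e \<in> Q" for e
    using side_inverse[OF Q(3)[OF that]] by (simp add: fibre_product_def)
  have \<tau>: "smooth_map_on (prod_manifold (vtotal A) (vtotal B)) (fibre_product A B) (vtotal T) (\<lambda>(a, b). \<tau> a b)"
    using tensor by (simp add: tensor_product_bundle_def)
  have 1: "smooth_at K (vtotal T) (\<lambda>e. \<tau> (\<alpha>i (x e, u e)) (\<beta>i (x e, v e))) p"
    using smooth_at_compose_map_on[OF K atAB atT \<tau> ab Q(1,2) QS] by simp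
  show ?thesis unfolding \<sigma>_def
    by (rule smooth_at_compose[OF K atT smooth_atlas_model 1 trivialized_smooth[OF pT tT]])
      (simp_all add: \<tau>_side_inverse[OF xp] xp)
qed

lemma smooth_at_\<Psi>:
  assumes K: "smooth_atlas K" and x: "smooth_at K M x p" and xp: "x p \<in> U" and z: "smooth_at K model_manifold z p"
  shows "smooth_at K N (\<lambda>e. \<Psi> (x e, z e)) p"
proof -
  have l: "linear (\<lambda>z. fst (snd z) :: 'fb)" "linear (\<lambda>z. snd (snd z) :: 'fc)" by (simp_all add: linear_iff)
  have u: "smooth_at K model_manifold (\<lambda>e. fst (z e)) p" by (rule smooth_at_model_linear[OF K z fst_snd_linear(1)])
  have v: "smooth_at K model_manifold (\<lambda>e. fst (snd (z e))) p" by (rule smooth_at_model_linear[OF K z l(1)])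
  have c: "smooth_at K model_manifold (\<lambda>e. snd (snd (z e))) p" by (rule smooth_at_model_linear[OF K z l(2)])
  \<comment> \<open>Both the isomorphism and its argument move; linearity of \<open>G x\<close>
    reduces this to smoothness for fixed arguments.\<close>
  have g: "smooth_at K model_manifold (\<lambda>e. G (x e) (snd (snd (z e)), \<sigma> (x e) (fst (z e)) (fst (snd (z e))))) p"
    by (rule smooth_at_linear_family[OF K atM x smooth_at_model_Pair[OF K c smooth_at_\<sigma>[OF K x xp u v]] U_open xp linG smG[OF xp]])
  show ?thesis
    using smooth_at_Pair[OF K atW atAB smooth_at_trivialized_inv[OF pW tW K x g xp]
      smooth_at_Pair[OF K atA atB smooth_at_trivialized_inv[OF pA tA K x[folded baseA] u xp]
        smooth_at_trivialized_inv[OF pB tB K x[folded baseB] v xp]]]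
    by (simp add: \<Psi>_def)
qed

text \<open>\<open>G\<close> prescribes the \<theta>-coordinate of the image under
  \<open>\<p>\<close> to be that of the tensor, and \<theta> is injective on the fibre over
  \<open>x\<close>.\<close>

lemma \<Psi>_in_X:
  assumes x: "x \<in> U"
  shows "\<Psi> (x, z) \<in> X"
proof -
  obtain u v c where z: "z = (u, v, c)" by (cases z)
  let ?w = "\<omega>i (x, G x (c, \<sigma> x u v))"
  have p: "\<p> ?w \<in> carrier (vtotal T)" "vproj T (\<p> ?w) = x"
    using \<p>_fibre[OF side_inverse(7)[OF x]] side_inverse(8)[OF x] by auto
  have "\<theta> (\<p> ?w) = \<theta> (\<tau> (\<alpha>i (x, u)) (\<beta>i (x, v)))"
    using G_right(2)[OF x, of "(c, \<sigma> x u v)"] by (simp add: \<sigma>_def)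
  then have "\<p> ?w = \<tau> (\<alpha>i (x, u)) (\<beta>i (x, v))"
    using trivialized_left[OF pT tT p(1)] trivialized_left[OF pT tT \<tau>_side_inverse(1)[OF x]] p(2) \<tau>_side_inverse(2)[OF x] x
    by metis
  then show ?thesis using side_inverse[OF x] by (simp add: \<Psi>_def X_iff z)
qed

text \<open>On D the tensor coordinate is that of \<open>\<p> w\<close>, so \<open>G\<close> is
  applied to exactly the pair that it inverts.\<close>

lemma \<Psi>_left:
  assumes X: "(w, a, b) \<in> X" and U: "vproj W w \<in> U"
  shows "\<Psi> (vproj W w, (\<alpha> a, \<beta> b, \<rho> (\<omega> w))) = (w, a, b)"
proof -
  note h = X[unfolded X_iff]
  have i: "\<alpha>i (vproj W w, \<alpha> a) = a" "\<beta>i (vproj W w, \<beta> b) = b" "\<omega>i (vproj W w, \<omega> w) = w"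
    using trivialized_left[OF pA tA, of a] trivialized_left[OF pB tB, of b] trivialized_left[OF pW tW, of w] h U by auto
  have "G (vproj W w) (\<rho> (\<omega> w), \<sigma> (vproj W w) (\<alpha> a) (\<beta> b)) = \<omega> w"
    using G_left[OF U, of "\<omega> w"] h by (simp add: \<sigma>_def i)
  then show ?thesis by (simp add: \<Psi>_def i)
qed

lemma \<Psi>_right:
  assumes "x \<in> U"
  shows "vproj W (fst (\<Psi> (x, (u, v, c)))) = x" "fst (snd (\<Psi> (x, (u, v, c)))) = \<alpha>i (x, u)"
    "snd (snd (\<Psi> (x, (u, v, c)))) = \<beta>i (x, v)" "\<rho> (\<omega> (fst (\<Psi> (x, (u, v, c))))) = c"
  using side_inverse[OF assms] G_right(1)[OF assms] by (simp_all add: \<Psi>_def)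

lemma \<Psi>_in_chart_dom: "x \<in> U \<Longrightarrow> \<Psi> (x, z) \<in> chart_dom"
  using side_inverse by (simp add: \<Psi>_def chart_dom_def)

lemma \<gamma>_smooth:
  assumes "q \<in> carrier N" "vproj W (fst q) \<in> U"
  shows "smooth_at N model_manifold (\<lambda>z. \<rho> (\<omega> (fst z))) q"
proof -
  have q: "fst q \<in> carrier (vtotal W)" using assms by auto
  show ?thesis
    by (rule smooth_at_model_linear[OF atN smooth_at_compose[OF atN atW smooth_atlas_model smooth_at_N(1)[OF assms(1)]
        trivialized_smooth[OF pW tW q assms(2)]] lin\<rho>])
qed

lemma \<Phi>_smooth:
  assumes q: "q \<in> chart_dom"
  shows "smooth_at N model_manifold \<Phi> q"
proof -
  have qN: "q \<in> carrier N" using q chart_dom_open openin_subset by blast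
  have d: "fst q \<in> carrier (vtotal W)" "vproj W (fst q) \<in> U" "fst (snd q) \<in> carrier (vtotal A)" "vproj A (fst (snd q)) \<in> U"
     "snd (snd q) \<in> carrier (vtotal B)" "vproj B (snd (snd q)) \<in> U" using q by (auto simp: chart_dom_def)
  note s = smooth_at_N[OF qN]
  have \<kappa>: "smooth_at M model_manifold \<kappa> (vproj W (fst q))"
    by (rule smooth_at_chart[OF atM chartM]) (use d U_sub in auto)
  have 1: "smooth_at N model_manifold (\<lambda>z. \<kappa> (vproj W (fst z))) q"
    by (rule smooth_at_compose[OF atN atM smooth_atlas_model smooth_at_compose[OF atN atW atM s(1) smooth_projectionD(3)[OF pW d(1)]] \<kappa>])
  show ?thesis unfolding \<Phi>_def[abs_def]
    by (rule smooth_at_model_Pair[OF atN 1 smooth_at_model_Pair[OF atN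
          smooth_at_compose[OF atN atA smooth_atlas_model s(2) trivialized_smooth[OF pA tA d(3,4)]]
          smooth_at_model_Pair[OF atN smooth_at_compose[OF atN atB smooth_atlas_model s(3) trivialized_smooth[OF pB tB d(5,6)]]
            \<gamma>_smooth[OF qN d(2)]]]])
qed

lemma \<kappa>_inv:
  assumes "y \<in> \<kappa> ` U"
  shows "inv_into Um \<kappa> y \<in> U" "\<kappa> (inv_into Um \<kappa> y) = y"
  using assms chart_inv[OF atM chartM] U_sub by auto

lemma \<Phi>_\<Psi>: "y \<in> \<kappa> ` U \<Longrightarrow> \<Phi> (\<Psi> (inv_into Um \<kappa> y, z)) = (y, z)"
  using \<Psi>_right[OF \<kappa>_inv(1)] \<kappa>_inv(2) side_inverse[OF \<kappa>_inv(1)] by (cases z) (simp add: \<Phi>_def)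

lemma \<Psi>_\<Phi>:
  assumes "q \<in> X \<inter> chart_dom"
  shows "\<Psi> (inv_into Um \<kappa> (fst (\<Phi> q)), snd (\<Phi> q)) = q" "fst (\<Phi> q) \<in> \<kappa> ` U"
proof -
  obtain w a b where q: "q = (w, a, b)" by (cases q)
  have w: "vproj W w \<in> U" using assms by (simp add: q chart_dom_def)
  then have "inv_into Um \<kappa> (\<kappa> (vproj W w)) = vproj W w" using chart_inv[OF atM chartM] U_sub by auto
  then show "\<Psi> (inv_into Um \<kappa> (fst (\<Phi> q)), snd (\<Phi> q)) = q"
    using \<Psi>_left[of w a b] assms w by (simp add: q \<Phi>_def)
  show "fst (\<Phi> q) \<in> \<kappa> ` U" using w by (simp add: q \<Phi>_def)
qed

lemma \<Phi>_image: "\<Phi> ` (X \<inter> chart_dom) = \<kappa> ` U \<times> UNIV"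
proof (intro equalityI subsetI)
  fix z assume "z \<in> \<Phi> ` (X \<inter> chart_dom)"
  then show "z \<in> \<kappa> ` U \<times> UNIV" using \<Psi>_\<Phi>(2) by (auto simp: mem_Times_iff)
next
  fix z assume "z \<in> \<kappa> ` U \<times> (UNIV :: ('fa \<times> 'fb \<times> 'fc) set)"
  then have z: "fst z \<in> \<kappa> ` U" by auto
  then have "\<Phi> (\<Psi> (inv_into Um \<kappa> (fst z), snd z)) = z" using \<Phi>_\<Psi> by simp
  moreover have "\<Psi> (inv_into Um \<kappa> (fst z), snd z) \<in> X \<inter> chart_dom"
    using \<Psi>_in_X[OF \<kappa>_inv(1)[OF z]] \<Psi>_in_chart_dom[OF \<kappa>_inv(1)[OF z]] by simp
  ultimately show "z \<in> \<Phi> ` (X \<inter> chart_dom)" by (metis image_eqI)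
qed

lemma \<Phi>_inj: "inj_on \<Phi> (X \<inter> chart_dom)"
  by (rule inj_on_inverseI[of _ "\<lambda>y. \<Psi> (inv_into Um \<kappa> (fst y), snd y)"]) (rule \<Psi>_\<Phi>(1))

lemma \<Phi>_image_open: "open (\<Phi> ` (X \<inter> chart_dom))"
  unfolding \<Phi>_image by (intro open_Times open_UNIV chart_open_image[OF atM chartM U_open U_sub])

lemma \<Phi>_inv_smooth:
  assumes y: "y \<in> \<Phi> ` (X \<inter> chart_dom)"
  shows "smooth_at model_manifold N (inv_into (X \<inter> chart_dom) \<Phi>) y"
proof -
  have y': "fst y \<in> \<kappa> ` U" using y unfolding \<Phi>_image by auto
  have i: "smooth_at model_manifold model_manifold (\<lambda>y. y) y" by (rule smooth_at_id) auto
  have f: "smooth_at model_manifold model_manifold fst y" "smooth_at model_manifold model_manifold snd y"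
    by (rule smooth_at_model_linear[OF smooth_atlas_model i fst_snd_linear(1)],
        rule smooth_at_model_linear[OF smooth_atlas_model i fst_snd_linear(2)])
  have k: "smooth_at model_manifold M (inv_into Um \<kappa>) (fst y)"
    by (rule smooth_at_chart_inv[OF atM chartM]) (use y' U_sub in auto)
  have x: "smooth_at model_manifold M (\<lambda>y. inv_into Um \<kappa> (fst y)) y"
    by (rule smooth_at_compose[OF smooth_atlas_model smooth_atlas_model atM f(1) k])
  have 1: "smooth_at model_manifold N (\<lambda>y. \<Psi> (inv_into Um \<kappa> (fst y), snd y)) y"
    by (rule smooth_at_\<Psi>[OF smooth_atlas_model x \<kappa>_inv(1)[OF y'] f(2)])
  have eq: "\<Psi> (inv_into Um \<kappa> (fst z), snd z) = inv_into (X \<inter> chart_dom) \<Phi> z" if "z \<in> \<Phi> ` (X \<inter> chart_dom)" for z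
  proof -
    from that obtain q where q: "q \<in> X \<inter> chart_dom" "z = \<Phi> q" by blast
    then show ?thesis using \<Psi>_\<Phi>(1)[OF q(1)] inv_into_f_f[OF \<Phi>_inj q(1)] by simp
  qed
  show ?thesis
    by (rule smooth_at_cong[OF smooth_atlas_model 1 _ y eq]) (use \<Phi>_image_open in \<open>simp_all add: openin_model\<close>)
qed

end

section \<open>The smooth structure on the double vector bundle\<close>

definition \<A> :: "(('w \<times> 'a \<times> 'b) set \<times> ('w \<times> 'a \<times> 'b \<Rightarrow> 'em \<times> 'fa \<times> 'fb \<times> 'fc)) set" where
  "\<A> = {c. \<exists>U Um \<kappa> \<omega> \<omega>i \<alpha> \<alpha>i \<beta> \<beta>i \<theta> \<theta>i \<rho> G. split_chart U Um \<kappa> \<omega> \<omega>i \<alpha> \<alpha>i \<beta> \<beta>i \<theta> \<theta>i \<rho> G \<and>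
      c = (X \<inter> chart_dom U, \<Phi> \<kappa> \<omega> \<alpha> \<beta> \<rho>)}"

lemma \<A>E:
  assumes "(V, \<phi>) \<in> \<A>"
  obtains U Um \<kappa> \<omega> \<omega>i \<alpha> \<alpha>i \<beta> \<beta>i \<theta> \<theta>i \<rho> G where "split_chart U Um \<kappa> \<omega> \<omega>i \<alpha> \<alpha>i \<beta> \<beta>i \<theta> \<theta>i \<rho> G"
    "V = X \<inter> chart_dom U" "\<phi> = \<Phi> \<kappa> \<omega> \<alpha> \<beta> \<rho>"
  using assms unfolding \<A>_def by blast

lemma submanifold_charts: "submanifold_charts N X \<A>"
proof
  show "smooth_manifold N"
    using bW bA bB by (simp add: vector_bundle_def)
  show "X \<subseteq> carrier N" by (rule X_subset)
  fix q assume q: "q \<in> X"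
  obtain w a b where e: "q = (w, a, b)" by (cases q)
  note h = q[unfolded e X_iff]
  obtain U Um \<kappa> \<omega> \<omega>i \<alpha> \<alpha>i \<beta> \<beta>i \<theta> \<theta>i \<rho> G where U: "vproj W w \<in> U"
    and sc: "split_chart U Um \<kappa> \<omega> \<omega>i \<alpha> \<alpha>i \<beta> \<beta>i \<theta> \<theta>i \<rho> G"
    using split_chart_exists[OF base_carrier[of w]] h by blast
  have "q \<in> X \<inter> chart_dom U" using q h U by (auto simp: e chart_dom_def[OF sc])
  moreover have "(X \<inter> chart_dom U, \<Phi> \<kappa> \<omega> \<alpha> \<beta> \<rho>) \<in> \<A>" unfolding \<A>_def using sc by blast
  ultimately show "\<exists>U \<phi>. (U, \<phi>) \<in> \<A> \<and> q \<in> U" by blast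
next
  fix V \<phi> assume "(V, \<phi>) \<in> \<A>"
  then obtain U Um \<kappa> \<omega> \<omega>i \<alpha> \<alpha>i \<beta> \<beta>i \<theta> \<theta>i \<rho> G where sc: "split_chart U Um \<kappa> \<omega> \<omega>i \<alpha> \<alpha>i \<beta> \<beta>i \<theta> \<theta>i \<rho> G"
    and e: "V = X \<inter> chart_dom U" "\<phi> = \<Phi> \<kappa> \<omega> \<alpha> \<beta> \<rho>" by (rule \<A>E)
  show "\<exists>O'. openin (mtop N) O' \<and> V = X \<inter> O' \<and> (\<forall>x\<in>O'. smooth_at N model_manifold \<phi> x)"
    using chart_dom_open[OF sc] \<Phi>_smooth[OF sc] e by (intro exI[of _ "chart_dom U"]) simp
  show "inj_on \<phi> V" unfolding e by (rule \<Phi>_inj[OF sc])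
  show "open (\<phi> ` V)" unfolding e by (rule \<Phi>_image_open[OF sc])
  show "smooth_at model_manifold N (inv_into V \<phi>) y" if "y \<in> \<phi> ` V" for y
    using that unfolding e by (rule \<Phi>_inv_smooth[OF sc])
qed

sublocale S: submanifold_charts N X \<A>
  by (rule submanifold_charts)

abbreviation "D \<equiv> S.submanifold"

lemma smooth_at_D:
  assumes "d \<in> X"
  shows "smooth_at D (vtotal W) fst d" "smooth_at D (vtotal A) (\<lambda>z. fst (snd z)) d" "smooth_at D (vtotal B) (\<lambda>z. snd (snd z)) d"
proof -
  have d: "d \<in> carrier N" using assms X_subset by blast
  show "smooth_at D (vtotal W) fst d" by (rule S.smooth_at_restrict[OF atW assms smooth_at_N(1)[OF d]])
  show "smooth_at D (vtotal A) (\<lambda>z. fst (snd z)) d" by (rule S.smooth_at_restrict[OF atA assms smooth_at_N(2)[OF d]])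
  show "smooth_at D (vtotal B) (\<lambda>z. snd (snd z)) d" by (rule S.smooth_at_restrict[OF atB assms smooth_at_N(3)[OF d]])
qed

text \<open>The core coordinate sees only the first entry of a triple, and both structures act on
  that entry by the operations of \<Omega>. Hence one fibrewise linear function is linear for
  both.\<close>

lemma dvb_chart_of_split_chart:
  assumes sc: "split_chart U Um \<kappa> \<omega> \<omega>i \<alpha> \<alpha>i \<beta> \<beta>i \<theta> \<theta>i \<rho> G"
  shows "dvb_chart (dvb_vertical D W A B) (dvb_horizontal D W A B) A B U \<alpha> \<alpha>i \<beta> \<beta>i
    (\<lambda>z. \<rho> (\<omega> (fst z))) (\<Psi> \<omega>i \<alpha>i \<beta>i \<theta> G)"
  unfolding dvb_chart_def
proof (intro conjI ballI allI impI; (elim conjE)?)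
  let ?V = "dvb_vertical D W A B" and ?H = "dvb_horizontal D W A B"
  have [simp]: "vtotal ?H = D" "vproj ?V = (\<lambda>(w, a, b). a)" "vproj ?H = (\<lambda>(w, a, b). b)"
    by (simp_all add: dvb_vertical_def dvb_horizontal_def)
  show "trivialized A U \<alpha> \<alpha>i" "trivialized B U \<beta> \<beta>i" using tA[OF sc] tB[OF sc] .
  note lin = lin\<rho>[OF sc]
  have \<rho>0: "\<rho> (\<omega> (vzero W x)) = 0" if "x \<in> U" for x
    using trivialized_zero[OF bW tW[OF sc] that] linear_0[OF lin] by simp
  {
    fix d assume "d \<in> carrier (vtotal ?H)" "vproj A (vproj ?V d) \<in> U"
    then obtain w a b where d: "d = (w, a, b)" and X: "(w, a, b) \<in> X" and U: "vproj A a \<in> U"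
      by (cases d) auto
    note h = X[unfolded X_iff]
    have dN: "d \<in> carrier N" using X X_subset d by blast
    show "smooth_at (vtotal ?H) model_manifold (\<lambda>z. \<rho> (\<omega> (fst z))) d"
      using S.smooth_at_restrict[OF smooth_atlas_model _ \<gamma>_smooth[OF sc dN]] X h U by (simp add: d)
    show "\<Psi> \<omega>i \<alpha>i \<beta>i \<theta> G (vproj A (vproj ?V d), \<alpha> (vproj ?V d), \<beta> (vproj ?H d), \<rho> (\<omega> (fst d))) = d"
      using \<Psi>_left[OF sc X] h U by (simp add: d)
    show "\<rho> (\<omega> (fst (vscale ?V r d))) = r *\<^sub>R \<rho> (\<omega> (fst d))" "\<rho> (\<omega> (fst (vscale ?H r d))) = r *\<^sub>R \<rho> (\<omega> (fst d))" for r
      using h U by (simp_all add: d dvb_vertical_def dvb_horizontal_def trivialized_scale[OF pW tW[OF sc]] linear_scale[OF lin])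
    fix d' assume "d' \<in> carrier (vtotal ?H)"
    then obtain w' a' b' where d': "d' = (w', a', b')" and X': "(w', a', b') \<in> X"
      by (cases d') auto
    note h' = X'[unfolded X_iff]
    have add: "\<rho> (\<omega> (vadd W w w')) = \<rho> (\<omega> w) + \<rho> (\<omega> w')" if "vproj W w = vproj W w'"
      using h h' U that by (simp add: trivialized_add[OF pW tW[OF sc]] linear_add[OF lin])
    show "\<rho> (\<omega> (fst (vadd ?V d d'))) = \<rho> (\<omega> (fst d)) + \<rho> (\<omega> (fst d'))" if "vproj ?V d = vproj ?V d'"
      using that add h h' by (simp add: d d' dvb_vertical_def)
    show "\<rho> (\<omega> (fst (vadd ?H d d'))) = \<rho> (\<omega> (fst d)) + \<rho> (\<omega> (fst d'))" if "vproj ?H d = vproj ?H d'"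
    proof -
      have "b = b'" using that by (simp add: d d')
      then have "vproj W w = vproj W w'" using h h' by metis
      then show ?thesis using add by (simp add: d d' dvb_horizontal_def)
    qed
  }
  {
    fix x u v c assume x: "x \<in> U"
    let ?M = "model_manifold :: ('fa \<times> 'fb \<times> 'fc, 'fa \<times> 'fb \<times> 'fc) manifold"
    let ?P = "prod_manifold M ?M"
    have P: "smooth_atlas ?P" using atM by simp
    have q: "(x, (u, v, c)) \<in> carrier M \<times> carrier ?M" using U_carrier[OF sc x] by simp
    note f = smooth_at_fst_snd[OF atM smooth_atlas_model q]
    have 1: "smooth_at ?P N (\<lambda>z. \<Psi> \<omega>i \<alpha>i \<beta>i \<theta> G (fst z, snd z)) (x, (u, v, c))"
      by (rule smooth_at_\<Psi>[OF sc P f(1) _ f(2)]) (simp add: x)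
    have Q: "openin (mtop ?P) (U \<times> UNIV)"
      by (rule openin_Times_prod[OF U_open[OF sc]]) (simp add: openin_model)
    \<comment> \<open>Smoothness into the ambient product upgrades to smoothness into D because all
      values over \<open>U\<close> lie in D.\<close>
    have "smooth_at ?P D (\<lambda>z. \<Psi> \<omega>i \<alpha>i \<beta>i \<theta> G (fst z, snd z)) (x, (u, v, c))"
      by (rule S.smooth_at_into_submanifold[OF P 1 Q]) (use x \<Psi>_in_X[OF sc] in auto)
    then show "smooth_at (prod_manifold (vbase A) model_manifold) (vtotal ?H) (\<Psi> \<omega>i \<alpha>i \<beta>i \<theta> G) (x, u, v, c)"
      by (simp add: baseA)
    show "vproj ?V (\<Psi> \<omega>i \<alpha>i \<beta>i \<theta> G (x, u, v, c)) = \<alpha>i (x, u)"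
      "vproj ?H (\<Psi> \<omega>i \<alpha>i \<beta>i \<theta> G (x, u, v, c)) = \<beta>i (x, v)"
      "\<rho> (\<omega> (fst (\<Psi> \<omega>i \<alpha>i \<beta>i \<theta> G (x, u, v, c)))) = c"
      using \<Psi>_right[OF sc x, of u v c] by (simp_all add: case_prod_beta)
  }
  show "\<rho> (\<omega> (fst (vzero ?V a))) = 0" if "vproj A a \<in> U" for a
    using \<rho>0[OF that] by (simp add: dvb_vertical_def)
  show "\<rho> (\<omega> (fst (vzero ?H b))) = 0" if "vproj B b \<in> U" for b
    using \<rho>0[OF that] by (simp add: dvb_horizontal_def)
qed

lemma dvb_data: "dvb_data TYPE('fc) (dvb_vertical D W A B) (dvb_horizontal D W A B) A B"
proof -
  let ?V = "dvb_vertical D W A B" and ?H = "dvb_horizontal D W A B"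
  have [simp]: "vtotal ?V = D" "vtotal ?H = D" "vbase ?V = vtotal A" "vbase ?H = vtotal B"
    "vproj ?V = (\<lambda>(w, a, b). a)" "vproj ?H = (\<lambda>(w, a, b). b)"
    by (simp_all add: dvb_vertical_def dvb_horizontal_def)
  show ?thesis
  proof (unfold_locales, goal_cases)
    \<comment> \<open>Goals 8 to 17 are the assumptions of \<open>dvb_data\<close> from
      \<open>sV\<close> to \<open>charts\<close>, in their order.\<close>
    case (8 d)
    then show ?case using smooth_at_D(2)[of d] by (simp add: case_prod_beta')
  next
    case (9 d)
    then show ?case using smooth_at_D(3)[of d] by (simp add: case_prod_beta')
  next
    case (10 d)
    then show ?case by (cases d) (simp add: X_iff)
  next
    case (11 d d')
    then show ?case using X_add_vertical by (cases d; cases d') (simp add: dvb_vertical_def)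
  next
    case (12 d d')
    then show ?case using X_add_horizontal by (cases d; cases d') (simp add: dvb_horizontal_def)
  next
    case (13 d r)
    then show ?case using X_scale(1) by (cases d) (simp add: dvb_vertical_def)
  next
    case (14 d r)
    then show ?case using X_scale(2) by (cases d) (simp add: dvb_horizontal_def)
  next
    case (15 a)
    then show ?case using X_zero(1) by (simp add: dvb_vertical_def)
  next
    case (16 b)
    then show ?case using X_zero(2) by (simp add: dvb_horizontal_def)
  next
    case (17 x)
    then have "x \<in> carrier M" using baseA by simp
    then obtain U Um \<kappa> \<omega> \<omega>i \<alpha> \<alpha>i \<beta> \<beta>i \<theta> \<theta>i \<rho> G where x: "x \<in> U"
      and sc: "split_chart U Um \<kappa> \<omega> \<omega>i \<alpha> \<alpha>i \<beta> \<beta>i \<theta> \<theta>i \<rho> G"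
      using split_chart_exists[of x] by blast
    show ?case by (intro exI conjI, rule x, rule dvb_chart_of_split_chart[OF sc])
  qed (use bA bB baseA baseB S.smooth_manifold_submanifold in simp_all)
qed

end

theorem theorem3p3:
  fixes M :: "('m, 'em::euclidean_model) manifold"
    and A :: "('a, 'em \<times> 'fa::euclidean_model, 'm, 'em) vbundle"
    and B :: "('b, 'em \<times> 'fb::euclidean_model, 'm, 'em) vbundle"
    and C :: "('c, 'em \<times> 'fc::euclidean_model, 'm, 'em) vbundle"
    and W :: "('w, 'em \<times> 'fw::euclidean_model, 'm, 'em) vbundle"
    and AB :: "('t, 'em \<times> 'ft::euclidean_model, 'm, 'em) vbundle"
    and \<tau> :: "'a \<Rightarrow> 'b \<Rightarrow> 't"
    and \<e> :: "'c \<Rightarrow> 'w" and \<p> :: "'w \<Rightarrow> 't"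
  assumes "smooth_manifold M"
    and "vector_bundle TYPE('fa) A" and "vbase A = M"
    and "vector_bundle TYPE('fb) B" and "vbase B = M"
    and "vector_bundle TYPE('fc) C" and "vbase C = M"
    and "vector_bundle TYPE('fw) W" and "vbase W = M"
    and "vector_bundle TYPE('ft) AB" and "vbase AB = M"
    and "tensor_product_bundle A B AB \<tau>"
    and "short_exact_sequence C \<e> W \<p> AB"
  shows "\<exists>D :: ('w \<times> 'a \<times> 'b, 'em \<times> 'fa \<times> 'fb \<times> 'fc) manifold.
    carrier D = dvb_set W A B \<tau> \<p> \<and>
    embedded_submanifold D (prod_manifold (vtotal W) (prod_manifold (vtotal A) (vtotal B))) \<and>
    double_vector_bundle TYPE('fb \<times> 'fc) TYPE('fa \<times> 'fc) TYPE('fa) TYPE('fb)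
      (dvb_vertical D W A B) (dvb_horizontal D W A B) A B"
proof -
  interpret dvb_sequence A B C W AB \<tau> \<e> \<p>
    using assms by unfold_locales simp_all
  show ?thesis
    by (rule exI[of _ D], intro conjI S.carrier_submanifold S.embedded dvb_data.double_vector_bundle[OF dvb_data])
qed

end
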